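(* Let $\mathbb{G}$ be a compact Hausdorff group acting continuously on a compact Hausdorff space $X$, and let $\alpha$ be an irreducible representation of $\mathbb{G}$. The isotypic component $C(X)_{\alpha}$ is finitely generated as a module over the invariant subalgebra $C(X)^{\mathbb{G}}$ if and only if the function $$X\ni x\longmapsto \dim \alpha^{\mathbb{G}_x}\in\mathbb{Z}_{\ge 0}$$ is locally constant.
   Context: $C(X)$ is the $C^*$-algebra of complex-valued continuous functions on $X$, with $\mathbb{G}$ acting by $(s\triangleright f)(x)=f(s^{-1}\triangleright x)$. $C(X)^{\mathbb{G}}\cong C(X/\mathbb{G})$ is the subalgebra of $\mathbb{G}$-invariant functions. Irreducible representations of a compact group are (strongly continuous, complex and hence) finite-dimensional. The $\alpha$-isotypic component is $C(X)_{\alpha}=\{f\in C(X) : \operatorname{span}(\mathbb{G}f)\cong \alpha^{n}\text{ as a representation for some integer } n\ge 0\}$; it is a $C(X)^{\mathbb{G}}$-submodule of $C(X)$. Finite generation is meant algebraically. $\mathbb{G}_x=\{s\in\mathbb{G} : s\triangleright x=x\}$ is the isotropy group of $x$, and for a closed subgroup $\mathbb{H}\le\mathbb{G}$, $\alpha^{\mathbb{H}}$ is the space of $\mathbb{H}$-invariant vectors in the carrier space of $\alpha$. *)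

theory Defs
  imports "HOL-Analysis.Analysis" "HOL-Library.Function_Algebras"
begin

text \<open>
  The group is a type of class \<open>topological_group_add\<close>. This class is not assumed commutative;
  the group law, unit and inverse of an arbitrary topological group are written
  \<open>s + t\<close>, \<open>0\<close> and \<open>- s\<close>.  The space is a subset \<open>X\<close> of a Hausdorff type with the subspace
  topology, so that the empty space is included.
\<close>

definition continuous_action :: "('g::topological_group_add \<Rightarrow> 'x::topological_space \<Rightarrow> 'x) \<Rightarrow> 'x set \<Rightarrow> bool" where
  "continuous_action act X \<longleftrightarrow>
     (\<forall>s. \<forall>x\<in>X. act s x \<in> X) \<and>
     (\<forall>x\<in>X. act 0 x = x) \<and>
     (\<forall>s t. \<forall>x\<in>X. act (s + t) x = act s (act t x)) \<and>
     continuous_on (UNIV \<times> X) (\<lambda>(s, x). act s x)"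

definition isotropy :: "('g \<Rightarrow> 'x \<Rightarrow> 'x) \<Rightarrow> 'x \<Rightarrow> 'g set" where
  "isotropy act x = {s. act s x = x}"


text \<open>
  A function on \<open>X\<close> is represented by its extension by \<open>0\<close> to the whole type, so that equality of
  HOL functions is equality on \<open>X\<close>.
\<close>

definition cont_functions :: "'x::topological_space set \<Rightarrow> ('x \<Rightarrow> complex) set" where
  "cont_functions X = {f. continuous_on X f \<and> (\<forall>x. x \<notin> X \<longrightarrow> f x = 0)}"

definition translate :: "('g::group_add \<Rightarrow> 'x \<Rightarrow> 'x) \<Rightarrow> 'x set \<Rightarrow> 'g \<Rightarrow> ('x \<Rightarrow> complex) \<Rightarrow> 'x \<Rightarrow> complex" where
  "translate act X s f = (\<lambda>x. if x \<in> X then f (act (- s) x) else 0)"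

definition invariant_functions ::
    "('g::group_add \<Rightarrow> 'x::topological_space \<Rightarrow> 'x) \<Rightarrow> 'x set \<Rightarrow> ('x \<Rightarrow> complex) set" where
  "invariant_functions act X = {f \<in> cont_functions X. \<forall>s. translate act X s f = f}"

definition cscale :: "complex \<Rightarrow> ('x \<Rightarrow> complex) \<Rightarrow> 'x \<Rightarrow> complex" where
  "cscale c f = (\<lambda>x. c * f x)"

global_interpretation cfun: vector_space cscale
  by unfold_locales (auto simp: cscale_def fun_eq_iff algebra_simps)


definition representation :: "('g::topological_group_add \<Rightarrow> complex^'n^'n) \<Rightarrow> bool" where
  "representation \<rho> \<longleftrightarrow>
     \<rho> 0 = mat 1 \<and>
     (\<forall>s t. \<rho> (s + t) = \<rho> s ** \<rho> t) \<and>
     (\<forall>v. continuous_on UNIV (\<lambda>s. \<rho> s *v v))"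

text \<open>The carrier space \<open>complex^'n\<close> is automatically nonzero, since types are nonempty.\<close>

definition irreducible_representation :: "('g::topological_group_add \<Rightarrow> complex^'n^'n) \<Rightarrow> bool" where
  "irreducible_representation \<rho> \<longleftrightarrow>
     representation \<rho> \<and>
     (\<forall>W. vec.subspace W \<and> (\<forall>s. \<forall>v\<in>W. \<rho> s *v v \<in> W) \<longrightarrow> W = {0} \<or> W = UNIV)"

definition fixed_vectors :: "('g \<Rightarrow> complex^'n^'n) \<Rightarrow> 'g set \<Rightarrow> (complex^'n) set" where
  "fixed_vectors \<rho> H = {v. \<forall>s\<in>H. \<rho> s *v v = v}"

text \<open>
  Isomorphism of two complex linear representations, each given by a scalar multiplication, an
  action and a carrier. No continuity is required of the intertwiner: below, the second carrier
  is always finite-dimensional.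
\<close>

definition rep_isomorphic ::
    "(complex \<Rightarrow> 'v \<Rightarrow> 'v) \<Rightarrow> ('g \<Rightarrow> 'v \<Rightarrow> 'v) \<Rightarrow> 'v::ab_group_add set \<Rightarrow>
     (complex \<Rightarrow> 'w \<Rightarrow> 'w) \<Rightarrow> ('g \<Rightarrow> 'w \<Rightarrow> 'w) \<Rightarrow> 'w::ab_group_add set \<Rightarrow> bool" where
  "rep_isomorphic scV actV V scW actW W \<longleftrightarrow>
     (\<exists>T. bij_betw T V W \<and>
          (\<forall>u\<in>V. \<forall>v\<in>V. T (u + v) = T u + T v) \<and>
          (\<forall>c. \<forall>v\<in>V. T (scV c v) = scW c (T v)) \<and>
          (\<forall>s. \<forall>v\<in>V. T (actV s v) = actW s (T v)))"

text \<open>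
  The \<open>n\<close>-fold direct sum of \<open>\<rho>\<close> acts on the sequences in \<open>complex^'n\<close> that vanish from index
  \<open>n\<close> on.
\<close>

definition isotypic_component ::
    "('g::topological_group_add \<Rightarrow> 'x::topological_space \<Rightarrow> 'x) \<Rightarrow> 'x set \<Rightarrow>
     ('g \<Rightarrow> complex^'n^'n) \<Rightarrow> ('x \<Rightarrow> complex) set" where
  "isotypic_component act X \<rho> =
     {f \<in> cont_functions X. \<exists>n::nat.
        rep_isomorphic
          cscale (translate act X) (cfun.span (range (\<lambda>s. translate act X s f)))
          (\<lambda>c v i. c *s v i) (\<lambda>s v i. \<rho> s *v v i) {v :: nat \<Rightarrow> complex^'n. \<forall>i\<ge>n. v i = 0}}"

definition finitely_generated_over :: "('x \<Rightarrow> complex) set \<Rightarrow> ('x \<Rightarrow> complex) set \<Rightarrow> bool" where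
  "finitely_generated_over A M \<longleftrightarrow>
     (\<exists>F. finite F \<and> F \<subseteq> M \<and> M = {(\<Sum>g\<in>F. a g * g) | a. \<forall>g\<in>F. a g \<in> A})"

end

theory Submission
  imports Defs "HOL-Computational_Algebra.Fundamental_Theorem_Algebra"
begin

text \<open>
  A function \<open>f\<close> lies in the isotypic component iff it is a sum of complex conjugates of coordinates
  of continuous equivariant maps from \<open>X\<close> into the contragredient representation, so finite
  generation can be decided for the module of equivariant maps.  Averaging Tietze extensions from
  orbits shows that these maps take at \<open>x\<close> exactly the values fixed by the isotropy group of \<open>x\<close>.

  If the dimension of the fixed space is locally constant, finitely many equivariant maps span it at
  every point, and Cramer's rule gives continuous coefficients, which are then averaged.
  Conversely, fix a point \<open>x0\<close> and measure the generators modulo a local frame of the fixed space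
  at \<open>x0\<close>.  After subtracting constant combinations of the frame the generators \<open>\<psi>\<close> vanish at
  \<open>x0\<close>; expressing \<open>\<psi> / sqrt \<bar>\<psi>\<bar>\<close> through the generators with bounded coefficients
  forces the components outside the frame to be zero near \<open>x0\<close>, so the dimension cannot jump.

  The averages come from von Neumann's mean: finite averages of right translates of a continuous
  function on a compact group come uniformly close to a constant.
\<close>

subsection \<open>The mean of a continuous function on a compact group\<close>

text \<open>The contragredient comes from evaluation. An intertwiner from \<open>\<alpha>\<close>
  into C(X), followed by evaluation at x, is a linear functional on the carrier; its Riesz vector
  for the standard hermitian form moves with x by \<open>adj (\<alpha> (- s))\<close>, and the
  antilinearity of that form produces the complex conjugates. As the matrices of
  \<open>\<alpha>\<close> need not be unitary, the fixed spaces of both representations are compared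
  through an invariant inner product.

  Two obstacles shape the proof. Generators of the module treat the coordinates of an equivariant
  map one at a time, so their coefficients combine to matrices; averaging conjugates of these and
  applying Schur's lemma makes them scalars. Secondly, a frame at a point stays independent nearby,
  so only an upward jump of the dimension has to be excluded. Expressing a generator through the
  generators says nothing, as the coefficient 1 is always available. Dividing it by a square root
  first, and multiplying back afterwards, leaves a factor that tends to zero at the point. A
  seminorm vanishing on the frame then gives Z \<le> \<delta> Z with \<delta> < 1, so Z = 0.\<close>

definition ravg :: "'g::group_add list \<Rightarrow> ('g \<Rightarrow> 'b::real_vector) \<Rightarrow> 'g \<Rightarrow> 'b" where
  "ravg ts f x = (\<Sum>t\<leftarrow>ts. f (x + t)) /\<^sub>R real (length ts)"

definition lavg :: "'g::group_add list \<Rightarrow> ('g \<Rightarrow> 'b::real_vector) \<Rightarrow> 'g \<Rightarrow> 'b" where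
  "lavg ts f x = (\<Sum>t\<leftarrow>ts. f (t + x)) /\<^sub>R real (length ts)"

definition oscillation_le :: "('g \<Rightarrow> 'b::real_normed_vector) \<Rightarrow> real \<Rightarrow> bool" where
  "oscillation_le f e \<longleftrightarrow> (\<forall>x y. norm (f x - f y) \<le> e)"

lemma list_average_in_convex:
  fixes f :: "'a \<Rightarrow> 'b::real_vector"
  assumes "convex C" "ts \<noteq> []" "\<And>t. t \<in> set ts \<Longrightarrow> f t \<in> C"
  shows "(\<Sum>t\<leftarrow>ts. f t) /\<^sub>R real (length ts) \<in> C"
proof -
  have "(\<Sum>i\<in>{0..<length ts}. (1 / real (length ts)) *\<^sub>R f (ts ! i)) \<in> C"
    by (rule convex_sum) (use assms in auto)
  then show ?thesis
    by (simp add: sum_list_sum_nth scaleR_sum_right inverse_eq_divide)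
qed

lemma ravg_in_convex:
  assumes "convex C" "ts \<noteq> []" "\<And>x. f x \<in> C"
  shows "ravg ts f x \<in> C"
  unfolding ravg_def by (rule list_average_in_convex) (use assms in auto)

lemma lavg_in_convex:
  assumes "convex C" "ts \<noteq> []" "\<And>x. f x \<in> C"
  shows "lavg ts f x \<in> C"
  unfolding lavg_def by (rule list_average_in_convex) (use assms in auto)

lemma sum_list_linear:
  assumes "linear L"
  shows "L (\<Sum>t\<leftarrow>ts. f t) = (\<Sum>t\<leftarrow>ts. L (f t))"
  by (induction ts) (use assms in \<open>auto simp: linear_0 linear_add\<close>)

lemma ravg_linear:
  assumes "linear L"
  shows "ravg ts (\<lambda>x. L (f x)) x = L (ravg ts f x)"
  unfolding ravg_def using assms by (simp add: sum_list_linear linear_cmul)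

text \<open>Lists instead of sets make this an identity: coinciding sums \<open>u + t\<close> have
  to be counted with multiplicity. It lets successive improvements be collected into a single
  average.\<close>

lemma ravg_ravg: "ravg us (ravg ts f) = ravg [u + t. u \<leftarrow> us, t \<leftarrow> ts] f"
proof
  fix x
  have "(\<Sum>u\<leftarrow>us. (\<Sum>t\<leftarrow>ts. f (x + u + t))) = (\<Sum>t\<leftarrow>[u + t. u \<leftarrow> us, t \<leftarrow> ts]. f (x + t))"
    by (induction us) (auto simp: comp_def add.assoc)
  moreover have "(\<Sum>u\<leftarrow>us. (\<Sum>t\<leftarrow>ts. f (x + u + t)) /\<^sub>R c) = (\<Sum>u\<leftarrow>us. (\<Sum>t\<leftarrow>ts. f (x + u + t))) /\<^sub>R c" for c
    by (induction us) (auto simp: scaleR_right_distrib)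
  moreover have "length [u + t. u \<leftarrow> us, t \<leftarrow> ts] = length us * length ts"
    by (induction us) auto
  ultimately show "ravg us (ravg ts f) x = ravg [u + t. u \<leftarrow> us, t \<leftarrow> ts] f x"
    by (simp add: ravg_def inverse_mult_distrib mult.commute)
qed

lemma ravg_lavg_commute:
  fixes f :: "'g::group_add \<Rightarrow> 'b::real_vector"
  shows "ravg ts (lavg us f) x = lavg us (ravg ts f) x"
proof -
  have swap: "(\<Sum>u\<leftarrow>us. (\<Sum>t\<leftarrow>ts. f (u + x + t))) = (\<Sum>t\<leftarrow>ts. (\<Sum>u\<leftarrow>us. f (u + x + t)))"
    by (induction us) (auto simp: sum_list_addf)
  have "linear (\<lambda>y::'b. y /\<^sub>R c)" for c
    by (simp add: linear_iff scaleR_right_distrib)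
  from sum_list_linear[OF this]
  have pull: "(\<Sum>t\<leftarrow>vs. g t /\<^sub>R c) = (\<Sum>t\<leftarrow>vs. g t) /\<^sub>R c" for vs :: "'g list" and g :: "'g \<Rightarrow> 'b" and c
    by metis
  show ?thesis
    unfolding ravg_def lavg_def using swap
    by (simp add: pull mult.commute add.assoc)
qed

lemma ravg_translate: "ravg ts (\<lambda>x. f (s + x)) x = ravg ts f (s + x)"
  by (simp add: ravg_def add.assoc)

lemma continuous_on_sum_list:
  fixes f :: "'a \<Rightarrow> 'c::topological_space \<Rightarrow> 'b::topological_monoid_add"
  shows "(\<And>t. t \<in> set ts \<Longrightarrow> continuous_on S (f t)) \<Longrightarrow> continuous_on S (\<lambda>x. \<Sum>t\<leftarrow>ts. f t x)"
  by (induction ts) (auto intro!: continuous_intros)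

lemma continuous_on_translate_right:
  fixes f :: "'g::topological_group_add \<Rightarrow> 'b::topological_space"
  assumes "continuous_on UNIV f"
  shows "continuous_on UNIV (\<lambda>x. f (x + t))"
  by (rule continuous_on_compose2[OF assms]) (auto intro!: continuous_intros)

lemma continuous_on_translate_left:
  fixes f :: "'g::topological_group_add \<Rightarrow> 'b::topological_space"
  assumes "continuous_on UNIV f"
  shows "continuous_on UNIV (\<lambda>x. f (t + x))"
  by (rule continuous_on_compose2[OF assms]) (auto intro!: continuous_intros)

lemma continuous_on_ravg:
  fixes f :: "'g::topological_group_add \<Rightarrow> 'b::real_normed_vector"
  assumes "continuous_on UNIV f"
  shows "continuous_on UNIV (ravg ts f)"
  unfolding ravg_def
  by (intro continuous_intros continuous_on_sum_list continuous_on_translate_right assms)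

text \<open>Closed balls are convex. One averaging puts \<open>ravg ts f z\<close> within
  \<open>e\<close> of every single value of \<open>f\<close>; averaging again, in the other
  argument, compares two averages.\<close>

lemma oscillation_le_ravg:
  assumes "oscillation_le f e" "ts \<noteq> []"
  shows "oscillation_le (ravg ts f) e"
  unfolding oscillation_le_def
proof (intro allI)
  fix x y
  have 1: "norm (ravg ts f z - f w) \<le> e" for z w
  proof -
    have "ravg ts f z \<in> cball (f w) e"
      by (rule ravg_in_convex) (use assms in \<open>auto simp: oscillation_le_def dist_norm\<close>)
    then show ?thesis by (simp add: dist_norm norm_minus_commute)
  qed
  have "ravg ts f x \<in> cball (ravg ts f y) e"
    by (rule ravg_in_convex)
       (use assms 1 in \<open>auto simp: dist_norm norm_minus_commute\<close>)
  then show "norm (ravg ts f x - ravg ts f y) \<le> e" by (simp add: dist_norm norm_minus_commute)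
qed

text \<open>The tube lemma: the open set of good pairs contains the slice {0} x UNIV, and
  compactness of the group gives a whole tube around it.\<close>

lemma uniform_left_translation:
  fixes f :: "'g::topological_group_add \<Rightarrow> 'b::real_normed_vector"
  assumes "compact (UNIV :: 'g set)" "continuous_on UNIV f" "e > 0"
  obtains U where "open U" "0 \<in> U" "\<And>u x. u \<in> U \<Longrightarrow> norm (f (u + x) - f x) < e"
proof -
  define W where "W = {p :: 'g \<times> 'g. norm (f (fst p + snd p) - f (snd p)) < e}"
  have "continuous_on UNIV (\<lambda>p :: 'g \<times> 'g. norm (f (fst p + snd p) - f (snd p)))"
    by (intro continuous_intros continuous_on_compose2[OF assms(2)]) auto
  then have "open W"
    unfolding W_def using open_Collect_less continuous_on_const by blast
  moreover have "{0} \<times> UNIV \<subseteq> W"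
    using assms(3) by (auto simp: W_def)
  ultimately obtain X0 where "0 \<in> X0" "open X0" "X0 \<times> UNIV \<subseteq> W"
    using Elementary_Topology.tube_lemma[of UNIV W 0] assms(1) by auto
  then have "norm (f (u + x) - f x) < e" if "u \<in> X0" for u x
    using that by (force simp: W_def)
  then show thesis using that \<open>open X0\<close> \<open>0 \<in> X0\<close> by blast
qed

text \<open>The oscillation is contracted repeatedly. Near a minimum point the current average is
  almost minimal, and finitely many translates of that neighbourhood cover the group, so a further
  average has at every point at least one small term. The number \<open>n\<close> of translates
  depends on \<open>f\<close> and \<open>e\<close> only, hence the contraction factor is the same in
  all rounds.\<close>

lemma ravg_oscillation_real:
  fixes f :: "'g::topological_group_add \<Rightarrow> real"
  assumes comp: "compact (UNIV :: 'g set)" and f: "continuous_on UNIV f" and "e > 0"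
  shows "\<exists>ts. ts \<noteq> [] \<and> oscillation_le (ravg ts f) e"
proof -
  obtain U where U: "open U" "0 \<in> U" "\<And>u x. u \<in> U \<Longrightarrow> norm (f (u + x) - f x) < e / 2"
    by (rule uniform_left_translation[OF comp f half_gt_zero[OF \<open>e > 0\<close>]]) blast
  have "open ((\<lambda>x. x + (- z)) -` U)" for z
    by (intro open_vimage U continuous_intros)
  moreover have "UNIV \<subseteq> (\<Union>z\<in>UNIV. (\<lambda>x. x + (- z)) -` U)"
    using U(2) by (simp add: subset_iff) (metis ab_left_minus add.right_inverse diff_self)
  ultimately obtain Z where Z: "finite Z" "UNIV \<subseteq> (\<Union>z\<in>Z. (\<lambda>x. x + (- z)) -` U)"
    using compactE_image[OF comp, of UNIV "\<lambda>z. (\<lambda>x. x + (- z)) -` U"] by auto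
  obtain zs where zs: "set zs = Z" using Z(1) finite_list by auto
  define n where "n = length zs"
  have "Z \<noteq> {}" using Z(2) by auto
  then have n: "n > 0" "zs \<noteq> []" using zs n_def by auto
  \<comment> \<open>One of \<open>n\<close> terms is within \<open>e / 2\<close> of the minimum, the
    other \<open>n - 1\<close> are bounded by the oscillation d only, so d becomes q d + e/(2n). The
    fixed point of this map is \<open>e / 2\<close>, and the excess over it shrinks by the factor
    \<open>q\<close>.\<close>
  define q where "q = 1 - 1 / real n"
  have q: "0 \<le> q" "q < 1" using n(1) by (auto simp: q_def)
  obtain D where D: "\<And>x. \<bar>f x\<bar> \<le> D"
  proof -
    have "bounded (range f)"
      by (intro compact_imp_bounded compact_continuous_image f comp)
    then show thesis using that by (auto simp: bounded_iff)
  qed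
  have step: "\<exists>ts. ts \<noteq> [] \<and> oscillation_le (ravg ts f) (q ^ i * (2 * D) + e / 2)" for i
  proof (induction i)
    case 0
    have "norm (ravg [0] f x - ravg [0] f y) \<le> 2 * D + e / 2" for x y
      using D[of x] D[of y] \<open>e > 0\<close> by (simp add: ravg_def)
    then show ?case by (auto simp: oscillation_le_def intro!: exI[of _ "[0]"])
  next
    case (Suc i)
    then obtain ts where ts: "ts \<noteq> []" "oscillation_le (ravg ts f) (q ^ i * (2 * D) + e / 2)" by auto
    define d where "d = q ^ i * (2 * D) + e / 2"
    define k where "k = ravg ts f"
    have "continuous_on UNIV k" unfolding k_def by (rule continuous_on_ravg[OF f])
    then obtain y where y: "\<And>x. k y \<le> k x"
      using continuous_attains_inf[OF comp] by auto
    have kd: "k x \<le> k y + d" for x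
      using ts(2) by (auto simp: k_def d_def oscillation_le_def abs_le_iff diff_le_eq add.commute)
    \<comment> \<open>Right averaging commutes with left translation, so the neighbourhood
      \<open>U\<close> found for \<open>f\<close> serves every average \<open>k\<close> of
      \<open>f\<close>.\<close>
    have kU: "k (u + y) \<le> k y + e / 2" if "u \<in> U" for u
    proof -
      have "f (u + x) - f x \<le> e / 2" for x
        using U(3)[OF that, of x] by (simp add: abs_less_iff del: less_divide_eq_numeral1)
      then have "ravg ts (\<lambda>x. f (u + x) - f x) y \<in> {..e/2}"
        by (intro ravg_in_convex ts(1)) (auto simp only: convex_real_interval atMost_iff)
      moreover have "ravg ts (\<lambda>x. f (u + x) - f x) y = k (u + y) - k y"
        by (simp add: k_def ravg_def sum_list_subtractf add.assoc algebra_simps)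
      ultimately show ?thesis by simp
    qed
    \<comment> \<open>If \<open>x + (- z)\<close> lies in \<open>U\<close>, adding
      \<open>- z + y\<close> on the right moves \<open>x\<close> into U + y, where \<open>k\<close>
      is nearly minimal.\<close>
    define us where "us = map (\<lambda>z. - z + y) zs"
    have us: "us \<noteq> []" "length us = n" using n by (auto simp: us_def n_def)
    have lower: "k y \<le> ravg us k x" for x
      using ravg_in_convex[of "{k y..}" us k x] us y by auto
    have upper: "ravg us k x \<le> k y + (q * d + e / (2 * real n))" for x
    proof -
      obtain z where z: "z \<in> Z" "x + (- z) \<in> U" using Z(2) by auto
      then obtain j where j: "j < n" "zs ! j = z" using zs n_def by (metis in_set_conv_nth)
      have kz: "k (x + us ! j) \<le> k y + e / 2"
      proof -
        have "x + us ! j = x + (- z) + y" using j by (simp only: us_def n_def nth_map add.assoc)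
        then show ?thesis using kU[OF z(2)] by simp
      qed
      have "(\<Sum>t\<leftarrow>us. k (x + t)) = (\<Sum>i<n. k (x + us ! i))"
        using us(2) by (simp add: sum_list_sum_nth atLeast0LessThan)
      also have "\<dots> = k (x + us ! j) + (\<Sum>i\<in>{..<n} - {j}. k (x + us ! i))"
        using j(1) by (simp add: sum.remove)
      also have "\<dots> \<le> (k y + e / 2) + (\<Sum>i\<in>{..<n} - {j}. k y + d)"
        by (intro add_mono kz sum_mono kd)
      also have "\<dots> = (k y + e / 2) + (real n - 1) * (k y + d)"
        using j(1) by (simp add: of_nat_diff)
      finally have "ravg us k x \<le> ((k y + e / 2) + (real n - 1) * (k y + d)) / real n"
        unfolding ravg_def using us(2) n(1) by (simp add: divide_simps)
      also have "\<dots> = k y + (q * d + e / (2 * real n))"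
        using n(1) by (simp add: q_def field_simps)
      finally show ?thesis .
    qed
    have "q * d + e / (2 * real n) = q ^ Suc i * (2 * D) + e / 2"
      using n(1) by (simp add: d_def q_def field_simps)
    then have "oscillation_le (ravg us k) (q ^ Suc i * (2 * D) + e / 2)"
      unfolding oscillation_le_def real_norm_def abs_le_iff
      using lower upper by (smt (verit))
    then have "oscillation_le (ravg [u + t. u \<leftarrow> us, t \<leftarrow> ts] f) (q ^ Suc i * (2 * D) + e / 2)"
      by (simp add: k_def ravg_ravg)
    moreover have "[u + t. u \<leftarrow> us, t \<leftarrow> ts] \<noteq> []"
      using us ts by (cases us; cases ts) auto
    ultimately show ?case by blast
  qed
  have "(\<lambda>i. q ^ i * (2 * D)) \<longlonglongrightarrow> 0"
    using q by (intro tendsto_mult_left_zero LIMSEQ_power_zero) auto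
  then have "\<forall>\<^sub>F i in sequentially. q ^ i * (2 * D) < e / 2"
    using \<open>e > 0\<close> by (intro order_tendstoD) auto
  then obtain i where "q ^ i * (2 * D) < e / 2" by (auto simp: eventually_sequentially)
  then have "q ^ i * (2 * D) + e / 2 \<le> e"
    by linarith
  moreover obtain ts where "ts \<noteq> []" "oscillation_le (ravg ts f) (q ^ i * (2 * D) + e / 2)"
    using step by blast
  ultimately show ?thesis
    by (intro exI[of _ ts]) (auto simp only: oscillation_le_def intro: order_trans)
qed

text \<open>Coordinates are treated one after another: by \<open>oscillation_le_ravg\<close> a later
  average does not spoil the coordinates already flattened. The tolerance is split over the
  \<open>DIM('b)\<close> basis vectors.\<close>

lemma ravg_oscillation:
  fixes f :: "'g::topological_group_add \<Rightarrow> 'b::euclidean_space"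
  assumes comp: "compact (UNIV :: 'g set)" and f: "continuous_on UNIV f" and "e > 0"
  shows "\<exists>ts. ts \<noteq> [] \<and> oscillation_le (ravg ts f) e"
proof -
  have lin: "linear (\<lambda>y::'b. y \<bullet> b)" for b
    by (simp add: linear_iff inner_add_left)
  have *: "\<exists>ts. ts \<noteq> [] \<and> (\<forall>b\<in>S. oscillation_le (\<lambda>x. ravg ts f x \<bullet> b) d)"
    if "finite S" "d > 0" for S d
    using that(1)
  proof (induction S rule: finite_induct)
    case empty
    show ?case by (auto intro: exI[of _ "[0]"])
  next
    case (insert b S)
    then obtain ts where ts: "ts \<noteq> []" "\<forall>b\<in>S. oscillation_le (\<lambda>x. ravg ts f x \<bullet> b) d" by auto
    have "continuous_on UNIV (\<lambda>x. ravg ts f x \<bullet> b)"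
      by (intro continuous_intros continuous_on_ravg f)
    from ravg_oscillation_real[OF comp this \<open>d > 0\<close>]
    obtain us where us: "us \<noteq> []" "oscillation_le (ravg us (\<lambda>x. ravg ts f x \<bullet> b)) d" by auto
    have eq: "ravg us (\<lambda>x. ravg ts f x \<bullet> c) = (\<lambda>x. ravg [u + t. u \<leftarrow> us, t \<leftarrow> ts] f x \<bullet> c)" for c
      by (auto simp: ravg_linear[OF lin] ravg_ravg)
    have "oscillation_le (\<lambda>x. ravg [u + t. u \<leftarrow> us, t \<leftarrow> ts] f x \<bullet> c) d" if "c \<in> insert b S" for c
      unfolding eq[symmetric]
      using that us ts by (auto intro: oscillation_le_ravg)
    moreover have "[u + t. u \<leftarrow> us, t \<leftarrow> ts] \<noteq> []"
      using us ts by (cases us; cases ts) auto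
    ultimately show ?case by blast
  qed
  define d where "d = e / real DIM('b)"
  have "d > 0" using \<open>e > 0\<close> by (simp add: d_def)
  from *[OF finite_Basis this]
  obtain ts where ts: "ts \<noteq> []" "\<forall>b\<in>Basis. oscillation_le (\<lambda>x. ravg ts f x \<bullet> b) d" by blast
  have "norm (ravg ts f x - ravg ts f y) \<le> e" for x y
  proof -
    have "norm (ravg ts f x - ravg ts f y) \<le> (\<Sum>b\<in>Basis. \<bar>(ravg ts f x - ravg ts f y) \<bullet> b\<bar>)"
      by (rule norm_le_l1)
    also have "\<dots> \<le> (\<Sum>b\<in>(Basis :: 'b set). d)"
      by (intro sum_mono) (use ts(2) in \<open>auto simp: oscillation_le_def inner_diff_left\<close>)
    also have "\<dots> = e" by (simp add: d_def)
    finally show ?thesis .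
  qed
  then show ?thesis using ts(1) by (auto simp: oscillation_le_def)
qed

text \<open>Inversion x |-> - x exchanges left and right translations.\<close>

lemma lavg_oscillation:
  fixes f :: "'g::topological_group_add \<Rightarrow> 'b::euclidean_space"
  assumes comp: "compact (UNIV :: 'g set)" and f: "continuous_on UNIV f" and "e > 0"
  shows "\<exists>ts. ts \<noteq> [] \<and> oscillation_le (lavg ts f) e"
proof -
  have "continuous_on UNIV (\<lambda>x. f (- x))"
    by (rule continuous_on_compose2[OF f]) (auto intro!: continuous_intros)
  from ravg_oscillation[OF comp this \<open>e > 0\<close>]
  obtain ts where ts: "ts \<noteq> []" "oscillation_le (ravg ts (\<lambda>x. f (- x))) e" by auto
  have "lavg (map uminus ts) f x = ravg ts (\<lambda>x. f (- x)) (- x)" for x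
    by (simp add: lavg_def ravg_def minus_add comp_def)
  then show ?thesis using ts
    by (intro exI[of _ "map uminus ts"]) (auto simp: oscillation_le_def)
qed

section \<open>Existence, uniqueness and invariance of the mean\<close>

definition is_mean :: "('g::group_add \<Rightarrow> 'b::real_normed_vector) \<Rightarrow> 'b \<Rightarrow> bool" where
  "is_mean f c \<longleftrightarrow> (\<forall>e>0. \<exists>ts. ts \<noteq> [] \<and> (\<forall>x. norm (ravg ts f x - c) \<le> e))"

text \<open>For continuous \<open>f\<close> on a compact group this is the integral against
  normalized Haar measure.\<close>

definition gmean :: "('g::group_add \<Rightarrow> 'b::real_normed_vector) \<Rightarrow> 'b" where
  "gmean f = (THE c. is_mean f c)"

text \<open>Left and right averages commute, so their near-constant values must agree.\<close>

lemma ravg_lavg_close: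
  fixes f :: "'g::topological_group_add \<Rightarrow> 'b::euclidean_space"
  assumes "us \<noteq> []" "ts \<noteq> []"
    and "\<And>x. norm (lavg us f x - b) \<le> d" "\<And>x. norm (ravg ts f x - a) \<le> e"
  shows "norm (a - b) \<le> d + e"
proof -
  have "ravg ts (lavg us f) 0 \<in> cball b d"
    by (rule ravg_in_convex) (use assms in \<open>auto simp: dist_norm norm_minus_commute\<close>)
  moreover have "lavg us (ravg ts f) 0 \<in> cball a e"
    by (rule lavg_in_convex) (use assms in \<open>auto simp: dist_norm norm_minus_commute\<close>)
  ultimately have "dist b (ravg ts (lavg us f) 0) \<le> d" "dist a (ravg ts (lavg us f) 0) \<le> e"
    by (auto simp: ravg_lavg_commute)
  then have "dist a b \<le> e + d" by metric
  then show ?thesis by (simp add: dist_norm)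
qed

text \<open>A left average of small oscillation is compared with both right averages by
  \<open>ravg_lavg_close\<close>; its own error \<open>r\<close> can be made arbitrarily
  small.\<close>

lemma ravg_close:
  fixes f :: "'g::topological_group_add \<Rightarrow> 'b::euclidean_space"
  assumes comp: "compact (UNIV :: 'g set)" and f: "continuous_on UNIV f"
    and "us \<noteq> []" "ts \<noteq> []"
    and "\<And>x. norm (ravg us f x - b) \<le> d" "\<And>x. norm (ravg ts f x - a) \<le> e"
  shows "norm (a - b) \<le> d + e"
proof (rule field_le_epsilon)
  fix r :: real assume "r > 0"
  then obtain vs where vs: "vs \<noteq> []" "oscillation_le (lavg vs f) (r/2)"
    using lavg_oscillation[OF comp f, of "r/2"] by auto
  then have *: "norm (lavg vs f x - lavg vs f 0) \<le> r/2" for x by (auto simp: oscillation_le_def)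
  have "norm (a - lavg vs f 0) \<le> r/2 + e" "norm (b - lavg vs f 0) \<le> r/2 + d"
    by (rule ravg_lavg_close[OF vs(1) _ *]; use assms in auto)+
  then show "norm (a - b) \<le> d + e + r"
    by (smt (verit) norm_triangle_ineq4 diff_diff_eq2 diff_add_cancel field_sum_of_halves norm_minus_commute norm_triangle_sub)
qed

lemma is_mean_unique:
  fixes f :: "'g::topological_group_add \<Rightarrow> 'b::euclidean_space"
  assumes comp: "compact (UNIV :: 'g set)" and f: "continuous_on UNIV f"
    and "is_mean f a" "is_mean f b"
  shows "a = b"
proof -
  have "norm (a - b) \<le> 0 + r" if "r > 0" for r
  proof -
    obtain ts us where "ts \<noteq> []" "us \<noteq> []" "\<And>x. norm (ravg ts f x - a) \<le> r/2"
      "\<And>x. norm (ravg us f x - b) \<le> r/2"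
      using assms(3,4) \<open>r > 0\<close> unfolding is_mean_def by (meson half_gt_zero)
    from ravg_close[OF comp f this(2,1,4,3)] show ?thesis by simp
  qed
  then have "norm (a - b) \<le> 0" by (rule field_le_epsilon)
  then show ?thesis by simp
qed

text \<open>Averages of oscillation at most 1/(n+1) exist, their values at 0 form a Cauchy sequence
  by \<open>ravg_close\<close>, and the limit is a mean.\<close>

lemma is_mean_gmean:
  fixes f :: "'g::topological_group_add \<Rightarrow> 'b::euclidean_space"
  assumes comp: "compact (UNIV :: 'g set)" and f: "continuous_on UNIV f"
  shows "is_mean f (gmean f)"
proof -
  have "\<exists>ts. ts \<noteq> [] \<and> oscillation_le (ravg ts f) (inverse (real (Suc n)))" for n
    by (rule ravg_oscillation[OF comp f]) auto
  then obtain T where T: "\<And>n. T n \<noteq> []" "\<And>n. oscillation_le (ravg (T n) f) (inverse (real (Suc n)))"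
    by metis
  define c where "c n = ravg (T n) f 0" for n
  have Tc: "norm (ravg (T n) f x - c n) \<le> inverse (real (Suc n))" for n x
    using T(2)[of n] by (auto simp: oscillation_le_def c_def)
  have cc: "norm (c m - c n) \<le> inverse (real (Suc n)) + inverse (real (Suc m))" for m n
    by (rule ravg_close[OF comp f T(1) T(1) Tc Tc])
  have "Cauchy c"
  proof (rule CauchyI)
    fix e :: real assume "e > 0"
    then obtain N where N: "inverse (real (Suc N)) < e / 2"
      using reals_Archimedean half_gt_zero by blast
    have "inverse (real (Suc n)) < e / 2" if "n \<ge> N" for n
      using N that by (smt (verit) le_imp_inverse_le of_nat_0_less_iff of_nat_mono Suc_le_mono zero_less_Suc)
    then show "\<exists>M. \<forall>m\<ge>M. \<forall>n\<ge>M. norm (c m - c n) < e"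
      using cc by (intro exI[of _ N]) (smt (verit) field_sum_of_halves)
  qed
  then obtain l where l: "c \<longlonglongrightarrow> l" by (meson Cauchy_convergent convergent_def)
  have "is_mean f l"
    unfolding is_mean_def
  proof (intro allI impI)
    fix e :: real assume "e > 0"
    have "\<forall>\<^sub>F n in sequentially. dist (c n) l < e / 2"
      using tendstoD[OF l half_gt_zero[OF \<open>e > 0\<close>]] .
    moreover have "\<forall>\<^sub>F n in sequentially. inverse (real (Suc n)) < e / 2"
      using LIMSEQ_inverse_real_of_nat \<open>e > 0\<close> by (intro order_tendstoD) auto
    ultimately have "\<forall>\<^sub>F n in sequentially. dist (c n) l < e / 2 \<and> inverse (real (Suc n)) < e / 2"
      by eventually_elim auto
    then obtain n where n: "norm (c n - l) < e / 2" "inverse (real (Suc n)) < e / 2"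
      by (auto simp: eventually_sequentially dist_norm)
    have "norm (ravg (T n) f x - l) \<le> e" for x
    proof -
      have "norm (ravg (T n) f x - l) \<le> norm (ravg (T n) f x - c n) + norm (c n - l)"
        using norm_triangle_ineq[of "ravg (T n) f x - c n" "c n - l"] by simp
      then show ?thesis using n Tc[of n x] by linarith
    qed
    then show "\<exists>ts. ts \<noteq> [] \<and> (\<forall>x. norm (ravg ts f x - l) \<le> e)" using T(1) by blast
  qed
  then show ?thesis
    unfolding gmean_def using is_mean_unique[OF comp f] by (metis theI)
qed

lemma gmean_eqI:
  fixes f :: "'g::topological_group_add \<Rightarrow> 'b::euclidean_space"
  assumes "compact (UNIV :: 'g set)" "continuous_on UNIV f" "is_mean f c"
  shows "gmean f = c"
  using is_mean_unique is_mean_gmean assms by blast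

lemma gmean_linear:
  fixes f :: "'g::topological_group_add \<Rightarrow> 'b::euclidean_space" and L :: "'b \<Rightarrow> 'c::euclidean_space"
  assumes comp: "compact (UNIV :: 'g set)" and f: "continuous_on UNIV f" and L: "linear L"
  shows "gmean (\<lambda>x. L (f x)) = L (gmean f)"
proof (rule gmean_eqI[OF comp])
  interpret L: bounded_linear L using L linear_conv_bounded_linear by blast
  show "continuous_on UNIV (\<lambda>x. L (f x))" by (intro L.continuous_on f)
  obtain K where K: "K > 0" "\<And>x. norm (L x) \<le> norm x * K" using L.pos_bounded by blast
  show "is_mean (\<lambda>x. L (f x)) (L (gmean f))"
    unfolding is_mean_def
  proof (intro allI impI)
    fix e :: real assume "e > 0"
    then have "e / K > 0" using K by simp
    then obtain ts where ts: "ts \<noteq> []" "\<And>x. norm (ravg ts f x - gmean f) \<le> e / K"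
      using is_mean_gmean[OF comp f] unfolding is_mean_def by meson
    have "norm (ravg ts (\<lambda>x. L (f x)) x - L (gmean f)) \<le> e" for x
    proof -
      have "norm (ravg ts (\<lambda>x. L (f x)) x - L (gmean f)) = norm (L (ravg ts f x - gmean f))"
        by (simp add: ravg_linear[OF L] L.diff)
      also have "\<dots> \<le> norm (ravg ts f x - gmean f) * K" by (rule K)
      also have "\<dots> \<le> e / K * K" using ts(2) K by (intro mult_right_mono) auto
      finally show ?thesis using K by simp
    qed
    then show "\<exists>ts. ts \<noteq> [] \<and> (\<forall>x. norm (ravg ts (\<lambda>x. L (f x)) x - L (gmean f)) \<le> e)"
      using ts(1) by blast
  qed
qed

lemma gmean_in_closed_convex:
  fixes f :: "'g::topological_group_add \<Rightarrow> 'b::euclidean_space"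
  assumes comp: "compact (UNIV :: 'g set)" and f: "continuous_on UNIV f"
    and C: "closed C" "convex C" "\<And>x. f x \<in> C"
  shows "gmean f \<in> C"
proof -
  have "\<exists>y\<in>C. dist y (gmean f) < e" if "e > 0" for e
  proof -
    have "e / 2 > 0" using that by simp
    then obtain ts where "ts \<noteq> []" "\<And>x. norm (ravg ts f x - gmean f) \<le> e / 2"
      using is_mean_gmean[OF comp f] unfolding is_mean_def by meson
    moreover have "e / 2 < e" using that by simp
    ultimately show ?thesis using C ravg_in_convex[of C ts f 0]
      by (intro bexI[of _ "ravg ts f 0"]) (auto simp only: dist_norm intro: le_less_trans)
  qed
  then show ?thesis using C(1) closed_approachable by blast
qed

text \<open>Right averages commute with left translation, so the lists that approximate the mean of
  \<open>f\<close> also do so for its translate.\<close>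

lemma gmean_translate:
  fixes f :: "'g::topological_group_add \<Rightarrow> 'b::euclidean_space"
  assumes comp: "compact (UNIV :: 'g set)" and f: "continuous_on UNIV f"
  shows "gmean (\<lambda>x. f (t + x)) = gmean f"
proof (rule gmean_eqI[OF comp])
  show "continuous_on UNIV (\<lambda>x. f (t + x))" by (rule continuous_on_translate_left[OF f])
  show "is_mean (\<lambda>x. f (t + x)) (gmean f)"
    using is_mean_gmean[OF comp f] unfolding is_mean_def ravg_translate by meson
qed

lemma gmean_const:
  assumes "compact (UNIV :: 'g::topological_group_add set)"
  shows "gmean (\<lambda>x::'g. c::'b::euclidean_space) = c"
  using gmean_in_closed_convex[OF assms, of "\<lambda>_. c" "{c}"] by auto

text \<open>The lists approximating the means of \<open>f\<close> and \<open>h\<close> may differ.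
  The pair (f, h) has common lists, and its mean is carried over by the linear maps
  \<open>fst\<close>, \<open>snd\<close> and addition.\<close>

lemma gmean_add:
  fixes f h :: "'g::topological_group_add \<Rightarrow> 'b::euclidean_space"
  assumes comp: "compact (UNIV :: 'g set)" and f: "continuous_on UNIV f" and h: "continuous_on UNIV h"
  shows "gmean (\<lambda>x. f x + h x) = gmean f + gmean h"
proof -
  have p: "continuous_on UNIV (\<lambda>x. (f x, h x))" by (intro continuous_intros f h)
  have "linear (\<lambda>p::'b\<times>'b. fst p + snd p)" "linear (fst :: 'b\<times>'b \<Rightarrow> 'b)" "linear (snd :: 'b\<times>'b \<Rightarrow> 'b)"
    by (auto simp: linear_iff scaleR_right_distrib)
  from this[THEN gmean_linear[OF comp p]] show ?thesis by simp
qed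

lemma gmean_sum:
  fixes f :: "'i \<Rightarrow> 'g::topological_group_add \<Rightarrow> 'b::euclidean_space"
  assumes comp: "compact (UNIV :: 'g set)" and "finite I"
    and f: "\<And>i. i \<in> I \<Longrightarrow> continuous_on UNIV (f i)"
  shows "gmean (\<lambda>x. \<Sum>i\<in>I. f i x) = (\<Sum>i\<in>I. gmean (f i))"
  using assms(2,3)
  by (induction I rule: finite_induct)
     (simp_all add: gmean_const[OF comp] gmean_add[OF comp] continuous_on_sum)

lemma norm_gmean_le:
  fixes f :: "'g::topological_group_add \<Rightarrow> 'b::euclidean_space"
  assumes "compact (UNIV :: 'g set)" "continuous_on UNIV f" "\<And>x. norm (f x) \<le> e"
  shows "norm (gmean f) \<le> e"
  using gmean_in_closed_convex[OF assms(1,2), of "cball 0 e"] assms(3) by auto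

text \<open>Compactness of the group makes the continuity in x uniform in s, and the mean does not
  increase a uniform bound.\<close>

lemma continuous_on_gmean:
  fixes h :: "'g::topological_group_add \<Rightarrow> 'x::topological_space \<Rightarrow> 'b::euclidean_space"
  assumes comp: "compact (UNIV :: 'g set)" and h: "continuous_on (UNIV \<times> X) (\<lambda>(s, x). h s x)"
  shows "continuous_on X (\<lambda>x. gmean (\<lambda>s. h s x))"
proof -
  have hx: "continuous_on UNIV (\<lambda>s. h s x)" if "x \<in> X" for x
    using continuous_on_compose2[OF h, of UNIV "\<lambda>s. (s, x)"] that
    by (auto simp: image_subset_iff continuous_on_Pair)
  have nbhd: "\<exists>A. open A \<and> x \<in> A \<and> (\<forall>y\<in>A \<inter> X. dist (gmean (\<lambda>s. h s y)) (gmean (\<lambda>s. h s x)) \<le> e)"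
    if x: "x \<in> X" and e: "e > 0" for x e
  proof -
    have "continuous_on (X \<times> UNIV) (\<lambda>(x, s). h s x)"
      using continuous_on_compose2[OF h continuous_on_swap, of "X \<times> UNIV"]
      by (simp add: case_prod_unfold product_swap)
    then obtain A where A: "x \<in> A" "open A" "\<And>y s. y \<in> A \<inter> X \<Longrightarrow> dist (h s y) (h s x) \<le> e"
      using continuous_on_prod_compactE[OF _ comp x e] by (smt (verit) UNIV_I case_prod_conv)
    have "dist (gmean (\<lambda>s. h s y)) (gmean (\<lambda>s. h s x)) \<le> e" if y: "y \<in> A \<inter> X" for y
    proof -
      have d: "norm (h s y - h s x) \<le> e" for s
        using A(3)[OF y] by (simp add: dist_norm)
      have "gmean (\<lambda>s. h s y) - gmean (\<lambda>s. h s x) = gmean (\<lambda>s. h s y - h s x)"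
      proof -
        have "gmean (\<lambda>s. (h s y - h s x) + h s x) = gmean (\<lambda>s. h s y - h s x) + gmean (\<lambda>s. h s x)"
          by (intro gmean_add[OF comp] continuous_intros hx) (use x y in auto)
        then show ?thesis by simp
      qed
      also have "norm \<dots> \<le> e"
        by (rule norm_gmean_le[OF comp]) (use x y d in \<open>auto intro!: continuous_intros hx\<close>)
      finally show ?thesis by (simp add: dist_norm)
    qed
    then show ?thesis using A by blast
  qed
  show ?thesis
    unfolding continuous_on_def
  proof (intro ballI tendstoI)
    fix x and e :: real assume x: "x \<in> X" "e > 0"
    then obtain A where "open A" "x \<in> A"
      "\<And>y. y \<in> A \<inter> X \<Longrightarrow> dist (gmean (\<lambda>s. h s y)) (gmean (\<lambda>s. h s x)) \<le> e/2"
      using nbhd[of x "e/2"] by auto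
    then show "\<forall>\<^sub>F y in at x within X. dist (gmean (\<lambda>s. h s y)) (gmean (\<lambda>s. h s x)) < e"
      unfolding eventually_at_topological using x(2)
      by (intro exI[of _ A]) (auto intro: le_less_trans[of _ "e/2"])
  qed
qed

subsection \<open>Equivariant maps\<close>

lemma continuous_on_matrix_vector_mult [continuous_intros]:
  fixes A :: "'a::topological_space \<Rightarrow> complex^'n^'m"
  assumes "continuous_on S A" "continuous_on S v"
  shows "continuous_on S (\<lambda>x. A x *v v x)"
  unfolding matrix_vector_mult_def by (intro continuous_intros assms)

lemma continuous_on_matrix_mult [continuous_intros]:
  fixes A :: "'a::topological_space \<Rightarrow> complex^'n^'m"
  assumes "continuous_on S A" "continuous_on S B"
  shows "continuous_on S (\<lambda>x. A x ** B x)"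
  unfolding matrix_matrix_mult_def by (intro continuous_intros assms)

lemma matrix_vector_mult_axis_nth: "(A *v axis j 1) $ i = A $ i $ j"
  for A :: "'a::field^'n^'m"
  by (simp add: matrix_vector_mult_def axis_def if_distrib[of "(*) _"] cong: if_cong)

lemma representation_zero: "representation \<sigma> \<Longrightarrow> \<sigma> 0 = mat 1"
  and representation_add: "representation \<sigma> \<Longrightarrow> \<sigma> (s + t) = \<sigma> s ** \<sigma> t"
  by (auto simp: representation_def)

lemma representation_add_vec: "representation \<sigma> \<Longrightarrow> \<sigma> (s + t) *v v = \<sigma> s *v (\<sigma> t *v v)"
  by (simp add: representation_add matrix_vector_mul_assoc)

lemma representation_minus_left [simp]: "representation \<sigma> \<Longrightarrow> \<sigma> (- s) *v (\<sigma> s *v v) = v"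
  and representation_minus_right [simp]: "representation \<sigma> \<Longrightarrow> \<sigma> s *v (\<sigma> (- s) *v v) = v"
  using representation_add_vec[of \<sigma> "- s" s v] representation_add_vec[of \<sigma> s "- s" v]
  by (simp_all add: representation_zero)

lemma continuous_on_representation:
  fixes \<sigma> :: "'g::topological_group_add \<Rightarrow> complex^'n^'n"
  assumes "representation \<sigma>"
  shows "continuous_on UNIV \<sigma>"
proof -
  have "continuous_on UNIV (\<lambda>s. \<sigma> s *v axis j 1)" for j
    using assms by (simp add: representation_def)
  then have "continuous_on UNIV (\<lambda>s. \<chi> i j. (\<sigma> s *v axis j 1) $ i)"
    by (intro continuous_on_vec_lambda continuous_on_component)
  then show ?thesis by (simp add: matrix_vector_mult_axis_nth)
qed

section \<open>Extension of vector-valued maps from compact subsets\<close>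

lemma compact_t2_normal_space:
  fixes X :: "'x::t2_space set"
  assumes "compact X"
  shows "normal_space (top_of_set X)"
proof (rule compact_Hausdorff_or_regular_imp_normal_space)
  show "compact_space (top_of_set X)"
    using assms by (simp add: compact_space_subtopology)
  have "Hausdorff_space (euclidean :: 'x topology)"
    unfolding Hausdorff_space_def disjnt_def using hausdorff by fastforce
  then show "Hausdorff_space (top_of_set X) \<or> regular_space (top_of_set X)"
    by (simp add: Hausdorff_space_subtopology)
qed

lemma tietze_euclidean:
  fixes f :: "'x::t2_space \<Rightarrow> 'b::euclidean_space"
  assumes X: "compact X" and K: "compact K" "K \<subseteq> X" and f: "continuous_on K f"
  obtains g where "continuous_on X g" "\<And>x. x \<in> K \<Longrightarrow> g x = f x"
proof -
  have cl: "closedin (top_of_set X) K"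
    using K by (simp add: closed_subset compact_imp_closed)
  have eq: "subtopology (top_of_set X) K = top_of_set K"
    using K by (simp add: subtopology_subtopology inf_absorb2)
  have "\<exists>g. continuous_on X g \<and> (\<forall>x\<in>K. g x = f x \<bullet> b)" for b
  proof -
    have fb: "continuous_map (subtopology (top_of_set X) K) euclideanreal (\<lambda>x. f x \<bullet> b)"
      unfolding eq continuous_map_iff_continuous by (intro continuous_intros f)
    show ?thesis
    proof (rule Tietze_extension_realinterval[OF compact_t2_normal_space[OF X] cl is_interval_univ UNIV_not_empty fb subset_UNIV])
      fix g assume "continuous_map (top_of_set X) euclideanreal g" and g: "\<And>x. x \<in> K \<Longrightarrow> g x = f x \<bullet> b"
      then have "continuous_on X g" by (simp add: continuous_map_iff_continuous)
      then show "\<exists>g. continuous_on X g \<and> (\<forall>x\<in>K. g x = f x \<bullet> b)" using g by blast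
    qed
  qed
  then have "\<forall>b. \<exists>g. continuous_on X g \<and> (\<forall>x\<in>K. g x = f x \<bullet> b)"
    by blast
  from choice[OF this]
  obtain g where g: "\<And>b. continuous_on X (g b)" "\<And>b x. x \<in> K \<Longrightarrow> g b x = f x \<bullet> b"
    by blast
  show thesis
  proof
    show "continuous_on X (\<lambda>x. \<Sum>b\<in>Basis. g b x *\<^sub>R b)" by (intro continuous_intros g)
    show "(\<Sum>b\<in>Basis. g b x *\<^sub>R b) = f x" if "x \<in> K" for x
      using that by (simp add: g euclidean_representation)
  qed
qed

definition equivariant_maps ::
    "('g::topological_group_add \<Rightarrow> 'x::topological_space \<Rightarrow> 'x) \<Rightarrow> 'x set \<Rightarrow>
     ('g \<Rightarrow> complex^'n^'n) \<Rightarrow> ('x \<Rightarrow> complex^'n) set" where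
  "equivariant_maps act X \<sigma> =
     {\<psi>. continuous_on X \<psi> \<and> (\<forall>x. x \<notin> X \<longrightarrow> \<psi> x = 0) \<and> (\<forall>s. \<forall>x\<in>X. \<psi> (act s x) = \<sigma> s *v \<psi> x)}"

definition equivariant_average ::
    "('g::topological_group_add \<Rightarrow> 'x::topological_space \<Rightarrow> 'x) \<Rightarrow> 'x set \<Rightarrow>
     ('g \<Rightarrow> complex^'n^'n) \<Rightarrow> ('x \<Rightarrow> complex^'n) \<Rightarrow> 'x \<Rightarrow> complex^'n" where
  "equivariant_average act X \<sigma> F x = (if x \<in> X then gmean (\<lambda>s. \<sigma> s *v F (act (- s) x)) else 0)"

definition invariant_average ::
    "('g::topological_group_add \<Rightarrow> 'x::topological_space \<Rightarrow> 'x) \<Rightarrow> 'x set \<Rightarrow>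
     ('x \<Rightarrow> complex) \<Rightarrow> 'x \<Rightarrow> complex" where
  "invariant_average act X c x = (if x \<in> X then gmean (\<lambda>s. c (act (- s) x)) else 0)"

lemma equivariant_mapsI:
  assumes "continuous_on X \<psi>" "\<And>x. x \<notin> X \<Longrightarrow> \<psi> x = 0"
    "\<And>s x. x \<in> X \<Longrightarrow> \<psi> (act s x) = \<sigma> s *v \<psi> x"
  shows "\<psi> \<in> equivariant_maps act X \<sigma>"
  using assms by (simp add: equivariant_maps_def)

lemma equivariant_mapsD:
  assumes "\<psi> \<in> equivariant_maps act X \<sigma>"
  shows "continuous_on X \<psi>" "\<And>x. x \<notin> X \<Longrightarrow> \<psi> x = 0"
    "\<And>s x. x \<in> X \<Longrightarrow> \<psi> (act s x) = \<sigma> s *v \<psi> x"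
  using assms by (simp_all add: equivariant_maps_def)

section \<open>Averaging for an action of a compact group\<close>

locale compact_group_action =
  fixes act :: "'g::{topological_group_add, t2_space} \<Rightarrow> 'x::t2_space \<Rightarrow> 'x"
    and X :: "'x set"
  assumes compact_group: "compact (UNIV :: 'g set)"
    and compact_space: "compact X"
    and action: "continuous_action act X"
begin

lemma act_closed [simp]: "x \<in> X \<Longrightarrow> act s x \<in> X"
  and act_zero [simp]: "x \<in> X \<Longrightarrow> act 0 x = x"
  and act_add: "x \<in> X \<Longrightarrow> act (s + t) x = act s (act t x)"
  and continuous_act: "continuous_on (UNIV \<times> X) (\<lambda>(s, x). act s x)"
  using action unfolding continuous_action_def by blast+

lemma act_minus_left [simp]: "x \<in> X \<Longrightarrow> act (- s) (act s x) = x"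
  and act_minus_right [simp]: "x \<in> X \<Longrightarrow> act s (act (- s) x) = x"
  by (simp_all flip: act_add)

lemma continuous_on_act:
  assumes "continuous_on S f" "continuous_on S g" "g ` S \<subseteq> X"
  shows "continuous_on S (\<lambda>p. act (f p) (g p))"
proof -
  have "continuous_on S (\<lambda>p. (\<lambda>(s, x). act s x) (f p, g p))"
    by (rule continuous_on_compose2[OF continuous_act])
       (use assms in \<open>auto intro!: continuous_on_Pair\<close>)
  then show ?thesis by simp
qed

lemma continuous_on_translated:
  assumes "continuous_on X F"
  shows "continuous_on (UNIV \<times> X) (\<lambda>p. F (act (- fst p) (snd p)))"
  by (rule continuous_on_compose2[OF assms], rule continuous_on_act)
     (auto intro!: continuous_intros)

lemma continuous_on_translated_group:
  assumes "continuous_on X F" "x \<in> X"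
  shows "continuous_on UNIV (\<lambda>s. F (act (- s) x))"
  by (rule continuous_on_compose2[OF assms(1)], rule continuous_on_act)
     (use assms in \<open>auto intro!: continuous_intros\<close>)

lemma continuous_on_orbit_map:
  "x \<in> X \<Longrightarrow> continuous_on UNIV (\<lambda>s. act s x)"
  by (rule continuous_on_act) (auto intro!: continuous_intros)

text \<open>Writing s = t + (- t + s) splits off \<open>\<sigma> t\<close>, and what remains is a
  left translate with the same mean.\<close>

lemma equivariant_average_in:
  fixes \<sigma> :: "'g \<Rightarrow> complex^'n^'n"
  assumes \<sigma>: "representation \<sigma>" and F: "continuous_on X F"
  shows "equivariant_average act X \<sigma> F \<in> equivariant_maps act X \<sigma>"
proof (rule equivariant_mapsI)
  have cont: "continuous_on (UNIV \<times> X) (\<lambda>p. \<sigma> (fst p) *v F (act (- fst p) (snd p)))"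
    by (intro continuous_intros continuous_on_translated F
        continuous_on_compose2[OF continuous_on_representation[OF \<sigma>]]) auto
  then have "continuous_on X (\<lambda>x. gmean (\<lambda>s. \<sigma> s *v F (act (- s) x)))"
    using continuous_on_gmean[OF compact_group, of X "\<lambda>s x. \<sigma> s *v F (act (- s) x)"]
    by (simp add: case_prod_unfold)
  then show "continuous_on X (equivariant_average act X \<sigma> F)"
    by (rule continuous_on_cong[THEN iffD1, rotated -1]) (auto simp: equivariant_average_def)
  show "equivariant_average act X \<sigma> F x = 0" if "x \<notin> X" for x
    using that by (simp add: equivariant_average_def)
  fix t x assume x: "x \<in> X"
  define k where "k s = \<sigma> s *v F (act (- s) x)" for s
  have k: "continuous_on UNIV k"
    unfolding k_def
    by (intro continuous_intros continuous_on_translated_group F x continuous_on_representation[OF \<sigma>])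
  have k': "continuous_on UNIV (\<lambda>s. k (- t + s))"
    by (rule continuous_on_translate_left[OF k])
  have "\<sigma> s *v F (act (- s) (act t x)) = \<sigma> t *v k (- t + s)" for s
  proof -
    have "\<sigma> s = \<sigma> (t + (- t + s))" by (simp add: add.assoc[symmetric])
    moreover have "act (- s) (act t x) = act (- (- t + s)) x"
      using x by (simp flip: act_add add: minus_add)
    ultimately show ?thesis
      unfolding k_def using representation_add_vec[OF \<sigma>] by metis
  qed
  then have "equivariant_average act X \<sigma> F (act t x) = gmean (\<lambda>s. \<sigma> t *v k (- t + s))"
    using x by (simp add: equivariant_average_def)
  also have "\<dots> = \<sigma> t *v gmean (\<lambda>s. k (- t + s))"
    by (rule gmean_linear[OF compact_group k']) simp
  also have "gmean (\<lambda>s. k (- t + s)) = gmean k"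
    by (rule gmean_translate[OF compact_group k])
  also have "gmean k = equivariant_average act X \<sigma> F x"
    using x by (simp add: equivariant_average_def k_def[abs_def])
  finally show "equivariant_average act X \<sigma> F (act t x) = \<sigma> t *v equivariant_average act X \<sigma> F x" .
qed

lemma invariant_functions_iff:
  "a \<in> invariant_functions act X \<longleftrightarrow>
     continuous_on X a \<and> (\<forall>x. x \<notin> X \<longrightarrow> a x = 0) \<and> (\<forall>s. \<forall>x\<in>X. a (act s x) = a x)"
proof -
  have "(\<forall>s. translate act X s a = a) \<longleftrightarrow> (\<forall>s. \<forall>x\<in>X. a (act s x) = a x)"
    if "\<forall>x. x \<notin> X \<longrightarrow> a x = 0"
  proof
    assume *: "\<forall>s. translate act X s a = a"
    show "\<forall>s. \<forall>x\<in>X. a (act s x) = a x"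
    proof (intro allI ballI)
      fix s x assume "x \<in> X"
      then show "a (act s x) = a x"
        using fun_cong[OF *[rule_format, of "- s"], of x] by (simp add: translate_def)
    qed
  next
    assume *: "\<forall>s. \<forall>x\<in>X. a (act s x) = a x"
    show "\<forall>s. translate act X s a = a"
    proof (intro allI ext)
      fix s x
      show "translate act X s a x = a x"
        using *[rule_format, of x "- s"] that by (cases "x \<in> X") (simp_all add: translate_def)
    qed
  qed
  then show ?thesis by (auto simp: invariant_functions_def cont_functions_def)
qed

lemma invariant_average_in:
  assumes c: "continuous_on X c"
  shows "invariant_average act X c \<in> invariant_functions act X"
  unfolding invariant_functions_iff
proof (intro conjI allI impI ballI)
  have "continuous_on X (\<lambda>x. gmean (\<lambda>s. c (act (- s) x)))"
    using continuous_on_gmean[OF compact_group, of X "\<lambda>s x. c (act (- s) x)"]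
      continuous_on_translated[OF c] by (simp add: case_prod_unfold)
  then show "continuous_on X (invariant_average act X c)"
    by (rule continuous_on_cong[THEN iffD1, rotated -1]) (auto simp: invariant_average_def)
  show "invariant_average act X c x = 0" if "x \<notin> X" for x
    using that by (simp add: invariant_average_def)
  fix t x assume x: "x \<in> X"
  have "act (- s) (act t x) = act (- (- t + s)) x" for s
    using x by (simp flip: act_add add: minus_add)
  then have "invariant_average act X c (act t x) = gmean (\<lambda>s. c (act (- (- t + s)) x))"
    using x by (simp add: invariant_average_def)
  also have "\<dots> = gmean (\<lambda>s. c (act (- s) x))"
    by (rule gmean_translate[OF compact_group continuous_on_translated_group[OF c x]])
  finally show "invariant_average act X c (act t x) = invariant_average act X c x"
    using x by (simp add: invariant_average_def)
qed

lemma equivariant_value_fixed: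
  assumes "\<psi> \<in> equivariant_maps act X \<sigma>" "x \<in> X"
  shows "\<psi> x \<in> fixed_vectors \<sigma> (isotropy act x)"
proof -
  have "\<sigma> s *v \<psi> x = \<psi> x" if "act s x = x" for s
    using equivariant_mapsD(3)[OF assms, of s] that by simp
  then show ?thesis by (simp add: fixed_vectors_def isotropy_def)
qed

text \<open>On the orbit of \<open>x0\<close> equivariance and the value \<open>w\<close> at
  \<open>x0\<close> leave only one candidate. It extends continuously to \<open>X\<close>, and
  averaging restores equivariance without changing the value at \<open>x0\<close>.\<close>

lemma equivariant_extension:
  fixes \<sigma> :: "'g \<Rightarrow> complex^'n^'n"
  assumes \<sigma>: "representation \<sigma>" and x0: "x0 \<in> X"
    and w: "w \<in> fixed_vectors \<sigma> (isotropy act x0)"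
  obtains \<psi> where "\<psi> \<in> equivariant_maps act X \<sigma>" "\<psi> x0 = w"
proof -
  define K where "K = range (\<lambda>s. act s x0)"
  \<comment> \<open>The chosen group element does not matter: two choices differ by an element of
    the isotropy group, which fixes \<open>w\<close>.\<close>
  define f where "f y = \<sigma> (SOME s. act s x0 = y) *v w" for y
  have f: "f (act s x0) = \<sigma> s *v w" for s
  proof -
    define t where "t = (SOME t. act t x0 = act s x0)"
    have "act t x0 = act s x0" unfolding t_def by (rule someI[of _ s]) simp
    then have "act (- t + s) x0 = x0" using act_add[OF x0, of "- t" s] act_minus_left[OF x0, of t] by metis
    then have "\<sigma> (- t + s) *v w = w" using w by (simp add: fixed_vectors_def isotropy_def)
    then have "\<sigma> t *v w = \<sigma> t *v (\<sigma> (- t + s) *v w)" by simp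
    also have "\<dots> = \<sigma> s *v w" 
      using representation_add_vec[OF \<sigma>, of t "- t + s" w] by (simp flip: add.assoc)
    finally show ?thesis by (simp add: f_def t_def)
  qed
  have K: "compact K" "K \<subseteq> X"
    unfolding K_def using x0 compact_group
    by (auto intro!: compact_continuous_image continuous_on_orbit_map)
  have "continuous_on K f"
  \<comment> \<open>The orbit map is closed, being continuous from a compact to a Hausdorff space;
    preimages under \<open>f\<close> are therefore images of closed, hence compact, subsets of the
    group.\<close>
  proof (subst continuous_on_closed_vimage[OF compact_imp_closed[OF K(1)]], intro allI impI)
    fix B :: "(complex^'n) set" assume "closed B"
    have "continuous_on UNIV (\<lambda>s. \<sigma> s *v w)"
      by (intro continuous_intros continuous_on_representation[OF \<sigma>])
    then have "closed ((\<lambda>s. \<sigma> s *v w) -` B)"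
      using continuous_on_closed_vimage[of UNIV "\<lambda>s. \<sigma> s *v w"] \<open>closed B\<close> by auto
    then have "compact ((\<lambda>s. \<sigma> s *v w) -` B)"
      using compact_Int_closed[OF compact_group] by auto
    then have "compact ((\<lambda>s. act s x0) ` ((\<lambda>s. \<sigma> s *v w) -` B))"
      by (intro compact_continuous_image continuous_on_subset[OF continuous_on_orbit_map[OF x0]]) auto
    moreover have "(\<lambda>s. act s x0) ` ((\<lambda>s. \<sigma> s *v w) -` B) = f -` B \<inter> K"
      by (auto simp: K_def f)
    ultimately show "closed (f -` B \<inter> K)" by (simp add: compact_imp_closed)
  qed
  from tietze_euclidean[OF compact_space K this]
  obtain F where F: "continuous_on X F" "\<And>y. y \<in> K \<Longrightarrow> F y = f y" by blast
  show thesis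
  proof
    show "equivariant_average act X \<sigma> F \<in> equivariant_maps act X \<sigma>"
      by (rule equivariant_average_in[OF \<sigma> F(1)])
    \<comment> \<open>At \<open>x0\<close> the integrand \<sigma> s F(s^{-1} x0) is thus constantly
      \<open>w\<close>, whatever the extension does off the orbit.\<close>
    have "F (act (- s) x0) = \<sigma> (- s) *v w" for s
      by (simp add: F(2) K_def f)
    then show "equivariant_average act X \<sigma> F x0 = w"
      using x0 \<sigma> by (simp add: equivariant_average_def gmean_const[OF compact_group])
  qed
qed

end

subsection \<open>Submodules of sums of copies of an irreducible representation\<close>

lemma irreducible_representationD:
  assumes "irreducible_representation \<rho>"
  shows "representation \<rho>"
    and "\<And>W. vec.subspace W \<Longrightarrow> (\<And>s v. v \<in> W \<Longrightarrow> \<rho> s *v v \<in> W) \<Longrightarrow> W = {0} \<or> W = UNIV"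
  using assms by (auto simp: irreducible_representation_def)

text \<open>Each \<open>\<tau> i\<close> is an intertwiner from \<open>\<rho>\<close> into one large
  module with action \<open>L\<close>. The images may overlap; the purpose is to understand the
  submodules of their sum.\<close>

locale irreducible_family = vector_space scale
  for scale :: "complex \<Rightarrow> 'v::ab_group_add \<Rightarrow> 'v" +
  fixes \<rho> :: "'g::topological_group_add \<Rightarrow> complex^'n^'n"
    and L :: "'g \<Rightarrow> 'v \<Rightarrow> 'v"
    and \<tau> :: "'i \<Rightarrow> complex^'n \<Rightarrow> 'v"
  assumes irreducible: "irreducible_representation \<rho>"
    and L_add: "L s (x + y) = L s x + L s y"
    and L_scale: "L s (scale c x) = scale c (L s x)"
    and \<tau>_add: "\<tau> i (u + v) = \<tau> i u + \<tau> i v"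
    and \<tau>_scale: "\<tau> i (c *s v) = scale c (\<tau> i v)"
    and \<tau>_equivariant: "\<tau> i (\<rho> s *v v) = L s (\<tau> i v)"
begin

definition comb :: "'i set \<Rightarrow> ('i \<Rightarrow> complex^'n) \<Rightarrow> 'v" where
  "comb J v = (\<Sum>i\<in>J. \<tau> i (v i))"

definition invariant_subspace :: "'v set \<Rightarrow> bool" where
  "invariant_subspace W \<longleftrightarrow> subspace W \<and> (\<forall>s. \<forall>w\<in>W. L s w \<in> W)"

text \<open>Requiring \<open>v i = 0\<close> instead of \<open>\<tau> i (v i) = 0\<close> builds in
  injectivity, so that for finite \<open>J\<close> and a subspace \<open>W\<close> the images
  indexed by \<open>J\<close> are genuine copies of \<open>\<rho>\<close>.\<close>

definition direct :: "'v set \<Rightarrow> 'i set \<Rightarrow> bool" where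
  "direct W J \<longleftrightarrow> (\<forall>w\<in>W. \<forall>v. w + comb J v = 0 \<longrightarrow> w = 0 \<and> (\<forall>i\<in>J. v i = 0))"

lemma \<tau>_zero [simp]: "\<tau> i 0 = 0"
  using \<tau>_scale[of i 0 0] by simp

lemma \<tau>_minus: "\<tau> i (- v) = - \<tau> i v"
  using \<tau>_add[of i v "- v"] by (simp add: eq_neg_iff_add_eq_0 add.commute)

lemma L_zero [simp]: "L s 0 = 0"
  using L_scale[of s 0 0] by simp

lemma L_sum: "L s (\<Sum>i\<in>J. f i) = (\<Sum>i\<in>J. L s (f i))"
  by (induction J rule: infinite_finite_induct) (auto simp: L_add)

lemma comb_add: "comb J (\<lambda>i. u i + v i) = comb J u + comb J v"
  by (simp add: comb_def \<tau>_add sum.distrib)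

lemma comb_minus: "comb J (\<lambda>i. - v i) = - comb J v"
  by (simp add: comb_def \<tau>_minus sum_negf)

lemma comb_diff: "comb J (\<lambda>i. u i - v i) = comb J u - comb J v"
  using comb_add[of J u "\<lambda>i. - v i"] by (simp add: comb_minus)

lemma comb_scale: "comb J (\<lambda>i. c *s v i) = scale c (comb J v)"
  by (simp add: comb_def \<tau>_scale scale_sum_right)

lemma comb_equivariant: "comb J (\<lambda>i. \<rho> s *v v i) = L s (comb J v)"
  by (simp add: comb_def \<tau>_equivariant L_sum)

lemma comb_zero [simp]: "comb J (\<lambda>i. 0) = 0"
  by (simp add: comb_def)

lemma comb_cong: "(\<And>i. i \<in> J \<Longrightarrow> u i = v i) \<Longrightarrow> comb J u = comb J v"
  by (simp add: comb_def)

lemma comb_single: "finite J \<Longrightarrow> i \<in> J \<Longrightarrow> comb J (\<lambda>j. if j = i then v else 0) = \<tau> i v"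
  by (simp add: comb_def if_distrib cong: if_cong)

lemma comb_sum: "finite K \<Longrightarrow> comb J (\<lambda>i. \<Sum>k\<in>K. v k i) = (\<Sum>k\<in>K. comb J (v k))"
  by (induction K rule: finite_induct) (auto simp: comb_add)

lemma invariant_subspace_comb: "invariant_subspace (range (comb J))"
proof -
  have "subspace (range (comb J))"
    unfolding subspace_def
    by (auto simp flip: comb_add comb_scale intro: range_eqI[of _ _ "\<lambda>i. 0"])
  then show ?thesis
    by (auto simp: invariant_subspace_def simp flip: comb_equivariant)
qed

text \<open>Take a maximal direct \<open>J\<close>. For an index i outside it, the vectors that
  \<open>\<tau> i\<close> sends into W + range (comb J) form an invariant subspace. Failure of
  directness for \<open>insert i J\<close> makes it nonzero, so irreducibility makes it
  everything.\<close>

lemma direct_extend: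
  assumes W: "invariant_subspace W" and "finite I" "J0 \<subseteq> I" "direct W J0"
  obtains J where "J0 \<subseteq> J" "J \<subseteq> I" "direct W J"
    "\<And>i v. i \<in> I \<Longrightarrow> \<exists>w\<in>W. \<exists>u. \<tau> i v = w + comb J u"
proof -
  define A where "A = {J. J0 \<subseteq> J \<and> J \<subseteq> I \<and> direct W J}"
  have "finite A" unfolding A_def by (rule finite_subset[of _ "Pow I"]) (use \<open>finite I\<close> in auto)
  moreover have "A \<noteq> {}" using assms(3,4) by (auto simp: A_def)
  ultimately obtain J where JA: "J \<in> A" and max: "\<And>J'. J' \<in> A \<Longrightarrow> J \<subseteq> J' \<Longrightarrow> J = J'"
    using finite_has_maximal[of A] by metis
  have J: "J0 \<subseteq> J" "J \<subseteq> I" "direct W J" using JA by (auto simp: A_def)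
  have fin: "finite J" using J(2) \<open>finite I\<close> finite_subset by blast
  have sub: "subspace W" and inv: "\<And>s w. w \<in> W \<Longrightarrow> L s w \<in> W"
    using W by (auto simp: invariant_subspace_def)
  have "\<exists>w\<in>W. \<exists>u. \<tau> i z = w + comb J u" if i: "i \<in> I" for i z
  proof (cases "i \<in> J")
    case True
    then show ?thesis using comb_single[OF fin True] subspace_0[OF sub] by (metis add_0)
  next
    case False
    define K where "K = {v. \<exists>w\<in>W. \<exists>u. \<tau> i v = w + comb J u}"
    have "\<not> direct W (insert i J)"
      using max[of "insert i J"] J i False unfolding A_def by blast
    then obtain w v where wv: "w \<in> W" "w + comb (insert i J) v = 0"
      and nz: "\<not> (w = 0 \<and> (\<forall>j\<in>insert i J. v j = 0))"
      unfolding direct_def by blast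
    have comb_i: "comb (insert i J) v = \<tau> i (v i) + comb J v"
      using False fin by (simp add: comb_def)
    have "v i \<noteq> 0"
    proof
      assume "v i = 0"
      then have "w + comb J v = 0" using wv comb_i by simp
      then show False using J wv(1) nz \<open>v i = 0\<close> by (auto simp: direct_def)
    qed
    moreover have "v i \<in> K"
    proof -
      have "\<tau> i (v i) + (w + comb J v) = 0"
        using wv(2) by (simp add: comb_i ac_simps)
      then have "\<tau> i (v i) = - (w + comb J v)" by (rule eq_neg_iff_add_eq_0[THEN iffD2])
      also have "\<dots> = (- w) + comb J (\<lambda>j. - v j)" by (simp add: comb_minus)
      finally show ?thesis using subspace_neg[OF sub wv(1)] unfolding K_def by blast
    qed
    moreover have "vec.subspace K"
      unfolding vec.subspace_def
    proof (intro conjI ballI allI)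
      show "0 \<in> K" using subspace_0[OF sub]
        by (auto simp: K_def intro!: bexI[of _ 0] exI[of _ "\<lambda>i. 0"])
    next
      fix a b assume "a \<in> K" "b \<in> K"
      then obtain w1 u1 w2 u2 where "w1 \<in> W" "w2 \<in> W" "\<tau> i a = w1 + comb J u1" "\<tau> i b = w2 + comb J u2"
        by (auto simp: K_def)
      then have "\<tau> i (a + b) = (w1 + w2) + comb J (\<lambda>j. u1 j + u2 j)" "w1 + w2 \<in> W"
        by (auto simp: \<tau>_add comb_add subspace_add[OF sub])
      then show "a + b \<in> K" unfolding K_def by blast
    next
      fix c a assume "a \<in> K"
      then obtain w1 u1 where "w1 \<in> W" "\<tau> i a = w1 + comb J u1" by (auto simp: K_def)
      then have "\<tau> i (c *s a) = scale c w1 + comb J (\<lambda>j. c *s u1 j)" "scale c w1 \<in> W"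
        by (auto simp: \<tau>_scale comb_scale scale_right_distrib subspace_scale[OF sub])
      then show "c *s a \<in> K" unfolding K_def by blast
    qed
    moreover have "\<rho> s *v a \<in> K" if "a \<in> K" for s a
    proof -
      obtain w1 u1 where "w1 \<in> W" "\<tau> i a = w1 + comb J u1" using \<open>a \<in> K\<close> by (auto simp: K_def)
      then have "\<tau> i (\<rho> s *v a) = L s w1 + comb J (\<lambda>j. \<rho> s *v u1 j)" "L s w1 \<in> W"
        by (auto simp: \<tau>_equivariant comb_equivariant L_add inv)
      then show ?thesis unfolding K_def by blast
    qed
    ultimately have "K = UNIV"
      using irreducible_representationD(2)[OF irreducible, of K] by blast
    then have "z \<in> K" by simp
    then show ?thesis by (simp add: K_def)
  qed
  then show thesis using that J by blast
qed

text \<open>Two complements of the same submodule are isomorphic: both \<open>W\<close> and the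
  copies indexed by \<open>D = I' - J\<close> complement the copies indexed by \<open>J\<close>. The
  isomorphism reads off the coordinates in \<open>D\<close>.\<close>

lemma submodule_isomorphic:
  assumes W: "invariant_subspace W" and I: "finite I" and WI: "W \<subseteq> range (comb I)"
  shows "\<exists>n::nat. rep_isomorphic scale L W (\<lambda>c v i. c *s v i) (\<lambda>s v i. \<rho> s *v v i)
           {v :: nat \<Rightarrow> complex^'n. \<forall>i\<ge>n. v i = 0}"
proof -
  have sub: "subspace W" and inv: "\<And>s w. w \<in> W \<Longrightarrow> L s w \<in> W"
    using W by (auto simp: invariant_subspace_def)
  have "direct W {}" by (simp add: direct_def comb_def)
  from direct_extend[OF W I empty_subsetI this]
  obtain J where J: "J \<subseteq> I" "direct W J"
    "\<And>i v. i \<in> I \<Longrightarrow> \<exists>w\<in>W. \<exists>u. \<tau> i v = w + comb J u" by metis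
  \<comment> \<open>The second extension starts from \<open>J\<close>, so that one index set
    \<open>I'\<close> gives unique coordinates for the whole sum and contains
    \<open>J\<close>.\<close>
  have "direct {0} J" using J(2) subspace_0[OF sub] by (auto simp: direct_def)
  moreover have "invariant_subspace {0}" by (simp add: invariant_subspace_def subspace_single_0)
  ultimately obtain I' where I': "J \<subseteq> I'" "I' \<subseteq> I" "direct {0} I'"
    "\<And>i v. i \<in> I \<Longrightarrow> \<exists>w\<in>{0}. \<exists>u. \<tau> i v = w + comb I' u"
    using direct_extend[OF _ I J(1), of "{0}"] by metis
  have fin: "finite I'" "finite J" using I I'(2) J(1) finite_subset by blast+
  have uniq: "u i = v i" if "comb I' u = comb I' v" "i \<in> I'" for u v i
  proof -
    have "0 + comb I' (\<lambda>i. u i - v i) = 0" using that(1) by (simp add: comb_diff)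
    then show ?thesis using I'(3) that(2) unfolding direct_def by fastforce
  qed
  have ex: "\<exists>v. comb I' v = w" if w: "w \<in> W" for w
  proof -
    obtain v where v: "w = comb I v" using WI w by blast
    have "\<forall>i. \<exists>u. i \<in> I \<longrightarrow> \<tau> i (v i) = comb I' u" using I'(4) by (metis add_0 singletonD)
    then obtain u where "\<And>i. i \<in> I \<Longrightarrow> \<tau> i (v i) = comb I' (u i)" by metis
    then have "w = comb I' (\<lambda>j. \<Sum>i\<in>I. u i j)"
      by (simp add: v comb_sum[OF I]) (simp add: comb_def)
    then show ?thesis by blast
  qed
  define c where "c w = (SOME v. comb I' v = w)" for w
  have c: "comb I' (c w) = w" if "w \<in> W" for w
    unfolding c_def by (rule someI_ex[OF ex[OF that]])
  define D where "D = I' - J"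
  have D: "finite D" using fin by (simp add: D_def)
  then obtain e where e: "bij_betw e {..<card D} D"
    using ex_bij_betw_nat_finite[OF D] by (auto simp: atLeast0LessThan)
  then have eD: "\<And>i. i < card D \<Longrightarrow> e i \<in> D" using bij_betwE by blast
  have eI: "\<And>i. i < card D \<Longrightarrow> e i \<in> I'" using eD D_def by blast
  \<comment> \<open>Dropping the coordinates in \<open>J\<close> is the projection along the copies
    complementary to \<open>W\<close>; positions from \<open>card D\<close> on are padded with
    0.\<close>
  define T where "T w i = (if i < card D then c w (e i) else 0)" for w and i :: nat
  have TI: "T w i = v (e i)" if "w \<in> W" "comb I' v = w" "i < card D" for w v i
    using uniq[of "c w" v "e i"] that c eI by (simp add: T_def)
  have T0: "\<not> i < card D \<Longrightarrow> T w i = 0" for w i by (simp add: T_def)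
  have T_add: "T (w + w') = T w + T w'" if "w \<in> W" "w' \<in> W" for w w'
  proof
    fix i show "T (w + w') i = (T w + T w') i"
      using TI[of "w + w'" "\<lambda>i. c w i + c w' i" i] that subspace_add[OF sub]
      by (cases "i < card D") (auto simp: comb_add c T_def)
  qed
  have T_scale: "T (scale a w) = (\<lambda>i. a *s T w i)" if "w \<in> W" for w a
  proof
    fix i show "T (scale a w) i = a *s T w i"
      using TI[of "scale a w" "\<lambda>i. a *s c w i" i] that subspace_scale[OF sub]
      by (cases "i < card D") (auto simp: comb_scale c T_def)
  qed
  have T_equiv: "T (L s w) = (\<lambda>i. \<rho> s *v T w i)" if "w \<in> W" for w s
  proof
    fix i show "T (L s w) i = \<rho> s *v T w i"
      using TI[of "L s w" "\<lambda>i. \<rho> s *v c w i" i] that inv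
      by (cases "i < card D") (auto simp: comb_equivariant c T_def)
  qed
  have split: "comb I' v = comb J v + comb D v" for v
    unfolding comb_def D_def using fin I'(1) by (simp add: sum.subset_diff add.commute)
  have "inj_on T W"
  proof (rule inj_onI)
    fix w w' assume ww: "w \<in> W" "w' \<in> W" "T w = T w'"
    define z where "z = w - w'"
    have z: "z \<in> W" using ww subspace_diff[OF sub] by (simp add: z_def)
    have "T w = T z + T w'" using T_add[OF z ww(2)] by (simp add: z_def)
    then have Tz: "T z i = 0" for i using ww(3) by (simp add: fun_eq_iff)
    have "c z j = 0" if j: "j \<in> D" for j
    proof -
      obtain i where "i < card D" "e i = j" using e j by (force simp: bij_betw_def)
      then show ?thesis using Tz[of i] by (simp add: T_def)
    qed
    then have "comb D (c z) = 0" by (simp add: comb_def)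
    then have "z = comb J (c z)" using c[OF z] split[of "c z"] by simp
    then have "z + comb J (\<lambda>i. - c z i) = 0" by (simp add: comb_minus)
    then have "z = 0" using J(2) z by (auto simp: direct_def)
    then show "w = w'" by (simp add: z_def)
  qed
  moreover have "T ` W = {v. \<forall>i\<ge>card D. v i = 0}"
  proof (intro equalityI subsetI)
    fix v :: "nat \<Rightarrow> complex^'n" assume v: "v \<in> {v. \<forall>i\<ge>card D. v i = 0}"
    define v' where "v' j = v (inv_into {..<card D} e j)" for j
    have v': "v' (e i) = v i" if "i < card D" for i
      using that e by (simp add: v'_def bij_betw_def inv_into_f_f)
    have "\<forall>i. \<exists>w u. i \<in> D \<longrightarrow> w \<in> W \<and> \<tau> i (v' i) = w + comb J u"
      using J(3) I'(2) unfolding D_def by blast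
    then obtain w u where wu: "\<And>i. i \<in> D \<Longrightarrow> w i \<in> W" "\<And>i. i \<in> D \<Longrightarrow> \<tau> i (v' i) = w i + comb J (u i)"
      by metis
    define y where "y = (\<Sum>i\<in>D. w i)"
    have y: "y \<in> W" unfolding y_def by (rule subspace_sum[OF sub]) (rule wu(1))
    \<comment> \<open>Surjectivity: the prescribed coordinates on \<open>D\<close> are kept, and the
      coordinates on \<open>J\<close> are chosen to cancel the \<open>J\<close>-parts, so that the
      combination lands in \<open>W\<close>.\<close>
    define r where "r j = (if j \<in> D then v' j else - (\<Sum>i\<in>D. u i j))" for j
    have "comb D r = comb D v'" by (rule comb_cong) (simp add: r_def)
    also have "\<dots> = y + comb J (\<lambda>j. \<Sum>i\<in>D. u i j)"
      by (simp add: comb_sum[OF D]) (simp add: y_def comb_def[of D] wu(2) sum.distrib)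
    finally have 1: "comb D r = y + comb J (\<lambda>j. \<Sum>i\<in>D. u i j)" .
    have 2: "comb J r = - comb J (\<lambda>j. \<Sum>i\<in>D. u i j)"
      by (subst comb_minus[symmetric], rule comb_cong) (auto simp: r_def D_def)
    have "comb I' r = y" unfolding split 1 2 by simp
    then have "T y i = v i" for i
      using TI[OF y, of r i] v v' eD by (cases "i < card D") (auto simp: r_def T0)
    then have "v = T y" by auto
    then show "v \<in> T ` W" using y by blast
  qed (auto simp: T_def)
  ultimately have "bij_betw T W {v. \<forall>i\<ge>card D. v i = 0}" by (simp add: bij_betw_def)
  then show ?thesis
    unfolding rep_isomorphic_def using T_add T_scale T_equiv by blast
qed

end

subsection \<open>The isotypic component in terms of equivariant maps\<close>

definition adj :: "complex^'n^'m \<Rightarrow> complex^'m^'n" where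
  "adj A = (\<chi> i j. cnj (A $ j $ i))"

definition hinner :: "complex^'n \<Rightarrow> complex^'n \<Rightarrow> complex" where
  "hinner u v = (\<Sum>i\<in>UNIV. cnj (u $ i) * v $ i)"

text \<open>The dual with respect to \<open>hinner\<close>, that is, the complex conjugate of the
  usual dual representation; it coincides with \<open>\<rho>\<close> when the matrices are
  unitary.\<close>

definition contragredient :: "('g::group_add \<Rightarrow> complex^'n^'n) \<Rightarrow> 'g \<Rightarrow> complex^'n^'n" where
  "contragredient \<rho> s = adj (\<rho> (- s))"

lemma sum_fun_apply: "(\<Sum>i\<in>I. f i) x = (\<Sum>i\<in>I. f i x)"
  for f :: "'i \<Rightarrow> 'a \<Rightarrow> 'b::comm_monoid_add"
  by (induction I rule: infinite_finite_induct) simp_all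

lemma adj_mult: "adj (A ** B) = adj B ** adj A"
  by (simp add: adj_def matrix_matrix_mult_def vec_eq_iff mult.commute)

lemma adj_adj [simp]: "adj (adj A) = A"
  by (simp add: adj_def vec_eq_iff)

lemma adj_mat_1 [simp]: "adj (mat 1) = mat 1"
  by (simp add: adj_def mat_def vec_eq_iff)

lemma hinner_add_right: "hinner u (v + w) = hinner u v + hinner u w"
  by (simp add: hinner_def algebra_simps sum.distrib)

lemma hinner_scale_right: "hinner u (c *s v) = c * hinner u v"
  by (simp add: hinner_def sum_distrib_left algebra_simps)

lemma hinner_zero_left [simp]: "hinner 0 v = 0"
  by (simp add: hinner_def)

lemma hinner_adj: "hinner u (A *v v) = hinner (adj A *v u) v"
proof -
  have "hinner u (A *v v) = (\<Sum>i\<in>UNIV. \<Sum>j\<in>UNIV. cnj (u $ i) * (A $ i $ j * v $ j))"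
    by (simp add: hinner_def matrix_vector_mult_def sum_distrib_left)
  also have "\<dots> = (\<Sum>j\<in>UNIV. \<Sum>i\<in>UNIV. cnj (u $ i) * (A $ i $ j * v $ j))"
    by (rule sum.swap)
  also have "\<dots> = hinner (adj A *v u) v"
    by (simp add: hinner_def matrix_vector_mult_def adj_def sum_distrib_left algebra_simps)
  finally show ?thesis .
qed

lemma hinner_axis: "hinner u (axis i 1) = cnj (u $ i)"
  by (simp add: hinner_def axis_def if_distrib cong: if_cong)

lemma continuous_on_adj [continuous_intros]:
  "continuous_on S A \<Longrightarrow> continuous_on S (\<lambda>x. adj (A x))"
  unfolding adj_def by (intro continuous_intros)

lemma representation_contragredient:
  fixes \<rho> :: "'g::topological_group_add \<Rightarrow> complex^'n^'n"
  assumes "representation \<rho>"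
  shows "representation (contragredient \<rho>)"
  unfolding representation_def
proof (intro conjI allI)
  show "contragredient \<rho> 0 = mat 1"
    using assms by (simp add: contragredient_def representation_zero)
  show "contragredient \<rho> (s + t) = contragredient \<rho> s ** contragredient \<rho> t" for s t
    using representation_add[OF assms, of "- t" "- s"]
    by (simp add: contragredient_def minus_add flip: adj_mult)
  show "continuous_on UNIV (\<lambda>s. contragredient \<rho> s *v v)" for v
    unfolding contragredient_def
    by (intro continuous_intros continuous_on_compose2[OF continuous_on_representation[OF assms]]) auto
qed

lemma equivariant_maps_sum:
  assumes "\<And>k. k \<in> K \<Longrightarrow> \<psi> k \<in> equivariant_maps act X \<sigma>"
    and "\<And>k. k \<in> K \<Longrightarrow> continuous_on X (a k)"
    and "\<And>k s x. k \<in> K \<Longrightarrow> x \<in> X \<Longrightarrow> a k (act s x) = a k x"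
  shows "(\<lambda>x. \<Sum>k\<in>K. a k x *s \<psi> k x) \<in> equivariant_maps act X \<sigma>"
proof (rule equivariant_mapsI)
  have "continuous_on X (\<lambda>x. a k x *s \<psi> k x)" if "k \<in> K" for k
    unfolding vector_scalar_mult_def
    by (intro continuous_intros assms(2) that equivariant_mapsD(1)[OF assms(1)])
  then show "continuous_on X (\<lambda>x. \<Sum>k\<in>K. a k x *s \<psi> k x)"
    by (intro continuous_on_sum)
  show "(\<Sum>k\<in>K. a k x *s \<psi> k x) = 0" if "x \<notin> X" for x
    using that by (intro sum.neutral) (auto simp: equivariant_mapsD(2)[OF assms(1)])
  show "(\<Sum>k\<in>K. a k (act s x) *s \<psi> k (act s x)) = \<sigma> s *v (\<Sum>k\<in>K. a k x *s \<psi> k x)"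
    if "x \<in> X" for s x
    using that by (simp add: vec.linear_sum[OF matrix_vector_mul_linear_gen] vec.scale
        assms(3) equivariant_mapsD(3)[OF assms(1)])
qed

context compact_group_action
begin

lemma cont_functions_subspace: "cfun.subspace (cont_functions X)"
  unfolding cfun.subspace_def cont_functions_def cscale_def zero_fun_def plus_fun_def
  by (auto intro!: continuous_intros)

lemma translate_in_cont:
  assumes "f \<in> cont_functions X"
  shows "translate act X s f \<in> cont_functions X"
proof -
  have f: "continuous_on X f" using assms by (simp add: cont_functions_def)
  have "continuous_on X (\<lambda>x. act (- s) x)"
    by (rule continuous_on_act) (auto intro!: continuous_intros)
  then have "continuous_on X (\<lambda>x. f (act (- s) x))"
    by (rule continuous_on_compose2[OF f]) auto
  then have "continuous_on X (translate act X s f)"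
    by (rule continuous_on_cong[THEN iffD1, rotated -1]) (auto simp: translate_def)
  then show ?thesis by (simp add: cont_functions_def translate_def)
qed

lemma translate_add: "translate act X s (f + g) = translate act X s f + translate act X s g"
  and translate_scale: "translate act X s (cscale c f) = cscale c (translate act X s f)"
  by (auto simp: translate_def cscale_def fun_eq_iff)

lemma translate_translate: "translate act X s (translate act X t f) = translate act X (s + t) f"
proof
  fix x
  have "act (- (s + t)) x = act (- t) (act (- s) x)" if "x \<in> X"
    using act_add[OF that, of "- t" "- s"] by (simp add: minus_add)
  then show "translate act X s (translate act X t f) x = translate act X (s + t) f x"
    by (simp add: translate_def)
qed

lemma orbit_span_translate:
  assumes "h \<in> cfun.span (range (\<lambda>s. translate act X s f))"
  shows "translate act X t h \<in> cfun.span (range (\<lambda>s. translate act X s f))"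
  using assms
proof (induction rule: cfun.span_induct_alt)
  case base
  have "translate act X t 0 = 0" by (auto simp: translate_def fun_eq_iff)
  then show ?case using cfun.span_zero by metis
next
  case (step c x y)
  have "translate act X t x \<in> range (\<lambda>s. translate act X s f)"
    using step(1) by (auto simp: translate_translate)
  then show ?case
    unfolding translate_add translate_scale
    by (intro cfun.span_add cfun.span_scale step(2) cfun.span_base)
qed

text \<open>By equivariance of \<open>\<Psi> i\<close>, pairing a vector with
  \<open>\<Psi> i x\<close> intertwines \<open>\<rho>\<close> with translation. Axis vectors give
  conjugate coordinates, so the orbit of the function spans a submodule of a finite sum of images of
  \<open>\<rho>\<close>, to which \<open>submodule_isomorphic\<close> applies.\<close>

lemma cnj_coordinates_in_isotypic:
  assumes irr: "irreducible_representation \<rho>"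
    and \<Psi>: "\<And>i. \<Psi> i \<in> equivariant_maps act X (contragredient \<rho>)"
  shows "(\<lambda>x. cnj (\<Sum>i\<in>UNIV. \<Psi> i x $ i)) \<in> isotypic_component act X \<rho>"
proof -
  define f where "f = (\<lambda>x. cnj (\<Sum>i\<in>UNIV. \<Psi> i x $ i))"
  define \<tau> where "\<tau> i v = (\<lambda>x. hinner (\<Psi> i x) v)" for i v
  interpret F: irreducible_family cscale \<rho> "translate act X" \<tau>
  proof unfold_locales
    show "irreducible_representation \<rho>" by fact
    show "translate act X s (f + g) = translate act X s f + translate act X s g" for s f g
      by (rule translate_add)
    show "translate act X s (cscale c f) = cscale c (translate act X s f)" for s c f
      by (rule translate_scale)
    show "\<tau> i (u + v) = \<tau> i u + \<tau> i v" for i u v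
      by (auto simp: \<tau>_def hinner_add_right)
    show "\<tau> i (c *s v) = cscale c (\<tau> i v)" for i c v
      by (auto simp: \<tau>_def hinner_scale_right cscale_def)
    show "\<tau> i (\<rho> s *v v) = translate act X s (\<tau> i v)" for i s v
      using equivariant_mapsD(2,3)[OF \<Psi>[of i]]
      by (auto simp: \<tau>_def translate_def fun_eq_iff hinner_adj contragredient_def)
  qed
  define W where "W = cfun.span (range (\<lambda>s. translate act X s f))"
  have f: "f \<in> cont_functions X"
    using equivariant_mapsD(1,2)[OF \<Psi>]
    by (auto simp: f_def cont_functions_def intro!: continuous_intros)
  have fc: "f = F.comb UNIV (\<lambda>i. axis i 1)"
    by (auto simp: F.comb_def f_def \<tau>_def hinner_axis sum_fun_apply fun_eq_iff)
  have "F.invariant_subspace W"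
    unfolding F.invariant_subspace_def W_def using orbit_span_translate by auto
  moreover have "W \<subseteq> range (F.comb UNIV)"
    unfolding W_def
  proof (rule cfun.span_minimal)
    show "cfun.subspace (range (F.comb UNIV))"
      using F.invariant_subspace_comb F.invariant_subspace_def by blast
    show "range (\<lambda>s. translate act X s f) \<subseteq> range (F.comb UNIV)"
      by (auto simp: fc simp flip: F.comb_equivariant)
  qed
  ultimately show ?thesis
    using F.submodule_isomorphic[of W UNIV] f
    by (auto simp: isotypic_component_def f_def W_def)
qed

text \<open>The inverse isomorphism, restricted to the i-th copy, is an intertwiner into C(X). Its
  evaluations at points are represented by an equivariant map, and the coordinates of
  \<open>f\<close> under the isomorphism combine these maps.\<close>

lemma isotypic_imp_cnj_coordinates:
  fixes \<rho> :: "'g \<Rightarrow> complex^'n^'n"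
  assumes \<rho>: "representation \<rho>" and f: "f \<in> isotypic_component act X \<rho>"
  obtains \<Psi> where "\<And>i. \<Psi> i \<in> equivariant_maps act X (contragredient \<rho>)"
    "f = (\<lambda>x. cnj (\<Sum>i\<in>UNIV. \<Psi> i x $ i))"
proof -
  define W where "W = cfun.span (range (\<lambda>s. translate act X s f))"
  define V where "V n = {v :: nat \<Rightarrow> complex^'n. \<forall>i\<ge>n. v i = 0}" for n
  have fX: "f \<in> cont_functions X" using f by (simp add: isotypic_component_def)
  obtain n T where T: "bij_betw T W (V n)"
    and T_add: "\<And>u v. u \<in> W \<Longrightarrow> v \<in> W \<Longrightarrow> T (u + v) = T u + T v"
    and T_scale: "\<And>c v. v \<in> W \<Longrightarrow> T (cscale c v) = (\<lambda>i. c *s T v i)"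
    and T_eq: "\<And>s v. v \<in> W \<Longrightarrow> T (translate act X s v) = (\<lambda>i. \<rho> s *v T v i)"
    using f unfolding isotypic_component_def rep_isomorphic_def W_def V_def by blast
  define S where "S = inv_into W T"
  have S: "\<And>v. v \<in> V n \<Longrightarrow> S v \<in> W" "\<And>v. v \<in> V n \<Longrightarrow> T (S v) = v" "\<And>w. w \<in> W \<Longrightarrow> S (T w) = w"
    using T by (auto simp: S_def bij_betw_def inv_into_into f_inv_into_f)
  have TV: "w \<in> W \<Longrightarrow> T w \<in> V n" for w using T bij_betwE by blast
  have SI: "S v = w" if "w \<in> W" "T w = v" for v w using S(3) that by blast
  have WX: "W \<subseteq> cont_functions X"
    unfolding W_def by (rule cfun.span_minimal) (use translate_in_cont fX cont_functions_subspace in auto)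
  define \<delta> where "\<delta> i v = (\<lambda>j. if j = i then v else 0)" for i :: nat and v :: "complex^'n"
  have \<delta>: "\<delta> i v \<in> V n" if "i < n" for i v using that by (auto simp: \<delta>_def V_def)
  define \<tau> where "\<tau> i v = S (\<delta> i v)" for i v
  have \<tau>W: "\<tau> i v \<in> W" if "i < n" for i v unfolding \<tau>_def by (rule S(1)[OF \<delta>[OF that]])
  have T\<tau>: "T (\<tau> i v) = \<delta> i v" if "i < n" for i v unfolding \<tau>_def by (rule S(2)[OF \<delta>[OF that]])
  have \<tau>_add: "\<tau> i (u + v) = \<tau> i u + \<tau> i v" if "i < n" for i u v
    unfolding \<tau>_def[of i "u + v"]
    by (rule SI) (use \<tau>W[OF that] in \<open>auto simp: T_add T\<tau>[OF that] \<delta>_def W_def cfun.span_add\<close>)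
  have \<tau>_scale: "\<tau> i (c *s v) = cscale c (\<tau> i v)" if "i < n" for i c v
    unfolding \<tau>_def[of i "c *s v"]
    by (rule SI) (use \<tau>W[OF that] in \<open>auto simp: T_scale T\<tau>[OF that] \<delta>_def W_def cfun.span_scale\<close>)
  have \<tau>_eq: "\<tau> i (\<rho> s *v v) = translate act X s (\<tau> i v)" if "i < n" for i s v
    unfolding \<tau>_def[of i "\<rho> s *v v"]
    by (rule SI) (use \<tau>W[OF that] in \<open>auto simp: T_eq T\<tau>[OF that] \<delta>_def W_def orbit_span_translate\<close>)
  have \<tau>_axis: "\<tau> i v = (\<Sum>j\<in>UNIV. cscale (v $ j) (\<tau> i (axis j 1)))" if i: "i < n" for i v
  proof -
    have *: "\<tau> i (\<Sum>j\<in>J. u j) = (\<Sum>j\<in>J. \<tau> i (u j))" for J :: "'n set" and u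
    proof (induction J rule: infinite_finite_induct)
      case empty
      show ?case using \<tau>_scale[OF i, of 0 0] by (simp add: cscale_def zero_fun_def)
    qed (simp_all add: \<tau>_add[OF i])
    have "v = (\<Sum>j\<in>UNIV. v $ j *s axis j 1)" by (simp add: basis_expansion)
    then have "\<tau> i v = \<tau> i (\<Sum>j\<in>UNIV. v $ j *s axis j 1)" by simp
    then show ?thesis by (simp only: * \<tau>_scale[OF i])
  qed
  \<comment> \<open>The Riesz vector of evaluation at x on the i-th copy:
    \<open>hinner (\<psi> i x) v\<close> equals \<open>\<tau> i v x\<close>.\<close>
  define \<psi> where "\<psi> i x = (\<chi> j. cnj (\<tau> i (axis j 1) x))" for i x
  have \<psi>: "\<psi> i \<in> equivariant_maps act X (contragredient \<rho>)" if i: "i < n" for i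
  proof (rule equivariant_mapsI)
    have \<tau>X: "continuous_on X (\<tau> i v)" "\<And>x. x \<notin> X \<Longrightarrow> \<tau> i v x = 0" for v
      using WX \<tau>W[OF i, of v] by (auto simp: cont_functions_def)
    show "continuous_on X (\<psi> i)" unfolding \<psi>_def by (intro continuous_intros \<tau>X)
    show "\<psi> i x = 0" if "x \<notin> X" for x using that \<tau>X by (simp add: \<psi>_def vec_eq_iff)
    show "\<psi> i (act s x) = contragredient \<rho> s *v \<psi> i x" if x: "x \<in> X" for s x
    proof -
      have "\<tau> i (axis j 1) (act s x) = (\<Sum>k\<in>UNIV. \<rho> (- s) $ k $ j * \<tau> i (axis k 1) x)" for j
      proof -
        have "\<tau> i (axis j 1) (act s x) = translate act X (- s) (\<tau> i (axis j 1)) x"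
          using x by (simp add: translate_def)
        also have "\<dots> = \<tau> i (\<rho> (- s) *v axis j 1) x" by (simp add: \<tau>_eq[OF i])
        also have "\<dots> = (\<Sum>k\<in>UNIV. \<rho> (- s) $ k $ j * \<tau> i (axis k 1) x)"
          by (subst \<tau>_axis[OF i]) (simp add: sum_fun_apply cscale_def matrix_vector_mult_axis_nth)
        finally show ?thesis .
      qed
      then show ?thesis
        by (simp add: \<psi>_def contragredient_def adj_def matrix_vector_mult_def vec_eq_iff)
    qed
  qed
  define w where "w = T f"
  have "f = translate act X 0 f"
    using fX by (auto simp: translate_def cont_functions_def fun_eq_iff)
  then have fW: "f \<in> W" unfolding W_def by (metis cfun.span_base rangeI)
  have fsum: "f = (\<Sum>i<n. \<tau> i (w i))"
  proof -
    have *: "(\<Sum>i<m. \<tau> i (w i)) \<in> W \<and> T (\<Sum>i<m. \<tau> i (w i)) = (\<lambda>i. if i < m then w i else 0)" if "m \<le> n" for m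
      using that
    proof (induction m)
      case 0
      have "T (cscale 0 f) = (\<lambda>i. 0)" using T_scale[OF fW, of 0] by simp
      moreover have "cscale 0 f = 0" by (simp add: cscale_def zero_fun_def)
      moreover have "0 \<in> W" unfolding W_def by (rule cfun.span_zero)
      ultimately show ?case by (simp add: zero_fun_def)
    next
      case (Suc m)
      then have "m < n" by simp
      let ?g = "\<Sum>i<m. \<tau> i (w i)"
      have g: "?g \<in> W" "T ?g = (\<lambda>i. if i < m then w i else 0)" using Suc by auto
      have eq: "(\<Sum>i<Suc m. \<tau> i (w i)) = ?g + \<tau> m (w m)" by (rule sum.lessThan_Suc)
      have "T (?g + \<tau> m (w m)) = T ?g + T (\<tau> m (w m))"
        by (rule T_add[OF g(1) \<tau>W[OF \<open>m < n\<close>]])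
      also have "\<dots> = (\<lambda>i. if i < Suc m then w i else 0)"
        by (auto simp: g(2) T\<tau>[OF \<open>m < n\<close>] \<delta>_def fun_eq_iff)
      finally show ?case
        unfolding eq using g(1) \<tau>W[OF \<open>m < n\<close>] W_def cfun.span_add by metis
    qed
    have "(\<lambda>i. if i < n then w i else 0) = T f"
      using TV[OF fW] by (auto simp: w_def V_def fun_eq_iff)
    then have "T (\<Sum>i<n. \<tau> i (w i)) = T f" using *[of n] by simp
    then show ?thesis using *[of n] fW T by (auto simp: bij_betw_def dest: inj_onD)
  qed
  \<comment> \<open>Sorted by coordinates: \<open>\<Psi> j\<close> is built so that its j-th entry
    collects all terms of \<open>f\<close> containing \<open>\<tau> i (axis j 1)\<close>.\<close>
  define \<Psi> where "\<Psi> j = (\<lambda>x. \<Sum>i<n. cnj (w i $ j) *s \<psi> i x)" for j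
  show thesis
  proof
    show "\<Psi> j \<in> equivariant_maps act X (contragredient \<rho>)" for j
      unfolding \<Psi>_def by (rule equivariant_maps_sum[where a = "\<lambda>i x. cnj (w i $ j)"]) (auto simp: \<psi>)
    show "f = (\<lambda>x. cnj (\<Sum>j\<in>UNIV. \<Psi> j x $ j))"
    proof
      fix x
      have "f x = (\<Sum>i<n. \<tau> i (w i) x)" by (subst fsum) (simp add: sum_fun_apply)
      also have "\<dots> = (\<Sum>i<n. \<Sum>j\<in>UNIV. w i $ j * \<tau> i (axis j 1) x)"
        by (intro sum.cong refl) (subst \<tau>_axis, auto simp: sum_fun_apply cscale_def)
      also have "\<dots> = (\<Sum>j\<in>UNIV. \<Sum>i<n. w i $ j * \<tau> i (axis j 1) x)" by (rule sum.swap)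
      also have "\<dots> = cnj (\<Sum>j\<in>UNIV. \<Psi> j x $ j)"
        by (simp add: \<Psi>_def \<psi>_def)
      finally show "f x = cnj (\<Sum>j\<in>UNIV. \<Psi> j x $ j)" .
    qed
  qed
qed

end

subsection \<open>Schur's lemma\<close>

lemma continuous_on_det [continuous_intros]:
  fixes A :: "'a::topological_space \<Rightarrow> complex^'n^'n"
  assumes "continuous_on S A"
  shows "continuous_on S (\<lambda>x. det (A x))"
  unfolding det_def by (intro continuous_intros assms)

lemma mat_vector_mult: "mat z *v v = z *s v" for v :: "complex^'n"
  by (simp add: mat_def matrix_vector_mult_def vec_eq_iff if_distrib[of "\<lambda>x. x * _"] cong: if_cong)

lemma det_eq_0_imp_kernel:
  fixes A :: "complex^'n^'n"
  assumes "det A = 0"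
  obtains v where "v \<noteq> 0" "A *v v = 0"
proof -
  have "\<not> (\<exists>B. B ** A = mat 1)"
    using assms invertible_det_nz[of A] invertible_left_inverse[of A] by simp
  then show thesis using that by (auto simp: matrix_left_invertible_ker)
qed

text \<open>The Leibniz formula with linear polynomials as entries turns the characteristic
  determinant into a polynomial \<open>q\<close>, to which the fundamental theorem of algebra
  applies once \<open>q\<close> is not constant.\<close>

lemma complex_eigenvalue:
  fixes A :: "complex^'n^'n"
  obtains z v where "v \<noteq> 0" "A *v v = z *s v"
proof -
  define q where "q = (\<Sum>p | p permutes (UNIV :: 'n set). smult (of_int (sign p))
      (\<Prod>i\<in>UNIV. [: A $ i $ p i, if p i = i then - 1 else 0 :]))"
  have q: "poly q z = det (A - mat z)" for z
  proof -
    have "(\<Prod>i\<in>UNIV. A $ i $ p i + z * (if p i = i then - 1 else 0)) =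
          (\<Prod>i\<in>UNIV. (A - mat z) $ i $ p i)" for p :: "'n \<Rightarrow> 'n"
      by (intro prod.cong) (auto simp: mat_def)
    then show ?thesis
      by (simp add: q_def poly_sum poly_prod det_def)
  qed
  have "\<not> constant (poly q)"
  proof
    assume "constant (poly q)"
    then have c: "poly q z = poly q 0" for z unfolding constant_def by metis
    define N where "N = CARD('n)"
    \<comment> \<open>The substitution z = 1/w reverses the characteristic polynomial. As w tends to
      0 the left side tends to 1, whereas a constant \<open>q\<close> would make the right side tend
      to 0, because N > 0.\<close>
    have inv: "det (mat 1 - (\<chi> i j. w * A $ i $ j)) = (- w) ^ N * poly q 0" if "w \<noteq> 0" for w
    proof -
      have "mat 1 - (\<chi> i j. w * A $ i $ j) = (\<chi> i. (- w) *s ((A - mat (inverse w)) $ i))"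
        using that by (auto simp: vec_eq_iff mat_def algebra_simps)
      then have "det (mat 1 - (\<chi> i j. w * A $ i $ j)) = (- w) ^ N * det (\<chi> i. (A - mat (inverse w)) $ i)"
        by (simp only: det_rows_mul prod_constant N_def)
      also have "(\<chi> i. (A - mat (inverse w)) $ i) = A - mat (inverse w)"
        by (simp add: vec_eq_iff)
      finally show ?thesis using c[of "inverse w"] by (simp only: q)
    qed
    have "continuous_on UNIV (\<lambda>w. det (mat 1 - (\<chi> i j. w * A $ i $ j)))"
      by (intro continuous_intros)
    then have "((\<lambda>w. det (mat 1 - (\<chi> i j. w * A $ i $ j))) \<longlongrightarrow> det (mat 1 - (\<chi> i j. 0 * A $ i $ j))) (at 0)"
      by (simp only: continuous_on_def) blast
    moreover have "(\<chi> i j. 0 * A $ i $ j) = 0" by (simp add: vec_eq_iff)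
    ultimately have 1: "((\<lambda>w. det (mat 1 - (\<chi> i j. w * A $ i $ j))) \<longlongrightarrow> 1) (at 0)"
      by (simp add: det_I)
    have "((\<lambda>w. (- w) ^ N * poly q 0) \<longlongrightarrow> (- 0) ^ N * poly q 0) (at 0)"
      by (intro tendsto_intros)
    moreover have "(- 0 :: complex) ^ N * poly q 0 = 0" by (simp add: N_def)
    ultimately have 2: "((\<lambda>w. (- w) ^ N * poly q 0) \<longlongrightarrow> 0) (at 0)" by metis
    have "((\<lambda>w. (- w) ^ N * poly q 0) \<longlongrightarrow> 1) (at 0)"
      using 1 by (rule Lim_transform_eventually) (auto simp: eventually_at_filter inv)
    with 2 show False using tendsto_unique trivial_limit_at by fastforce
  qed
  then obtain z where "poly q z = 0" using fundamental_theorem_of_algebra by blast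
  then have "det (A - mat z) = 0" by (simp add: q)
  then obtain v where "v \<noteq> 0" "(A - mat z) *v v = 0" by (rule det_eq_0_imp_kernel)
  then show thesis using that[of v z] by (simp add: matrix_vector_mult_diff_rdistrib mat_vector_mult)
qed

text \<open>An eigenspace of \<open>B\<close> is nonzero and, as \<open>B\<close> commutes with
  \<open>\<rho>\<close>, invariant; irreducibility makes it the whole space.\<close>

lemma schur_scalar:
  fixes \<rho> :: "'g::topological_group_add \<Rightarrow> complex^'n^'n"
  assumes irr: "irreducible_representation \<rho>" and B: "\<And>s. \<rho> s ** B = B ** \<rho> s"
  obtains z where "B = mat z"
proof -
  obtain z v where v: "v \<noteq> 0" "B *v v = z *s v" by (rule complex_eigenvalue)
  define K where "K = {v. B *v v = z *s v}"
  have "vec.subspace K"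
    unfolding vec.subspace_def K_def
    by (auto simp: vec.add vec.scale vector_add_ldistrib mult.commute vector_smult_assoc)
  moreover have "\<rho> s *v u \<in> K" if "u \<in> K" for s u
    using that B[of s] by (simp add: K_def matrix_vector_mul_assoc vec.scale flip: B)
      (simp add: vec.scale flip: matrix_vector_mul_assoc)
  ultimately have "K = UNIV"
    using irreducible_representationD(2)[OF irr, of K] v unfolding K_def by blast
  then have "B *v u = mat z *v u" for u by (auto simp: K_def mat_vector_mult)
  then have "B = mat z" by (simp add: matrix_eq)
  then show thesis by (rule that)
qed

text \<open>Taking adjoints turns commutation with the contragredient into commutation with
  \<open>\<rho>\<close>, for which irreducibility is given.\<close>

lemma schur_scalar_contragredient:
  fixes \<rho> :: "'g::topological_group_add \<Rightarrow> complex^'n^'n"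
  assumes irr: "irreducible_representation \<rho>"
    and B: "\<And>s. contragredient \<rho> s ** B = B ** contragredient \<rho> s"
  obtains z where "B = mat z"
proof -
  have "\<rho> s ** adj B = adj B ** \<rho> s" for s
    using arg_cong[OF B[of "- s"], of adj] by (simp add: contragredient_def adj_mult)
  then obtain z where "adj B = mat z" using schur_scalar[OF irr] by blast
  then have "B = adj (mat z)" by (metis adj_adj)
  also have "\<dots> = mat (cnj z)" by (simp add: adj_def mat_def vec_eq_iff)
  finally show thesis by (rule that)
qed

lemma linear_matrix_sandwich:
  fixes B :: "complex^'n^'m" and C :: "complex^'k^'l"
  shows "linear (\<lambda>M. B ** M ** C)"
  by (rule linearI)
     (simp_all add: matrix_matrix_mult_def vec_eq_iff algebra_simps sum.distrib sum_distrib_left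
       sum_distrib_right scaleR_sum_right)

lemma linear_matrix_apply: "linear (\<lambda>M :: complex^'n^'m. M *v v)"
  by (rule linearI)
     (simp_all add: matrix_vector_mult_def vec_eq_iff algebra_simps sum.distrib scaleR_sum_right)

subsection \<open>Averages over the group\<close>

lemma representation_minus_mult: "representation \<sigma> \<Longrightarrow> \<sigma> (- t) ** \<sigma> t = mat 1"
  using representation_add[of \<sigma> "- t" t] by (simp add: representation_zero)

text \<open>Left invariance of the mean makes the averaged conjugate commute with every
  \<open>\<sigma> t\<close>, so Schur's lemma applies.\<close>

lemma gmean_conjugation_scalar:
  fixes \<rho> :: "'g::topological_group_add \<Rightarrow> complex^'n^'n"
  defines "\<sigma> \<equiv> contragredient \<rho>"
  assumes comp: "compact (UNIV :: 'g set)" and irr: "irreducible_representation \<rho>"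
  obtains z where "gmean (\<lambda>s. \<sigma> s ** A ** \<sigma> (- s)) = mat z"
proof -
  have \<sigma>: "representation \<sigma>"
    unfolding \<sigma>_def by (rule representation_contragredient[OF irreducible_representationD(1)[OF irr]])
  define k where "k s = \<sigma> s ** A ** \<sigma> (- s)" for s
  have k: "continuous_on UNIV k"
    unfolding k_def
    by (intro continuous_intros continuous_on_compose2[OF continuous_on_representation[OF \<sigma>]]) auto
  have "\<sigma> t ** gmean k = gmean k ** \<sigma> t" for t
  proof -
    have "\<sigma> t ** k s ** \<sigma> (- t) = k (t + s)" for s
      by (simp only: k_def representation_add[OF \<sigma>] minus_add matrix_mul_assoc)
    then have "gmean (\<lambda>s. \<sigma> t ** k s ** \<sigma> (- t)) = gmean k"
      using gmean_translate[OF comp k] by simp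
    moreover have "gmean (\<lambda>s. \<sigma> t ** k s ** \<sigma> (- t)) = \<sigma> t ** gmean k ** \<sigma> (- t)"
      by (rule gmean_linear[OF comp k linear_matrix_sandwich])
    ultimately have "gmean k ** \<sigma> t = \<sigma> t ** gmean k ** \<sigma> (- t) ** \<sigma> t" by simp
    also have "\<dots> = \<sigma> t ** gmean k"
      using representation_minus_mult[OF \<sigma>] by (simp flip: matrix_mul_assoc)
    finally show ?thesis by simp
  qed
  then obtain z where "gmean k = mat z"
    using schur_scalar_contragredient[OF irr] unfolding \<sigma>_def by metis
  then show thesis using that by (simp add: k_def[abs_def])
qed

text \<open>Comparing traces identifies the scalar as trace A / n. What is used later is that it
  depends linearly on the entries of \<open>A\<close> with constant coefficients, so that continuous
  matrices give continuous scalars.\<close>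

lemma gmean_conjugation:
  fixes \<rho> :: "'g::topological_group_add \<Rightarrow> complex^'n^'n"
  defines "\<sigma> \<equiv> contragredient \<rho>"
  assumes comp: "compact (UNIV :: 'g set)" and irr: "irreducible_representation \<rho>"
  obtains \<beta> :: "'n \<Rightarrow> 'n \<Rightarrow> complex"
  where "\<And>A. gmean (\<lambda>s. \<sigma> s ** A ** \<sigma> (- s)) = mat (\<Sum>i\<in>UNIV. \<Sum>j\<in>UNIV. A $ i $ j * \<beta> i j)"
proof -
  have \<sigma>: "representation \<sigma>"
    unfolding \<sigma>_def by (rule representation_contragredient[OF irreducible_representationD(1)[OF irr]])
  have cont: "continuous_on UNIV \<sigma>" "continuous_on UNIV (\<lambda>s. \<sigma> (- s))"
    by (auto intro!: continuous_on_representation[OF \<sigma>] continuous_intros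
        continuous_on_compose2[OF continuous_on_representation[OF \<sigma>]])
  \<comment> \<open>An arbitrary index: any diagonal entry of a scalar matrix shows the
    scalar.\<close>
  define k :: 'n where "k = undefined"
  define \<beta> where "\<beta> i j = gmean (\<lambda>s. \<sigma> s $ k $ i * \<sigma> (- s) $ j $ k)" for i j
  show thesis
  proof
    fix A :: "complex^'n^'n"
    obtain z where z: "gmean (\<lambda>s. \<sigma> s ** A ** \<sigma> (- s)) = mat z"
      using gmean_conjugation_scalar[OF comp irr] unfolding \<sigma>_def by blast
    have lin: "linear (\<lambda>M :: complex^'n^'n. M $ k $ k)" by (rule linearI) simp_all
    have "z = gmean (\<lambda>s. \<sigma> s ** A ** \<sigma> (- s)) $ k $ k" by (simp add: z mat_def)
    also have "\<dots> = gmean (\<lambda>s. (\<sigma> s ** A ** \<sigma> (- s)) $ k $ k)"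
      by (rule gmean_linear[OF comp _ lin, symmetric]) (intro continuous_intros cont)
    also have "(\<lambda>s. (\<sigma> s ** A ** \<sigma> (- s)) $ k $ k) =
        (\<lambda>s. \<Sum>j\<in>UNIV. \<Sum>i\<in>UNIV. A $ i $ j * (\<sigma> s $ k $ i * \<sigma> (- s) $ j $ k))"
      by (simp add: matrix_matrix_mult_def sum_distrib_left algebra_simps)
    also have "gmean \<dots> = (\<Sum>j\<in>UNIV. \<Sum>i\<in>UNIV. gmean (\<lambda>s. A $ i $ j * (\<sigma> s $ k $ i * \<sigma> (- s) $ j $ k)))"
      by (simp add: gmean_sum[OF comp] cont continuous_intros)
    also have "\<dots> = (\<Sum>j\<in>UNIV. \<Sum>i\<in>UNIV. A $ i $ j * \<beta> i j)"
    proof -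
      have lin: "linear (\<lambda>x. A $ i $ j * x)" for i j by (rule linearI) (simp_all add: algebra_simps)
      have "gmean (\<lambda>s. A $ i $ j * (\<sigma> s $ k $ i * \<sigma> (- s) $ j $ k)) = A $ i $ j * \<beta> i j" for i j
        unfolding \<beta>_def
        by (rule gmean_linear[OF comp _ lin]) (intro continuous_intros cont)
      then show ?thesis by simp
    qed
    also have "\<dots> = (\<Sum>i\<in>UNIV. \<Sum>j\<in>UNIV. A $ i $ j * \<beta> i j)" by (rule sum.swap)
    finally show "gmean (\<lambda>s. \<sigma> s ** A ** \<sigma> (- s)) = mat (\<Sum>i\<in>UNIV. \<Sum>j\<in>UNIV. A $ i $ j * \<beta> i j)"
      using z by simp
  qed
qed

section \<open>Invariant inner product and dimensions of fixed spaces\<close>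

lemma hinner_self: "hinner v v = of_real ((norm v)\<^sup>2)"
proof -
  have "hinner v v = (\<Sum>i\<in>UNIV. of_real ((norm (v $ i))\<^sup>2))"
    unfolding hinner_def by (intro sum.cong refl) (simp only: complex_norm_square mult.commute)
  also have "\<dots> = of_real ((norm v)\<^sup>2)"
    by (simp add: norm_vec_def L2_set_def sum_nonneg)
  finally show ?thesis .
qed

text \<open>The intertwiner is the Gram matrix of an invariant inner product.\<close>

lemma contragredient_intertwiner:
  fixes \<rho> :: "'g::topological_group_add \<Rightarrow> complex^'n^'n"
  assumes comp: "compact (UNIV :: 'g set)" and \<rho>: "representation \<rho>"
  obtains P where "inj ((*v) P)" "\<And>s. contragredient \<rho> s ** P = P ** \<rho> s"
proof -
  define k where "k s = adj (\<rho> (- s)) ** \<rho> (- s)" for s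
  have \<rho>': "continuous_on UNIV (\<lambda>s. \<rho> (- s))"
    by (rule continuous_on_compose2[OF continuous_on_representation[OF \<rho>]])
       (auto intro!: continuous_intros)
  have k: "continuous_on UNIV k" unfolding k_def by (intro continuous_intros \<rho>')
  define P where "P = gmean k"
  show thesis
  proof
    show "contragredient \<rho> t ** P = P ** \<rho> t" for t
    proof -
      have "k (t + s) = adj (\<rho> (- t)) ** k s ** \<rho> (- t)" for s
        by (simp only: k_def representation_add[OF \<rho>] minus_add matrix_mul_assoc adj_mult)
      then have "P = gmean (\<lambda>s. adj (\<rho> (- t)) ** k s ** \<rho> (- t))"
        using gmean_translate[OF comp k, of t] by (simp add: P_def)
      also have "\<dots> = adj (\<rho> (- t)) ** P ** \<rho> (- t)"
        unfolding P_def by (rule gmean_linear[OF comp k linear_matrix_sandwich])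
      finally have "P ** \<rho> t = adj (\<rho> (- t)) ** P ** \<rho> (- t) ** \<rho> t" by simp
      also have "\<dots> = adj (\<rho> (- t)) ** P"
        using representation_minus_mult[OF \<rho>] by (simp flip: matrix_mul_assoc)
      finally show ?thesis by (simp add: contragredient_def)
    qed
    have "v = 0" if "P *v v = 0" for v
    proof (rule ccontr)
      assume "v \<noteq> 0"
      have n: "continuous_on UNIV (\<lambda>s. norm (\<rho> (- s) *v v))" by (intro continuous_intros \<rho>')
      \<comment> \<open>Positive definiteness: on the compact group the continuous function
        |\<rho>(-s) v| attains its minimum, which is positive because \<open>\<rho> (- t)\<close> is
        invertible, and a positive lower bound survives averaging.\<close>
      obtain t where t: "\<And>s. norm (\<rho> (- t) *v v) \<le> norm (\<rho> (- s) *v v)"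
        using continuous_attains_inf[OF comp UNIV_not_empty n] by auto
      define c where "c = (norm (\<rho> (- t) *v v))\<^sup>2"
      have "\<rho> t *v (\<rho> (- t) *v v) = v" using \<rho> by simp
      then have "\<rho> (- t) *v v \<noteq> 0" using \<open>v \<noteq> 0\<close> by auto
      then have "c > 0" by (simp add: c_def)
      have lin: "linear (\<lambda>M. hinner v (M *v v))"
        by (rule linearI)
           (simp_all add: linear_add[OF linear_matrix_apply] linear_cmul[OF linear_matrix_apply]
             hinner_add_right, simp add: hinner_def scaleR_sum_right)
      have "hinner v (k s *v v) = of_real ((norm (\<rho> (- s) *v v))\<^sup>2)" for s
        by (simp add: k_def hinner_adj hinner_self flip: matrix_vector_mul_assoc)
      then have "c \<le> Re (hinner v (k s *v v))" for s
        using t[of s] by (simp add: c_def power_mono)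
      then have "gmean (\<lambda>s. hinner v (k s *v v)) \<in> {z. Re z \<ge> c}"
        by (intro gmean_in_closed_convex[OF comp] closed_halfspace_Re_ge convex_halfspace_Re_ge)
           (auto simp: hinner_def intro!: continuous_intros k)
      moreover have "gmean (\<lambda>s. hinner v (k s *v v)) = hinner v (P *v v)"
        unfolding P_def by (rule gmean_linear[OF comp k lin])
      ultimately show False using that \<open>c > 0\<close> by (simp add: hinner_def)
    qed
    then show "inj ((*v) P)" by (simp add: vec.inj_iff_eq_0)
  qed
qed

text \<open>The bijective intertwiner \<open>P\<close> carries one fixed space onto the other. Hence
  the dimension function of the theorem may be studied for the contragredient.\<close>

lemma dim_fixed_vectors_contragredient:
  fixes \<rho> :: "'g::topological_group_add \<Rightarrow> complex^'n^'n"
  assumes comp: "compact (UNIV :: 'g set)" and \<rho>: "representation \<rho>"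
  shows "vec.dim (fixed_vectors (contragredient \<rho>) H) = vec.dim (fixed_vectors \<rho> H)"
proof -
  obtain P where inj: "inj ((*v) P)" and P: "\<And>s. contragredient \<rho> s ** P = P ** \<rho> s"
    using contragredient_intertwiner[OF comp \<rho>] by metis
  have surj: "surj ((*v) P)"
    using vec.linear_inj_imp_surj[OF matrix_vector_mul_linear_gen inj] .
  have *: "contragredient \<rho> s *v (P *v v) = P *v (\<rho> s *v v)" for s v
    by (simp add: matrix_vector_mul_assoc P)
  have "fixed_vectors (contragredient \<rho>) H = (*v) P ` fixed_vectors \<rho> H"
  proof (intro equalityI subsetI)
    fix u assume u: "u \<in> fixed_vectors (contragredient \<rho>) H"
    obtain v where v: "u = P *v v" using surj by auto
    have "v \<in> fixed_vectors \<rho> H"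
      using u inj by (auto simp: fixed_vectors_def v * dest: injD)
    then show "u \<in> (*v) P ` fixed_vectors \<rho> H" using v by blast
  qed (auto simp: fixed_vectors_def *)
  moreover have "inj_on ((*v) P) (vec.span (fixed_vectors \<rho> H))"
    using inj by (rule inj_on_subset) simp
  ultimately show ?thesis
    using vec.dim_image_eq[OF matrix_vector_mul_linear_gen] by metis
qed

section \<open>From module generators to generators of the equivariant maps\<close>

context compact_group_action
begin

lemma equivariant_maps_zero: "(\<lambda>x. 0) \<in> equivariant_maps act X \<sigma>"
  by (rule equivariant_mapsI) auto

text \<open>Each coordinate of \<open>\<eta>\<close> is generated separately, which expresses
  \<open>\<eta>\<close> through the maps \<open>\<Psi> g j\<close> with matrix coefficients.
  Invariance of these coefficients allows them to be replaced by their averaged conjugates, which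
  are scalar.\<close>

lemma finitely_generated_imp_equivariant_generators:
  fixes \<rho> :: "'g \<Rightarrow> complex^'n^'n"
  assumes irr: "irreducible_representation \<rho>"
    and fg: "finitely_generated_over (invariant_functions act X) (isotypic_component act X \<rho>)"
  obtains J :: "(('x \<Rightarrow> complex) \<times> 'n) set" and \<psi> where "finite J"
    "\<And>k. k \<in> J \<Longrightarrow> \<psi> k \<in> equivariant_maps act X (contragredient \<rho>)"
    "\<And>\<eta>. \<eta> \<in> equivariant_maps act X (contragredient \<rho>) \<Longrightarrow>
       \<exists>a. (\<forall>k\<in>J. continuous_on X (a k)) \<and> (\<forall>x\<in>X. \<eta> x = (\<Sum>k\<in>J. a k x *s \<psi> k x))"
proof -
  let ?A = "invariant_functions act X" and ?M = "isotypic_component act X \<rho>"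
  define \<sigma> where "\<sigma> = contragredient \<rho>"
  let ?E = "equivariant_maps act X \<sigma>"
  have \<rho>: "representation \<rho>" by (rule irreducible_representationD(1)[OF irr])
  have \<sigma>: "representation \<sigma>" unfolding \<sigma>_def by (rule representation_contragredient[OF \<rho>])
  have cont: "continuous_on UNIV \<sigma>" "continuous_on UNIV (\<lambda>s. \<sigma> (- s))"
    by (auto intro!: continuous_on_representation[OF \<sigma>] continuous_intros
        continuous_on_compose2[OF continuous_on_representation[OF \<sigma>]])
  obtain F where F: "finite F" "F \<subseteq> ?M" "?M = {\<Sum>g\<in>F. a g * g | a. \<forall>g\<in>F. a g \<in> ?A}"
    using fg unfolding finitely_generated_over_def by blast
  have "\<forall>g. \<exists>\<Psi>. g \<in> F \<longrightarrow> (\<forall>j. \<Psi> j \<in> ?E) \<and> g = (\<lambda>x. cnj (\<Sum>j\<in>UNIV. \<Psi> j x $ j))"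
    using isotypic_imp_cnj_coordinates[OF \<rho>] F(2) unfolding \<sigma>_def by (metis subsetD)
  from choice[OF this] obtain \<Psi> where *: "\<forall>g. g \<in> F \<longrightarrow>
      (\<forall>j. \<Psi> g j \<in> ?E) \<and> g = (\<lambda>x. cnj (\<Sum>j\<in>UNIV. \<Psi> g j x $ j))" by (rule exE)
  have \<Psi>: "\<Psi> g j \<in> ?E" "g x = cnj (\<Sum>j\<in>UNIV. \<Psi> g j x $ j)" if "g \<in> F" for g j x
  proof -
    show "\<Psi> g j \<in> ?E" using * that by blast
    have "g = (\<lambda>x. cnj (\<Sum>j\<in>UNIV. \<Psi> g j x $ j))" using * that by blast
    then show "g x = cnj (\<Sum>j\<in>UNIV. \<Psi> g j x $ j)" by (rule fun_cong)
  qed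
  obtain \<beta> where \<beta>: "\<And>A. gmean (\<lambda>s. \<sigma> s ** A ** \<sigma> (- s)) = mat (\<Sum>i\<in>UNIV. \<Sum>j\<in>UNIV. A $ i $ j * \<beta> i j)"
    by (rule gmean_conjugation[OF compact_group irr, folded \<sigma>_def]) (rule that)
  define J where "J = F \<times> (UNIV :: 'n set)"
  have "\<exists>a. (\<forall>k\<in>J. continuous_on X (a k)) \<and> (\<forall>x\<in>X. \<eta> x = (\<Sum>k\<in>J. a k x *s (case k of (g, j) \<Rightarrow> \<Psi> g j) x))"
    if \<eta>: "\<eta> \<in> ?E" for \<eta>
  proof -
    have "\<exists>a. (\<forall>g\<in>F. a g \<in> ?A) \<and> (\<lambda>x. cnj (\<eta> x $ i)) = (\<Sum>g\<in>F. a g * g)" for i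
    proof -
      have "(\<lambda>x. cnj (\<Sum>k\<in>UNIV. (if k = i then \<eta> else (\<lambda>x. 0)) x $ k)) \<in> ?M"
        by (rule cnj_coordinates_in_isotypic[OF irr])
           (use \<eta> equivariant_maps_zero in \<open>auto simp: \<sigma>_def\<close>)
      moreover have "(\<Sum>k\<in>UNIV. (if k = i then \<eta> else (\<lambda>x. 0)) x $ k) = \<eta> x $ i" for x
        by (simp add: if_distrib[of "\<lambda>f. f x $ _"] cong: if_cong)
      ultimately have "(\<lambda>x. cnj (\<eta> x $ i)) \<in> ?M" by simp
      then show ?thesis unfolding F(3) by blast
    qed
    then have "\<forall>i. \<exists>a. (\<forall>g\<in>F. a g \<in> ?A) \<and> (\<lambda>x. cnj (\<eta> x $ i)) = (\<Sum>g\<in>F. a g * g)"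
      by (rule allI)
    from choice[OF this] obtain a
      where *: "\<forall>i. (\<forall>g\<in>F. a i g \<in> ?A) \<and> (\<lambda>x. cnj (\<eta> x $ i)) = (\<Sum>g\<in>F. a i g * g)" by (rule exE)
    have a: "\<And>i g. g \<in> F \<Longrightarrow> a i g \<in> ?A" using * by blast
    have \<eta>a: "cnj (\<eta> x $ i) = (\<Sum>g\<in>F. a i g x * g x)" for i x
    proof -
      have "(\<lambda>x. cnj (\<eta> x $ i)) = (\<Sum>g\<in>F. a i g * g)" using * by blast
      from fun_cong[OF this, of x] show ?thesis by (simp add: sum_fun_apply)
    qed
    \<comment> \<open>Only column \<open>j\<close> is nonzero: it multiplies the j-th entry of
      \<open>\<Psi> g j\<close> by the coefficient belonging to coordinate i of
      \<open>\<eta>\<close>.\<close>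
    define A where "A g j x = (\<chi> i j'. if j' = j then cnj (a i g x) else 0)" for g x and j :: 'n
    have \<eta>A: "\<eta> x = (\<Sum>g\<in>F. \<Sum>j\<in>UNIV. A g j x *v \<Psi> g j x)" for x
    proof -
      have "\<eta> x $ i = (\<Sum>g\<in>F. \<Sum>j\<in>UNIV. A g j x *v \<Psi> g j x) $ i" for i
      proof -
        have "\<eta> x $ i = cnj (\<Sum>g\<in>F. a i g x * g x)" by (simp flip: \<eta>a)
        also have "\<dots> = (\<Sum>g\<in>F. cnj (a i g x) * cnj (g x))" by simp
        also have "\<dots> = (\<Sum>g\<in>F. cnj (a i g x) * (\<Sum>j\<in>UNIV. \<Psi> g j x $ j))"
          by (intro sum.cong refl) (subst \<Psi>(2), simp_all)
        also have "\<dots> = (\<Sum>g\<in>F. \<Sum>j\<in>UNIV. A g j x *v \<Psi> g j x) $ i"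
          by (simp add: A_def matrix_vector_mult_def sum_distrib_left if_distrib[of "\<lambda>x. x * _"] cong: if_cong)
        finally show ?thesis .
      qed
      then show ?thesis by (simp add: vec_eq_iff)
    qed
    \<comment> \<open>The scalar that \<open>gmean_conjugation\<close> assigns to the matrix
      \<open>A g j x\<close>.\<close>
    define b where "b = (\<lambda>(g, j) x. \<Sum>i\<in>UNIV. cnj (a i g x) * \<beta> i j)"
    have "continuous_on X (b k)" if "k \<in> J" for k
      using that a by (auto simp: b_def J_def invariant_functions_iff intro!: continuous_intros)
    moreover have "\<eta> x = (\<Sum>k\<in>J. b k x *s (case k of (g, j) \<Rightarrow> \<Psi> g j) x)" if x: "x \<in> X" for x
    proof -
      have Ax: "A g j (act (- s) x) = A g j x" if "g \<in> F" for g j s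
      proof -
        have "a i g (act (- s) x) = a i g x" for i
          using a[OF that] x by (simp add: invariant_functions_iff)
        then show ?thesis by (simp only: A_def)
      qed
      \<comment> \<open>The relation is moved to \<open>act (- s) x\<close> and back by
        equivariance; as it holds for every s with the same left side, the mean over s may be
        taken.\<close>
      have *: "\<eta> x = (\<Sum>(g, j)\<in>J. (\<sigma> s ** A g j x ** \<sigma> (- s)) *v \<Psi> g j x)" for s
      proof -
        have "\<eta> x = \<sigma> s *v \<eta> (act (- s) x)"
          using equivariant_mapsD(3)[OF \<eta> x] \<sigma> by simp
        also have "\<dots> = (\<Sum>g\<in>F. \<Sum>j\<in>UNIV. \<sigma> s *v (A g j x *v (\<sigma> (- s) *v \<Psi> g j x)))"
          by (subst \<eta>A) (simp add: vec.linear_sum[OF matrix_vector_mul_linear_gen] Ax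
              equivariant_mapsD(3)[OF \<Psi>(1) x])
        also have "\<dots> = (\<Sum>(g, j)\<in>J. (\<sigma> s ** A g j x ** \<sigma> (- s)) *v \<Psi> g j x)"
          by (simp add: J_def sum.cartesian_product matrix_vector_mul_assoc matrix_mul_assoc)
        finally show ?thesis .
      qed
      have "finite J" using F(1) by (simp add: J_def)
      have k: "continuous_on UNIV (\<lambda>s. \<sigma> s ** A g j x ** \<sigma> (- s))" for g j
        by (intro continuous_intros cont)
      have "\<eta> x = gmean (\<lambda>s::'g. \<eta> x)" by (simp add: gmean_const[OF compact_group])
      also have "\<dots> = gmean (\<lambda>s. \<Sum>(g, j)\<in>J. (\<sigma> s ** A g j x ** \<sigma> (- s)) *v \<Psi> g j x)"
        by (rule arg_cong[where f = gmean]) (rule ext, rule *)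
      also have "\<dots> = (\<Sum>(g, j)\<in>J. gmean (\<lambda>s. (\<sigma> s ** A g j x ** \<sigma> (- s)) *v \<Psi> g j x))"
        unfolding case_prod_unfold
        by (rule gmean_sum[OF compact_group \<open>finite J\<close>]) (intro continuous_intros k)
      also have "\<dots> = (\<Sum>(g, j)\<in>J. gmean (\<lambda>s. \<sigma> s ** A g j x ** \<sigma> (- s)) *v \<Psi> g j x)"
        unfolding case_prod_unfold
        by (intro sum.cong refl gmean_linear[OF compact_group k linear_matrix_apply])
      also have "\<dots> = (\<Sum>(g, j)\<in>J. b (g, j) x *s \<Psi> g j x)"
        unfolding \<beta> mat_vector_mult
        by (simp add: b_def A_def if_distrib[of "\<lambda>x. x * _"] cong: if_cong)
      also have "\<dots> = (\<Sum>k\<in>J. b k x *s (case k of (g, j) \<Rightarrow> \<Psi> g j) x)"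
        by (intro sum.cong refl) auto
      finally show ?thesis .
    qed
    ultimately show ?thesis by blast
  qed
  moreover have "(case k of (g, j) \<Rightarrow> \<Psi> g j) \<in> ?E" if "k \<in> J" for k
    using that \<Psi>(1) by (auto simp: J_def)
  moreover have "finite J" using F(1) by (simp add: J_def)
  ultimately show thesis using that[of J "\<lambda>k. case k of (g, j) \<Rightarrow> \<Psi> g j"] unfolding \<sigma>_def by blast
qed

end

subsection \<open>Local frames of equivariant maps\<close>

lemma locally_constant_on_iff:
  "locally (\<lambda>U. f constant_on U) X \<longleftrightarrow>
     (\<forall>x\<in>X. \<exists>V. openin (top_of_set X) V \<and> x \<in> V \<and> (\<forall>y\<in>V. f y = f x))"
proof
  assume loc: "locally (\<lambda>U. f constant_on U) X"
  show "\<forall>x\<in>X. \<exists>V. openin (top_of_set X) V \<and> x \<in> V \<and> (\<forall>y\<in>V. f y = f x)"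
  proof
    fix x assume "x \<in> X"
    then obtain U V where "openin (top_of_set X) U" "f constant_on V" "x \<in> U" "U \<subseteq> V"
      using loc[unfolded locally_def, rule_format, of X x] by auto
    then show "\<exists>V. openin (top_of_set X) V \<and> x \<in> V \<and> (\<forall>y\<in>V. f y = f x)"
      by (intro exI[of _ U]) (auto simp: constant_on_def subset_iff)
  qed
next
  assume *: "\<forall>x\<in>X. \<exists>V. openin (top_of_set X) V \<and> x \<in> V \<and> (\<forall>y\<in>V. f y = f x)"
  show "locally (\<lambda>U. f constant_on U) X"
    unfolding locally_def
  proof (intro allI impI)
    fix W x assume W: "openin (top_of_set X) W \<and> x \<in> W"
    then have "x \<in> X" using openin_imp_subset by blast
    with * have "\<exists>V. openin (top_of_set X) V \<and> x \<in> V \<and> (\<forall>y\<in>V. f y = f x)" by (rule bspec)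
    then obtain V where "openin (top_of_set X) V \<and> x \<in> V \<and> (\<forall>y\<in>V. f y = f x)" by (rule exE)
    then have V: "openin (top_of_set X) V" "x \<in> V" "\<forall>y\<in>V. f y = f x" by blast+
    then have "f constant_on (V \<inter> W)" unfolding constant_on_def by blast
    then show "\<exists>U V. openin (top_of_set X) U \<and> f constant_on V \<and> x \<in> U \<and> U \<subseteq> V \<and> V \<subseteq> W"
      using openin_Int[OF V(1)] V(2) W by blast
  qed
qed

lemma subspace_fixed_vectors: "vec.subspace (fixed_vectors \<sigma> H)"
  by (auto simp: vec.subspace_def fixed_vectors_def vec.add vec.scale)

text \<open>The columns outside \<open>S\<close> are constant vectors that complete the frame to a
  square matrix, so a nonzero determinant, an open condition, certifies independence of the
  frame.\<close>

definition frame_matrix ::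
    "'n set \<Rightarrow> ('n \<Rightarrow> 'x \<Rightarrow> complex^'n) \<Rightarrow> ('n \<Rightarrow> complex^'n) \<Rightarrow> 'x \<Rightarrow> complex^'n^'n" where
  "frame_matrix S \<Phi> w x = (\<chi> i k. (if k \<in> S then \<Phi> k x else w k) $ i)"

definition supported_vectors :: "'n set \<Rightarrow> (complex^'n) set" where
  "supported_vectors S = {c. \<forall>k. k \<notin> S \<longrightarrow> c $ k = 0}"

lemma subspace_supported_vectors: "vec.subspace (supported_vectors S)"
  by (auto simp: vec.subspace_def supported_vectors_def)

lemma frame_matrix_mult:
  assumes "c \<in> supported_vectors S"
  shows "frame_matrix S \<Phi> w x *v c = (\<Sum>k\<in>S. c $ k *s \<Phi> k x)"
proof -
  have "frame_matrix S \<Phi> w x *v c = (\<Sum>k\<in>UNIV. c $ k *s (if k \<in> S then \<Phi> k x else w k))"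
    by (simp add: frame_matrix_def matrix_vector_mult_def vec_eq_iff mult.commute)
  also have "\<dots> = (\<Sum>k\<in>S. c $ k *s (if k \<in> S then \<Phi> k x else w k))"
    using assms by (intro sum.mono_neutral_right) (auto simp: supported_vectors_def)
  finally show ?thesis by simp
qed

lemma frame_matrix_cong:
  "(\<And>k. k \<in> S \<Longrightarrow> \<Phi> k x = w k) \<Longrightarrow> frame_matrix S \<Phi> w x = (\<chi> i k. w k $ i)"
  by (simp add: frame_matrix_def vec_eq_iff)

lemma det_nonzero_inj:
  fixes A :: "complex^'n^'n"
  assumes "det A \<noteq> 0"
  shows "inj ((*v) A)"
  using assms invertible_det_nz[of A] invertible_left_inverse[of A] matrix_left_invertible_injective[of A]
  by simp

context compact_group_action
begin

lemma continuous_on_frame_matrix: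
  assumes "\<And>k. k \<in> S \<Longrightarrow> \<Phi> k \<in> equivariant_maps act X \<sigma>"
  shows "continuous_on X (frame_matrix S \<Phi> w)"
proof -
  have "continuous_on X (\<lambda>x. (if k \<in> S then \<Phi> k x else w k) $ i)" for i k
    by (cases "k \<in> S")
       (auto intro!: continuous_on_component continuous_intros equivariant_mapsD(1)[OF assms])
  then show ?thesis
    unfolding frame_matrix_def[abs_def] by (intro continuous_on_vec_lambda)
qed

text \<open>A basis of the fixed space is completed to a basis of the carrier. The vectors from the
  fixed space, indexed by \<open>S\<close>, are values of equivariant maps by
  \<open>equivariant_extension\<close>.\<close>

lemma frame_exists:
  fixes \<sigma> :: "'g \<Rightarrow> complex^'n^'n"
  assumes \<sigma>: "representation \<sigma>" and x0: "x0 \<in> X"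
  shows "\<exists>S \<Phi> w. (\<forall>k\<in>S. \<Phi> k \<in> equivariant_maps act X \<sigma>) \<and> det (frame_matrix S \<Phi> w x0) \<noteq> 0 \<and>
           card S = vec.dim (fixed_vectors \<sigma> (isotropy act x0))"
proof -
  define V where "V = fixed_vectors \<sigma> (isotropy act x0)"
  obtain b where b: "b \<subseteq> V" "vec.independent b" "V \<subseteq> vec.span b" "card b = vec.dim V"
    by (rule vec.basis_exists)
  define b' where "b' = vec.extend_basis b"
  have b': "b \<subseteq> b'" "vec.independent b'" "vec.span b' = UNIV"
    using vec.extend_basis_superset[OF b(2)] vec.independent_extend_basis[OF b(2)]
      vec.span_extend_basis[OF b(2)] by (auto simp: b'_def)
  have "finite b'" using b'(2) by (rule vec.finiteI_independent)
  moreover have "card b' = CARD('n)"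
    using vec.dim_eq_card[of b' UNIV] b' by (simp add: vec.dim_UNIV card_cart_basis)
  ultimately obtain e where e: "bij_betw e (UNIV :: 'n set) b'"
    using finite_same_card_bij[of "UNIV :: 'n set" b'] by auto
  define S where "S = e -` b"
  have eS: "bij_betw e S b"
    using e b'(1) by (auto simp: S_def bij_betw_def inj_on_def)
  have "\<forall>k. \<exists>\<phi>. k \<in> S \<longrightarrow> \<phi> \<in> equivariant_maps act X \<sigma> \<and> \<phi> x0 = e k"
  proof
    fix k
    show "\<exists>\<phi>. k \<in> S \<longrightarrow> \<phi> \<in> equivariant_maps act X \<sigma> \<and> \<phi> x0 = e k"
    proof (cases "k \<in> S")
      case True
      then have "e k \<in> fixed_vectors \<sigma> (isotropy act x0)" using b(1) by (auto simp: S_def V_def)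
      then obtain \<phi> where "\<phi> \<in> equivariant_maps act X \<sigma>" "\<phi> x0 = e k"
        by (rule equivariant_extension[OF \<sigma> x0])
      then show ?thesis by blast
    qed auto
  qed
  from choice[OF this] obtain \<Phi>
    where \<Phi>: "\<forall>k. k \<in> S \<longrightarrow> \<Phi> k \<in> equivariant_maps act X \<sigma> \<and> \<Phi> k x0 = e k" by (rule exE)
  define A where "A = (\<chi> i k. e k $ i)"
  have "column k A = e k" for k by (simp add: A_def column_def vec_eq_iff)
  then have "columns A = b'" using e by (auto simp: columns_def bij_betw_def)
  then have "\<exists>B. A ** B = mat 1" using b'(3) matrix_right_invertible_span_columns by blast
  then have "det A \<noteq> 0" using invertible_right_inverse invertible_det_nz by blast
  moreover have "frame_matrix S \<Phi> e x0 = A"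
    unfolding A_def by (rule frame_matrix_cong) (use \<Phi> in blast)
  moreover have "card S = vec.dim V" using bij_betw_same_card[OF eS] b(4) by simp
  ultimately show ?thesis using \<Phi> unfolding V_def by metis
qed

text \<open>Where the determinant is nonzero, the columns in \<open>S\<close> span a subspace of the
  fixed space of dimension exactly \<open>card S\<close>. The dimension can thus only exceed
  \<open>card S\<close>, and equality means that the frame spans.\<close>

lemma frame_dim:
  fixes \<sigma> :: "'g \<Rightarrow> complex^'n^'n"
  assumes \<Phi>: "\<And>k. k \<in> S \<Longrightarrow> \<Phi> k \<in> equivariant_maps act X \<sigma>"
    and x: "x \<in> X" and det: "det (frame_matrix S \<Phi> w x) \<noteq> 0"
  shows "vec.dim (fixed_vectors \<sigma> (isotropy act x)) = card S \<longleftrightarrow>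
         fixed_vectors \<sigma> (isotropy act x) \<subseteq> (*v) (frame_matrix S \<Phi> w x) ` supported_vectors S"
proof -
  let ?B = "frame_matrix S \<Phi> w x" and ?U = "supported_vectors S"
  let ?V = "fixed_vectors \<sigma> (isotropy act x)"
  have sub: "(*v) ?B ` ?U \<subseteq> ?V"
  proof clarify
    fix c :: "complex^'n" assume "c \<in> ?U"
    then have "?B *v c = (\<Sum>k\<in>S. c $ k *s \<Phi> k x)" by (rule frame_matrix_mult)
    also have "\<dots> \<in> ?V"
      by (intro vec.subspace_sum vec.subspace_scale subspace_fixed_vectors equivariant_value_fixed \<Phi> x)
    finally show "?B *v c \<in> ?V" .
  qed
  have "inj ((*v) ?B)" by (rule det_nonzero_inj[OF det])
  then have "inj_on ((*v) ?B) (vec.span ?U)" by (rule inj_on_subset) simp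
  from vec.dim_image_eq[OF matrix_vector_mul_linear_gen this]
  have dim: "vec.dim ((*v) ?B ` ?U) = card S"
    using dim_substandard_cart[of S, where 'a = complex] by (simp add: supported_vectors_def)
  have sp: "vec.subspace ((*v) ?B ` ?U)"
    by (rule vec.linear_subspace_image[OF matrix_vector_mul_linear_gen subspace_supported_vectors])
  show ?thesis
  proof
    assume "vec.dim ?V = card S"
    then show "?V \<subseteq> (*v) ?B ` ?U"
      using vec.subspace_dim_equal[OF sp subspace_fixed_vectors sub] dim by simp
  next
    assume "?V \<subseteq> (*v) ?B ` ?U"
    then show "vec.dim ?V = card S" using sub dim by (metis subset_antisym)
  qed
qed

subsection \<open>Locally constant dimension implies finite generation\<close>

text \<open>Finitely many frames, each used on the part of its level set where its determinant is
  nonzero, cover \<open>X\<close>. Their Cramer formulas are glued with weights that vanish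
  elsewhere.\<close>

lemma locally_constant_imp_equivariant_generators:
  fixes \<sigma> :: "'g \<Rightarrow> complex^'n^'n"
  assumes \<sigma>: "representation \<sigma>"
    and loc: "locally (\<lambda>U. (\<lambda>x. vec.dim (fixed_vectors \<sigma> (isotropy act x))) constant_on U) X"
  obtains J :: "('x \<times> 'n) set" and \<Phi> where "finite J"
    "\<And>k. k \<in> J \<Longrightarrow> \<Phi> k \<in> equivariant_maps act X \<sigma>"
    "\<And>\<psi>. \<psi> \<in> equivariant_maps act X \<sigma> \<Longrightarrow>
       \<exists>a. (\<forall>k\<in>J. a k \<in> invariant_functions act X) \<and> (\<forall>x\<in>X. \<psi> x = (\<Sum>k\<in>J. a k x *s \<Phi> k x))"
proof -
  let ?E = "equivariant_maps act X \<sigma>"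
  define d where "d x = vec.dim (fixed_vectors \<sigma> (isotropy act x))" for x
  have loc': "\<exists>V. openin (top_of_set X) V \<and> x \<in> V \<and> (\<forall>y\<in>V. d y = d x)" if "x \<in> X" for x
    using loc that unfolding locally_constant_on_iff d_def by blast
  have level: "openin (top_of_set X) {y \<in> X. d y \<in> N}" for N
  proof (subst openin_subopen, intro ballI)
    fix x assume x: "x \<in> {y \<in> X. d y \<in> N}"
    then have "x \<in> X" by simp
    from loc'[OF this] obtain V where "openin (top_of_set X) V \<and> x \<in> V \<and> (\<forall>y\<in>V. d y = d x)"
      by (rule exE)
    then have V: "openin (top_of_set X) V" "x \<in> V" "\<forall>y\<in>V. d y = d x" by blast+
    have "V \<subseteq> {y \<in> X. d y \<in> N}"
    proof
      fix y assume "y \<in> V"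
      then have "d y = d x" "y \<in> X" using V(3) openin_imp_subset[OF V(1)] by blast+
      then show "y \<in> {y \<in> X. d y \<in> N}" using x by simp
    qed
    then show "\<exists>T. openin (top_of_set X) T \<and> x \<in> T \<and> T \<subseteq> {y \<in> X. d y \<in> N}"
      using V by blast
  qed
  have "\<forall>t. \<exists>F. t \<in> X \<longrightarrow> (case F of (S, \<Phi>, w) \<Rightarrow> (\<forall>k\<in>S. \<Phi> k \<in> ?E) \<and>
          det (frame_matrix S \<Phi> w t) \<noteq> 0 \<and> card S = d t)"
    using frame_exists[OF \<sigma>] unfolding d_def by fast
  from choice[OF this] obtain F where F: "\<forall>t. t \<in> X \<longrightarrow> (case F t of (S, \<Phi>, w) \<Rightarrow> (\<forall>k\<in>S. \<Phi> k \<in> ?E) \<and>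
          det (frame_matrix S \<Phi> w t) \<noteq> 0 \<and> card S = d t)" by (rule exE)
  define S where "S t = fst (F t)" for t
  define \<Phi> where "\<Phi> t = fst (snd (F t))" for t
  define B where "B t = frame_matrix (S t) (\<Phi> t) (snd (snd (F t)))" for t
  have \<Phi>: "\<Phi> t k \<in> ?E" if "t \<in> X" "k \<in> S t" for t k
    using F that by (force simp: S_def \<Phi>_def case_prod_unfold)
  have B: "det (B t t) \<noteq> 0" "card (S t) = d t" if "t \<in> X" for t
    using F that by (force simp: S_def \<Phi>_def B_def case_prod_unfold)+
  have Bcont: "continuous_on X (B t)" if "t \<in> X" for t
    unfolding B_def by (rule continuous_on_frame_matrix) (rule \<Phi>[OF that])
  \<comment> \<open>The indicator of a level set of the dimension; it is continuous exactly because
    level sets of a locally constant function are open and closed.\<close>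
  define e where "e t x = (if d x = d t then 1 else 0 :: complex)" for t x
  have econt: "continuous_on X (e t)" for t
  proof -
    have "openin (top_of_set X) (X \<inter> e t -` U)" for U
    proof -
      have "X \<inter> e t -` U = {y \<in> X. d y \<in> {n. (if n = d t then 1 else 0) \<in> U}}"
        by (auto simp: e_def)
      then show ?thesis by (simp only: level)
    qed
    then show ?thesis by (simp add: continuous_openin_preimage_eq)
  qed
  define D where "D t x = det (B t x)" for t x
  have Dcont: "continuous_on X (D t)" if "t \<in> X" for t
    unfolding D_def by (intro continuous_intros Bcont that)
  define W where "W t = {x \<in> X. d x = d t \<and> D t x \<noteq> 0}" for t
  have Wopen: "openin (top_of_set X) (W t)" if "t \<in> X" for t
  proof -
    have "openin (top_of_set X) (X \<inter> D t -` (- {0}))"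
      by (rule continuous_openin_preimage_gen[OF Dcont[OF that]]) auto
    from openin_Int[OF this level[of "{d t}"]]
    show ?thesis by (rule back_subst[of "openin _"]) (auto simp: W_def)
  qed
  have "\<exists>T\<subseteq>X. finite T \<and> X \<subseteq> (\<Union>t\<in>T. W t)"
  proof -
    have "\<forall>t. \<exists>O'. t \<in> X \<longrightarrow> open O' \<and> W t = X \<inter> O'"
      using Wopen by (auto simp: openin_open)
    from choice[OF this] obtain O' where O': "\<forall>t. t \<in> X \<longrightarrow> open (O' t) \<and> W t = X \<inter> O' t" by (rule exE)
    have "X \<subseteq> (\<Union>t\<in>X. O' t)"
    proof
      fix t assume "t \<in> X"
      then have "t \<in> W t" using B(1) by (simp add: W_def D_def)
      then show "t \<in> (\<Union>t\<in>X. O' t)" using O' \<open>t \<in> X\<close> by blast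
    qed
    then obtain T where "T \<subseteq> X" "finite T" "X \<subseteq> (\<Union>t\<in>T. O' t)"
      using compactE_image[OF compact_space, of X O'] O' by blast
    then show ?thesis using O' by (intro exI[of _ T]) blast
  qed
  then obtain T where T: "T \<subseteq> X" "finite T" "X \<subseteq> (\<Union>t\<in>T. W t)" by blast
  \<comment> \<open>Total weight: the terms are |D|^2 on the relevant level sets and 0 elsewhere,
    and the cover makes the sum positive. This common denominator replaces division by the single
    determinants.\<close>
  define q where "q x = (\<Sum>t\<in>T. cnj (D t x) * D t x * e t x)" for x
  have qcont: "continuous_on X q"
    unfolding q_def using T(1) by (intro continuous_intros Dcont econt) auto
  have q0: "q x \<noteq> 0" if x: "x \<in> X" for x
  proof -
    obtain t where t: "t \<in> T" "x \<in> W t" using T(3) x by blast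
    have eq: "q x = of_real (\<Sum>t\<in>T. (cmod (D t x))\<^sup>2 * (if d x = d t then 1 else 0))"
      unfolding q_def of_real_sum
      by (intro sum.cong refl) (simp add: e_def complex_norm_square mult.commute del: of_real_power)
    have "0 < (cmod (D t x))\<^sup>2 * (if d x = d t then 1 else 0)"
      using t(2) by (simp add: W_def)
    also have "\<dots> \<le> (\<Sum>t\<in>T. (cmod (D t x))\<^sup>2 * (if d x = d t then 1 else 0))"
      by (rule member_le_sum[OF t(1)]) (auto simp: T(2))
    finally show ?thesis unfolding eq of_real_eq_0_iff by (rule less_imp_neq[symmetric])
  qed
  define J where "J = (SIGMA t:T. S t)"
  have "finite J" unfolding J_def using T(2) by auto
  moreover have "(case k of (t, i) \<Rightarrow> \<Phi> t i) \<in> ?E" if "k \<in> J" for k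
    using that T(1) \<Phi> by (auto simp: J_def)
  moreover have "\<exists>a. (\<forall>k\<in>J. a k \<in> invariant_functions act X) \<and>
      (\<forall>x\<in>X. \<psi> x = (\<Sum>k\<in>J. a k x *s (case k of (t, i) \<Rightarrow> \<Phi> t i) x))" if \<psi>: "\<psi> \<in> ?E" for \<psi>
  proof -
    \<comment> \<open>Cramer's numerator: column \<open>i\<close> of the frame matrix is replaced by
      \<open>\<psi> x\<close>.\<close>
    define N where "N t i x = det (\<chi> r k. if k = i then \<psi> x $ r else B t x $ r $ k)" for t i x
    have Ncont: "continuous_on X (N t i)" if "t \<in> X" for t i
    proof -
      have "continuous_on X (\<lambda>x. if k = i then \<psi> x $ r else B t x $ r $ k)" for r k
        by (cases "k = i")
           (auto intro!: continuous_on_component equivariant_mapsD(1)[OF \<psi>] Bcont[OF that])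
      then show ?thesis
        unfolding N_def by (intro continuous_on_det continuous_on_vec_lambda)
    qed
    text \<open>Cramer's rule, multiplied by the determinant so that no division occurs where it vanishes.\<close>
    have cramer: "(cnj (D t x) * D t x * e t x) *s \<psi> x =
        (\<Sum>i\<in>S t. (cnj (D t x) * e t x * N t i x) *s \<Phi> t i x)" if t: "t \<in> X" and x: "x \<in> X" for t x
    proof (cases "x \<in> W t")
      case True
      then have "D t x \<noteq> 0" and "d x = card (S t)" using B(2)[OF t] by (auto simp: W_def)
      then have "fixed_vectors \<sigma> (isotropy act x) \<subseteq> (*v) (B t x) ` supported_vectors (S t)"
        using frame_dim[of "S t" "\<Phi> t" \<sigma> x "snd (snd (F t))"] \<Phi>[OF t] x
        unfolding d_def D_def B_def by blast
      then obtain c where c: "c \<in> supported_vectors (S t)" "\<psi> x = B t x *v c"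
        using equivariant_value_fixed[OF \<psi> x] by blast
      have N: "N t i x = c $ i * D t x" for i
        unfolding N_def D_def c(2) by (rule cramer_lemma)
      have "(cnj (D t x) * D t x * e t x) *s \<psi> x =
          (cnj (D t x) * D t x * e t x) *s (\<Sum>i\<in>S t. c $ i *s \<Phi> t i x)"
        unfolding c(2) B_def frame_matrix_mult[OF c(1)] ..
      also have "\<dots> = (\<Sum>i\<in>S t. (cnj (D t x) * e t x * N t i x) *s \<Phi> t i x)"
        by (simp add: vec.scale_sum_right N mult_ac)
      finally show ?thesis .
    next
      case False
      then have "cnj (D t x) * e t x = 0" using x by (auto simp: W_def e_def)
      then show ?thesis by (auto simp: mult.commute mult.left_commute)
    qed
    define c where "c = (\<lambda>(t, i) x. cnj (D t x) * e t x * N t i x / q x)"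
    have ccont: "continuous_on X (c k)" if "k \<in> J" for k
    proof -
      obtain t i where k: "k = (t, i)" "t \<in> X" using \<open>k \<in> J\<close> T(1) by (auto simp: J_def)
      show ?thesis
        unfolding c_def k(1) prod.case
        by (intro continuous_intros Dcont econt Ncont qcont k(2)) (use q0 in auto)
    qed
    have \<psi>c: "\<psi> x = (\<Sum>k\<in>J. c k x *s (case k of (t, i) \<Rightarrow> \<Phi> t i) x)" if x: "x \<in> X" for x
    proof -
      have "q x *s \<psi> x = (\<Sum>t\<in>T. (cnj (D t x) * D t x * e t x) *s \<psi> x)"
        unfolding q_def by (rule vec.scale_sum_left)
      also have "\<dots> = (\<Sum>t\<in>T. \<Sum>i\<in>S t. (cnj (D t x) * e t x * N t i x) *s \<Phi> t i x)"
        using T(1) by (intro sum.cong refl cramer[OF _ x]) auto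
      also have "\<dots> = (\<Sum>(t, i)\<in>J. (cnj (D t x) * e t x * N t i x) *s \<Phi> t i x)"
        unfolding J_def by (rule sum.Sigma) (auto simp: T(2))
      finally have "inverse (q x) *s (q x *s \<psi> x) =
          inverse (q x) *s (\<Sum>(t, i)\<in>J. (cnj (D t x) * e t x * N t i x) *s \<Phi> t i x)" by simp
      then show ?thesis
        using q0[OF x] by (simp add: vec.scale_sum_right c_def case_prod_unfold field_simps)
    qed
    have main: "\<psi> x = (\<Sum>k\<in>J. invariant_average act X (c k) x *s (case k of (t, i) \<Rightarrow> \<Phi> t i) x)"
      if x: "x \<in> X" for x
    proof -
      let ?\<Phi> = "\<lambda>k. case k of (t, i) \<Rightarrow> \<Phi> t i"
      have \<Phi>E: "?\<Phi> k \<in> ?E" if "k \<in> J" for k using that T(1) \<Phi> by (auto simp: J_def)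
      \<comment> \<open>Equivariance of both sides moves the formula from \<open>act (- s) x\<close>
        to x and leaves s in the coefficients only, so averaging over s makes them
        invariant.\<close>
      have *: "\<psi> x = (\<Sum>k\<in>J. c k (act (- s) x) *s ?\<Phi> k x)" for s
      proof -
        have "\<psi> x = \<sigma> s *v \<psi> (act (- s) x)"
          using equivariant_mapsD(3)[OF \<psi> x] \<sigma> by simp
        also have "\<dots> = (\<Sum>k\<in>J. c k (act (- s) x) *s (\<sigma> s *v ?\<Phi> k (act (- s) x)))"
          using x by (simp add: \<psi>c vec.linear_sum[OF matrix_vector_mul_linear_gen] vec.scale)
        also have "\<dots> = (\<Sum>k\<in>J. c k (act (- s) x) *s ?\<Phi> k x)"
          using equivariant_mapsD(3)[OF \<Phi>E x] \<sigma> by simp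
        finally show ?thesis .
      qed
      have cx: "continuous_on UNIV (\<lambda>s. c k (act (- s) x))" if "k \<in> J" for k
        by (rule continuous_on_translated_group[OF ccont[OF that] x])
      have lin: "linear (\<lambda>z. z *s v)" for v :: "complex^'n"
        by (rule linearI) (simp_all add: vec_eq_iff algebra_simps)
      have "\<psi> x = gmean (\<lambda>s::'g. \<psi> x)" by (simp add: gmean_const[OF compact_group])
      also have "\<dots> = gmean (\<lambda>s. \<Sum>k\<in>J. c k (act (- s) x) *s ?\<Phi> k x)"
        by (rule arg_cong[where f = gmean]) (rule ext, rule *)
      also have "\<dots> = (\<Sum>k\<in>J. gmean (\<lambda>s. c k (act (- s) x) *s ?\<Phi> k x))"
        by (rule gmean_sum[OF compact_group \<open>finite J\<close>])
           (auto simp: vector_scalar_mult_def intro!: continuous_intros cx)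
      also have "\<dots> = (\<Sum>k\<in>J. gmean (\<lambda>s. c k (act (- s) x)) *s ?\<Phi> k x)"
        by (intro sum.cong refl gmean_linear[OF compact_group cx lin])
      also have "\<dots> = (\<Sum>k\<in>J. invariant_average act X (c k) x *s ?\<Phi> k x)"
        using x by (simp add: invariant_average_def)
      finally show ?thesis .
    qed
    show ?thesis
      by (intro exI[of _ "\<lambda>k. invariant_average act X (c k)"] conjI ballI invariant_average_in ccont main)
  qed
  ultimately show thesis using that[of J "\<lambda>k. case k of (t, i) \<Rightarrow> \<Phi> t i"] by blast
qed

section \<open>From generators of the equivariant maps to module generators\<close>

lemma invariant_functions_sum:
  "(\<And>k. k \<in> K \<Longrightarrow> a k \<in> invariant_functions act X) \<Longrightarrow>
     (\<lambda>x. \<Sum>k\<in>K. a k x) \<in> invariant_functions act X"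
  by (auto simp: invariant_functions_iff intro!: continuous_intros)

lemma invariant_functions_cnj:
  "a \<in> invariant_functions act X \<Longrightarrow> (\<lambda>x. cnj (a x)) \<in> invariant_functions act X"
  by (auto simp: invariant_functions_iff intro!: continuous_intros)

text \<open>Conjugated invariant functions multiply equivariant maps into equivariant maps, so
  closure under combinations is seen on the level of these maps.\<close>

lemma isotypic_component_combination:
  fixes \<rho> :: "'g \<Rightarrow> complex^'n^'n"
  assumes irr: "irreducible_representation \<rho>"
    and a: "\<And>g. g \<in> F \<Longrightarrow> a g \<in> invariant_functions act X"
    and F: "F \<subseteq> isotypic_component act X \<rho>"
  shows "(\<Sum>g\<in>F. a g * g) \<in> isotypic_component act X \<rho>"
proof -
  let ?E = "equivariant_maps act X (contragredient \<rho>)"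
  have "\<forall>g. \<exists>\<Psi>. g \<in> F \<longrightarrow> (\<forall>j. \<Psi> j \<in> ?E) \<and> g = (\<lambda>x. cnj (\<Sum>j\<in>UNIV. \<Psi> j x $ j))"
    using isotypic_imp_cnj_coordinates[OF irreducible_representationD(1)[OF irr]] F by (metis subsetD)
  from choice[OF this] obtain \<Psi> where *: "\<forall>g. g \<in> F \<longrightarrow>
      (\<forall>j. \<Psi> g j \<in> ?E) \<and> g = (\<lambda>x. cnj (\<Sum>j\<in>UNIV. \<Psi> g j x $ j))" by (rule exE)
  define \<Psi>' where "\<Psi>' j = (\<lambda>x. \<Sum>g\<in>F. cnj (a g x) *s \<Psi> g j x)" for j
  have "\<Psi>' j \<in> ?E" for j
    unfolding \<Psi>'_def
  proof (rule equivariant_maps_sum)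
    show "\<Psi> g j \<in> ?E" if "g \<in> F" for g using * that by blast
    show "continuous_on X (\<lambda>x. cnj (a g x))" if "g \<in> F" for g
      using invariant_functions_cnj[OF a[OF that]] by (simp add: invariant_functions_iff)
    show "cnj (a g (act s x)) = cnj (a g x)" if "g \<in> F" "x \<in> X" for g s x
      using a[OF that(1)] that(2) by (simp add: invariant_functions_iff)
  qed
  then have "(\<lambda>x. cnj (\<Sum>j\<in>UNIV. \<Psi>' j x $ j)) \<in> isotypic_component act X \<rho>"
    by (intro cnj_coordinates_in_isotypic[OF irr])
  moreover have "(\<lambda>x. cnj (\<Sum>j\<in>UNIV. \<Psi>' j x $ j)) = (\<Sum>g\<in>F. a g * g)"
  proof
    fix x
    have g: "g x = cnj (\<Sum>j\<in>UNIV. \<Psi> g j x $ j)" if "g \<in> F" for g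
    proof -
      have "g = (\<lambda>x. cnj (\<Sum>j\<in>UNIV. \<Psi> g j x $ j))" using * that by blast
      then show ?thesis by (rule fun_cong)
    qed
    have "cnj (\<Sum>j\<in>UNIV. \<Psi>' j x $ j) = (\<Sum>j\<in>UNIV. \<Sum>g\<in>F. a g x * cnj (\<Psi> g j x $ j))"
      by (simp add: \<Psi>'_def)
    also have "\<dots> = (\<Sum>g\<in>F. \<Sum>j\<in>UNIV. a g x * cnj (\<Psi> g j x $ j))" by (rule sum.swap)
    also have "\<dots> = (\<Sum>g\<in>F. a g x * cnj (\<Sum>j\<in>UNIV. \<Psi> g j x $ j))"
      by (simp add: sum_distrib_left)
    also have "\<dots> = (\<Sum>g\<in>F. a g x * g x)"
      by (intro sum.cong refl arg_cong2[where f = "(*)"]) (simp only: g)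
    finally show "cnj (\<Sum>j\<in>UNIV. \<Psi>' j x $ j) = (\<Sum>g\<in>F. a g * g) x"
      by (simp add: sum_fun_apply)
  qed
  ultimately show ?thesis by simp
qed

text \<open>The conjugates of all coordinates of the generating maps generate the module, since
  conjugation keeps the coefficients invariant.\<close>

lemma equivariant_generators_imp_finitely_generated:
  fixes \<rho> :: "'g \<Rightarrow> complex^'n^'n" and J :: "'j set"
  assumes irr: "irreducible_representation \<rho>" and J: "finite J"
    and \<Phi>: "\<And>k. k \<in> J \<Longrightarrow> \<Phi> k \<in> equivariant_maps act X (contragredient \<rho>)"
    and gen: "\<And>\<psi>. \<psi> \<in> equivariant_maps act X (contragredient \<rho>) \<Longrightarrow>
       \<exists>a. (\<forall>k\<in>J. a k \<in> invariant_functions act X) \<and> (\<forall>x\<in>X. \<psi> x = (\<Sum>k\<in>J. a k x *s \<Phi> k x))"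
  shows "finitely_generated_over (invariant_functions act X) (isotypic_component act X \<rho>)"
proof -
  let ?A = "invariant_functions act X" and ?M = "isotypic_component act X \<rho>"
  let ?E = "equivariant_maps act X (contragredient \<rho>)"
  define K where "K = J \<times> (UNIV :: 'n set)"
  define h where "h = (\<lambda>(k, i) x. cnj (\<Phi> k x $ i))"
  define F where "F = h ` K"
  have "finite K" "finite F" using J by (auto simp: K_def F_def)
  have hM: "h p \<in> ?M" if "p \<in> K" for p
  proof -
    obtain k i where p: "p = (k, i)" "k \<in> J" using \<open>p \<in> K\<close> by (auto simp: K_def)
    have "(\<lambda>x. cnj (\<Sum>j\<in>UNIV. (if j = i then \<Phi> k else (\<lambda>x. 0)) x $ j)) \<in> ?M"
      by (rule cnj_coordinates_in_isotypic[OF irr])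
         (use \<Phi>[OF p(2)] equivariant_maps_zero in auto)
    moreover have "(\<Sum>j\<in>UNIV. (if j = i then \<Phi> k else (\<lambda>x. 0)) x $ j) = \<Phi> k x $ i" for x
      by (simp add: if_distrib[of "\<lambda>f. f x $ _"] cong: if_cong)
    ultimately show ?thesis by (simp add: h_def p(1))
  qed
  then have FM: "F \<subseteq> ?M" by (auto simp: F_def)
  have "\<exists>a. f = (\<Sum>g\<in>F. a g * g) \<and> (\<forall>g\<in>F. a g \<in> ?A)" if f: "f \<in> ?M" for f
  proof -
    obtain \<Psi> where \<Psi>: "\<And>i. \<Psi> i \<in> ?E" and f: "f = (\<lambda>x. cnj (\<Sum>i\<in>UNIV. \<Psi> i x $ i))"
      by (rule isotypic_imp_cnj_coordinates[OF irreducible_representationD(1)[OF irr] f]) (rule that)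
    have "\<forall>i. \<exists>a. (\<forall>k\<in>J. a k \<in> ?A) \<and> (\<forall>x\<in>X. \<Psi> i x = (\<Sum>k\<in>J. a k x *s \<Phi> k x))"
      using gen[OF \<Psi>] by (rule allI)
    from choice[OF this] obtain a
      where "\<forall>i. (\<forall>k\<in>J. a i k \<in> ?A) \<and> (\<forall>x\<in>X. \<Psi> i x = (\<Sum>k\<in>J. a i k x *s \<Phi> k x))" by (rule exE)
    then have a: "\<And>i k. k \<in> J \<Longrightarrow> a i k \<in> ?A" "\<And>i x. x \<in> X \<Longrightarrow> \<Psi> i x = (\<Sum>k\<in>J. a i k x *s \<Phi> k x)"
      by blast+
    define b where "b = (\<lambda>(k, i) x. cnj (a i k x))"
    have b: "b p \<in> ?A" if "p \<in> K" for p
      using that a(1) by (auto simp: b_def K_def intro!: invariant_functions_cnj)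
    have fx: "f x = (\<Sum>p\<in>K. b p x * h p x)" for x
    proof (cases "x \<in> X")
      case True
      have "f x = (\<Sum>i\<in>UNIV. \<Sum>k\<in>J. b (k, i) x * h (k, i) x)"
        using True by (simp add: f a(2) b_def h_def)
      also have "\<dots> = (\<Sum>k\<in>J. \<Sum>i\<in>UNIV. b (k, i) x * h (k, i) x)" by (rule sum.swap)
      also have "\<dots> = (\<Sum>p\<in>K. b p x * h p x)"
        unfolding K_def by (simp add: sum.cartesian_product case_prod_unfold)
      finally show ?thesis .
    next
      case False
      then have "b p x = 0" if "p \<in> K" for p using b[OF that] by (simp add: invariant_functions_iff)
      moreover have "f x = 0" using False equivariant_mapsD(2)[OF \<Psi>] by (simp add: f)
      ultimately show ?thesis by simp
    qed
    \<comment> \<open>Different pairs may give the same function, whereas \<open>F\<close> is a set;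
      their coefficients are added up.\<close>
    define c where "c g = (\<lambda>x. \<Sum>p | p \<in> K \<and> h p = g. b p x)" for g
    have "c g \<in> ?A" for g
      unfolding c_def by (rule invariant_functions_sum) (use b in auto)
    moreover have "f = (\<Sum>g\<in>F. c g * g)"
    proof
      fix x
      have "f x = (\<Sum>g\<in>F. \<Sum>p | p \<in> K \<and> h p = g. b p x * h p x)"
        unfolding fx F_def by (rule sum.image_gen[OF \<open>finite K\<close>])
      also have "\<dots> = (\<Sum>g\<in>F. c g x * g x)"
        by (intro sum.cong refl) (simp add: c_def sum_distrib_right)
      finally show "f x = (\<Sum>g\<in>F. c g * g) x" by (simp add: sum_fun_apply)
    qed
    ultimately show ?thesis by blast
  qed
  moreover have "(\<Sum>g\<in>F. a g * g) \<in> ?M" if "\<forall>g\<in>F. a g \<in> ?A" for a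
    by (rule isotypic_component_combination[OF irr _ FM]) (use that in blast)
  ultimately have "?M = {\<Sum>g\<in>F. a g * g | a. \<forall>g\<in>F. a g \<in> ?A}" by blast
  then show ?thesis
    unfolding finitely_generated_over_def using \<open>finite F\<close> FM by blast
qed

end

subsection \<open>Finite generation implies locally constant dimension\<close>

text \<open>The minimum of |\<sigma> s v| over the group and the unit sphere is attained by
  compactness and positive by invertibility; homogeneity does the rest.\<close>

lemma norm_lower_bound_representation:
  fixes \<sigma> :: "'g::topological_group_add \<Rightarrow> complex^'n^'n"
  assumes comp: "compact (UNIV :: 'g set)" and \<sigma>: "representation \<sigma>"
  obtains c where "c > 0" "\<And>s v. c * norm v \<le> norm (\<sigma> s *v v)"
proof -
  let ?K = "(UNIV :: 'g set) \<times> sphere (0 :: complex^'n) 1"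
  have K: "compact ?K" using comp by (intro compact_Times) auto
  obtain u :: "complex^'n" where "norm u = 1" using vector_choose_size[of 1] by auto
  then have ne: "?K \<noteq> {}" by auto
  have cont: "continuous_on ?K (\<lambda>p. norm (\<sigma> (fst p) *v snd p))"
    by (intro continuous_intros continuous_on_compose2[OF continuous_on_representation[OF \<sigma>]]) auto
  obtain p where p: "p \<in> ?K" "\<And>r. r \<in> ?K \<Longrightarrow> norm (\<sigma> (fst p) *v snd p) \<le> norm (\<sigma> (fst r) *v snd r)"
    using continuous_attains_inf[OF K ne cont] by blast
  define c where "c = norm (\<sigma> (fst p) *v snd p)"
  have "\<sigma> (- fst p) *v (\<sigma> (fst p) *v snd p) = snd p" using \<sigma> by simp
  then have "\<sigma> (fst p) *v snd p \<noteq> 0" using p(1) by auto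
  then have "c > 0" by (simp add: c_def)
  moreover have "c * norm v \<le> norm (\<sigma> s *v v)" for s v
  proof (cases "v = 0")
    case False
    have "c \<le> norm (\<sigma> s *v (v /\<^sub>R norm v))"
      using p(2)[of "(s, v /\<^sub>R norm v)"] False by (simp add: c_def)
    also have "\<sigma> s *v (v /\<^sub>R norm v) = (\<sigma> s *v v) /\<^sub>R norm v"
      by (rule linear_cmul[OF matrix_vector_mul_linear])
    finally show ?thesis using False by (simp add: field_simps)
  qed simp
  ultimately show thesis by (rule that)
qed

context compact_group_action
begin

text \<open>
  Dividing by the square root of an invariant norm keeps a map continuous and equivariant; this is
  what turns a bound on coefficients into a contraction near a zero of the map.
\<close>

lemma equivariant_sqrt_quotient:
  fixes \<sigma> :: "'g \<Rightarrow> complex^'n^'n"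
  assumes \<sigma>: "representation \<sigma>" and \<psi>: "\<psi> \<in> equivariant_maps act X \<sigma>"
  shows "\<exists>\<epsilon> \<eta>. continuous_on X \<epsilon> \<and> (\<forall>x\<in>X. 0 \<le> \<epsilon> x \<and> (\<psi> x = 0 \<longrightarrow> \<epsilon> x = 0)) \<and>
     \<eta> \<in> equivariant_maps act X \<sigma> \<and> (\<forall>x\<in>X. \<psi> x = of_real (\<epsilon> x) *s \<eta> x)"
proof -
  obtain c where c: "c > 0" "\<And>s v. c * norm v \<le> norm (\<sigma> s *v v)"
    by (rule norm_lower_bound_representation[OF compact_group \<sigma>]) (rule that)
  \<comment> \<open>As \<open>\<sigma>\<close> need not be isometric, the norm of
    \<open>\<psi>\<close> is made invariant by averaging; the result has the same zeros and
    dominates a multiple of the norm.\<close>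
  define H where "H = invariant_average act X (\<lambda>x. of_real (norm (\<psi> x)))"
  have nc: "continuous_on X (\<lambda>x. complex_of_real (norm (\<psi> x)))"
    by (intro continuous_intros equivariant_mapsD(1)[OF \<psi>])
  have H: "H \<in> invariant_functions act X"
    unfolding H_def by (rule invariant_average_in[OF nc])
  define h where "h x = Re (H x)" for x
  have h_cont: "continuous_on X h" and h_inv: "\<And>s x. x \<in> X \<Longrightarrow> h (act s x) = h x"
    using H by (auto simp: h_def invariant_functions_iff intro!: continuous_intros)
  have h_lower: "c * norm (\<psi> x) \<le> h x" if x: "x \<in> X" for x
  proof -
    have "c * norm (\<psi> x) \<le> norm (\<psi> (act (- s) x))" for s
      using c(2)[of "\<psi> x" "- s"] equivariant_mapsD(3)[OF \<psi> x, of "- s"] by simp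
    then have "gmean (\<lambda>s. complex_of_real (norm (\<psi> (act (- s) x)))) \<in> {z. Re z \<ge> c * norm (\<psi> x)}"
      by (intro gmean_in_closed_convex[OF compact_group] closed_halfspace_Re_ge convex_halfspace_Re_ge
          continuous_on_translated_group[OF nc x]) auto
    then show ?thesis using x by (simp add: h_def H_def invariant_average_def)
  qed
  have h_nonneg: "0 \<le> h x" if "x \<in> X" for x
    using h_lower[OF that] c(1) by (meson order_trans mult_nonneg_nonneg less_imp_le norm_ge_zero)
  have h_zero: "h x = 0" if x: "x \<in> X" and "\<psi> x = 0" for x
  proof -
    have "\<psi> (act (- s) x) = 0" for s using equivariant_mapsD(3)[OF \<psi> x, of "- s"] that(2) by simp
    then show ?thesis using x by (simp add: h_def H_def invariant_average_def gmean_const[OF compact_group])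
  qed
  define \<epsilon> where "\<epsilon> x = sqrt (h x)" for x
  \<comment> \<open>Where \<open>\<epsilon> x = 0\<close> the convention \<open>1 / 0 = 0\<close>
    gives the value 0, the limit required there.\<close>
  define \<eta> where "\<eta> x = (1 / \<epsilon> x) *\<^sub>R \<psi> x" for x
  have \<epsilon>: "continuous_on X \<epsilon>" unfolding \<epsilon>_def by (intro continuous_intros h_cont)
  have \<psi>\<eta>: "\<psi> x = \<epsilon> x *\<^sub>R \<eta> x" if "x \<in> X" for x
  proof (cases "\<psi> x = 0")
    case False
    then have "0 < c * norm (\<psi> x)" using c(1) by simp
    then have "\<epsilon> x \<noteq> 0" using h_lower[OF that] by (simp add: \<epsilon>_def)
    then show ?thesis by (simp add: \<eta>_def)
  qed (simp add: \<eta>_def)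
  \<comment> \<open>From c |\<psi>| \<le> h = \<epsilon>^2. This bound gives continuity of
    \<open>\<eta>\<close> at the zeros of \<open>\<epsilon>\<close>.\<close>
  have \<eta>_bound: "norm (\<eta> x) \<le> \<epsilon> x / c" if x: "x \<in> X" for x
  proof (cases "h x = 0")
    case False
    then have "h x > 0" using h_nonneg[OF x] by simp
    have "norm (\<eta> x) = norm (\<psi> x) / \<epsilon> x" using h_nonneg[OF x] by (simp add: \<eta>_def \<epsilon>_def)
    also have "\<dots> \<le> (h x / c) / \<epsilon> x"
      using h_lower[OF x] c(1) h_nonneg[OF x]
      by (intro divide_right_mono) (auto simp: field_simps \<epsilon>_def)
    also have "\<dots> = (h x / \<epsilon> x) / c" by simp
    also have "h x / \<epsilon> x = \<epsilon> x" using \<open>h x > 0\<close> by (simp add: \<epsilon>_def real_div_sqrt)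
    finally show ?thesis .
  qed (simp add: \<eta>_def \<epsilon>_def)
  have "\<eta> \<in> equivariant_maps act X \<sigma>"
  proof (rule equivariant_mapsI)
    show "continuous_on X \<eta>"
      unfolding continuous_on_def
    proof
      fix x assume x: "x \<in> X"
      show "(\<eta> \<longlongrightarrow> \<eta> x) (at x within X)"
      proof (cases "\<epsilon> x = 0")
        case True
        have "((\<lambda>y. \<epsilon> y / c) \<longlongrightarrow> \<epsilon> x / c) (at x within X)"
          using \<epsilon> x c(1) unfolding continuous_on_def by (intro tendsto_intros) auto
        then have lim: "((\<lambda>y. \<epsilon> y / c) \<longlongrightarrow> 0) (at x within X)" using True by simp
        have "(\<eta> \<longlongrightarrow> 0) (at x within X)"
          by (rule Lim_null_comparison[OF _ lim]) (auto simp: eventually_at_filter intro!: \<eta>_bound always_eventually)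
        then show ?thesis using True by (simp add: \<eta>_def)
      next
        case False
        show ?thesis
          unfolding \<eta>_def using \<epsilon> equivariant_mapsD(1)[OF \<psi>] x False
          unfolding continuous_on_def by (intro tendsto_intros) auto
      qed
    qed
    show "\<eta> x = 0" if "x \<notin> X" for x using that equivariant_mapsD(2)[OF \<psi>] by (simp add: \<eta>_def)
    show "\<eta> (act s x) = \<sigma> s *v \<eta> x" if x: "x \<in> X" for s x
      unfolding \<eta>_def \<epsilon>_def h_inv[OF x] equivariant_mapsD(3)[OF \<psi> x]
      by (rule linear_cmul[OF matrix_vector_mul_linear, symmetric])
  qed
  moreover have "of_real r *s v = r *\<^sub>R v" for r and v :: "complex^'n"
    by (simp add: vec_eq_iff scaleR_conv_of_real[where 'a = complex])
  ultimately show ?thesis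
    using \<epsilon> \<psi>\<eta> h_nonneg h_zero by (intro exI[of _ \<epsilon>] exI[of _ \<eta>]) (simp add: \<epsilon>_def)
qed

text \<open>The frame prevents a drop of the dimension, the contraction a rise: if all generators
  lie in the span of the frame at x, so do all fixed vectors, since each is the value of an
  equivariant map.\<close>

lemma equivariant_generators_imp_locally_constant:
  fixes \<sigma> :: "'g \<Rightarrow> complex^'n^'n" and J :: "'j set"
  assumes \<sigma>: "representation \<sigma>" and J: "finite J"
    and \<psi>: "\<And>k. k \<in> J \<Longrightarrow> \<psi> k \<in> equivariant_maps act X \<sigma>"
    and gen: "\<And>\<eta>. \<eta> \<in> equivariant_maps act X \<sigma> \<Longrightarrow>
       \<exists>a. (\<forall>k\<in>J. continuous_on X (a k)) \<and> (\<forall>x\<in>X. \<eta> x = (\<Sum>k\<in>J. a k x *s \<psi> k x))"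
  shows "locally (\<lambda>U. (\<lambda>x. vec.dim (fixed_vectors \<sigma> (isotropy act x))) constant_on U) X"
  unfolding locally_constant_on_iff
proof
  let ?E = "equivariant_maps act X \<sigma>"
  fix x0 assume x0: "x0 \<in> X"
  from frame_exists[OF \<sigma> x0] obtain S \<Phi> w where \<Phi>: "\<forall>k\<in>S. \<Phi> k \<in> ?E"
    and det0: "det (frame_matrix S \<Phi> w x0) \<noteq> 0"
    and card: "card S = vec.dim (fixed_vectors \<sigma> (isotropy act x0))" by (elim exE conjE)
  have \<Phi>: "\<And>k. k \<in> S \<Longrightarrow> \<Phi> k \<in> ?E" using \<Phi> by blast
  define B where "B = frame_matrix S \<Phi> w"
  let ?U = "supported_vectors S"
  have Bcont: "continuous_on X B" unfolding B_def by (rule continuous_on_frame_matrix[OF \<Phi>])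
  have "fixed_vectors \<sigma> (isotropy act x0) \<subseteq> (*v) (B x0) ` ?U"
    using frame_dim[OF \<Phi> x0 det0] card unfolding B_def by simp
  then have "\<forall>k. \<exists>c. k \<in> J \<longrightarrow> c \<in> ?U \<and> \<psi> k x0 = B x0 *v c"
    using equivariant_value_fixed[OF \<psi> x0] by blast
  from choice[OF this] obtain c where c: "\<forall>k. k \<in> J \<longrightarrow> c k \<in> ?U \<and> \<psi> k x0 = B x0 *v c k"
    by (rule exE)
  \<comment> \<open>Subtracting the frame combination with the coefficients valid at
    \<open>x0\<close> makes the map vanish at \<open>x0\<close> without changing it modulo the frame
    at other points.\<close>
  define \<psi>' where "\<psi>' k = (\<lambda>x. \<psi> k x - (\<Sum>i\<in>S. c k $ i *s \<Phi> i x))" for k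
  have \<psi>'E: "\<psi>' k \<in> ?E" if k: "k \<in> J" for k
  proof -
    have sumE: "(\<lambda>x. \<Sum>i\<in>S. c k $ i *s \<Phi> i x) \<in> ?E"
      by (rule equivariant_maps_sum) (auto simp: \<Phi>)
    show ?thesis
      unfolding \<psi>'_def
    proof (rule equivariant_mapsI)
      show "continuous_on X (\<lambda>x. \<psi> k x - (\<Sum>i\<in>S. c k $ i *s \<Phi> i x))"
        by (intro continuous_on_diff equivariant_mapsD(1)[OF \<psi>[OF k]] equivariant_mapsD(1)[OF sumE])
      show "\<psi> k x - (\<Sum>i\<in>S. c k $ i *s \<Phi> i x) = 0" if "x \<notin> X" for x
        using equivariant_mapsD(2)[OF \<psi>[OF k] that] equivariant_mapsD(2)[OF sumE that] by simp
      show "\<psi> k (act s x) - (\<Sum>i\<in>S. c k $ i *s \<Phi> i (act s x)) =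
          \<sigma> s *v (\<psi> k x - (\<Sum>i\<in>S. c k $ i *s \<Phi> i x))" if "x \<in> X" for s x
        using equivariant_mapsD(3)[OF \<psi>[OF k] that] equivariant_mapsD(3)[OF sumE that]
        by (simp add: vec.diff)
    qed
  qed
  have \<psi>'B: "\<psi>' k x = \<psi> k x - B x *v c k" if "k \<in> J" for k x
    using c that by (simp add: \<psi>'_def B_def frame_matrix_mult)
  have "\<forall>k. \<exists>p. k \<in> J \<longrightarrow> (case p of (\<epsilon>, \<eta>) \<Rightarrow>
      continuous_on X \<epsilon> \<and> (\<forall>x\<in>X. 0 \<le> \<epsilon> x \<and> (\<psi>' k x = 0 \<longrightarrow> \<epsilon> x = 0)) \<and>
      \<eta> \<in> ?E \<and> (\<forall>x\<in>X. \<psi>' k x = of_real (\<epsilon> x) *s \<eta> x))"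
    using equivariant_sqrt_quotient[OF \<sigma> \<psi>'E] by fast
  from choice[OF this] obtain p where p: "\<forall>k. k \<in> J \<longrightarrow> (case p k of (\<epsilon>, \<eta>) \<Rightarrow>
      continuous_on X \<epsilon> \<and> (\<forall>x\<in>X. 0 \<le> \<epsilon> x \<and> (\<psi>' k x = 0 \<longrightarrow> \<epsilon> x = 0)) \<and>
      \<eta> \<in> ?E \<and> (\<forall>x\<in>X. \<psi>' k x = of_real (\<epsilon> x) *s \<eta> x))" by (rule exE)
  define \<epsilon> where "\<epsilon> k = fst (p k)" for k
  define \<eta> where "\<eta> k = snd (p k)" for k
  have \<epsilon>: "continuous_on X (\<epsilon> k)" "\<And>x. x \<in> X \<Longrightarrow> 0 \<le> \<epsilon> k x"
      "\<And>x. x \<in> X \<Longrightarrow> \<psi>' k x = 0 \<Longrightarrow> \<epsilon> k x = 0"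
    and \<eta>: "\<eta> k \<in> ?E" "\<And>x. x \<in> X \<Longrightarrow> \<psi>' k x = of_real (\<epsilon> k x) *s \<eta> k x" if "k \<in> J" for k
    using p[rule_format, OF that] unfolding \<epsilon>_def \<eta>_def case_prod_unfold by blast+
  have "\<forall>k. \<exists>a. k \<in> J \<longrightarrow> (\<forall>l\<in>J. continuous_on X (a l)) \<and> (\<forall>x\<in>X. \<eta> k x = (\<Sum>l\<in>J. a l x *s \<psi> l x))"
    using gen[OF \<eta>(1)] by blast
  from choice[OF this] obtain a where "\<forall>k. k \<in> J \<longrightarrow>
      (\<forall>l\<in>J. continuous_on X (a k l)) \<and> (\<forall>x\<in>X. \<eta> k x = (\<Sum>l\<in>J. a k l x *s \<psi> l x))" by (rule exE)
  then have a: "\<And>k l. k \<in> J \<Longrightarrow> l \<in> J \<Longrightarrow> continuous_on X (a k l)"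
    "\<And>k x. k \<in> J \<Longrightarrow> x \<in> X \<Longrightarrow> \<eta> k x = (\<Sum>l\<in>J. a k l x *s \<psi> l x)" by blast+
  have "\<forall>q. \<exists>M. q \<in> J \<times> J \<longrightarrow> (\<forall>x\<in>X. norm (a (fst q) (snd q) x) \<le> M)"
  proof
    fix q :: "'j \<times> 'j"
    show "\<exists>M. q \<in> J \<times> J \<longrightarrow> (\<forall>x\<in>X. norm (a (fst q) (snd q) x) \<le> M)"
    proof (cases "q \<in> J \<times> J")
      case True
      then have "compact (a (fst q) (snd q) ` X)"
        using a(1) by (intro compact_continuous_image compact_space) auto
      then have "bounded (a (fst q) (snd q) ` X)" by (rule compact_imp_bounded)
      then show ?thesis by (auto simp: bounded_iff)
    qed blast
  qed
  from choice[OF this] obtain M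
    where M: "\<forall>q. q \<in> J \<times> J \<longrightarrow> (\<forall>x\<in>X. norm (a (fst q) (snd q) x) \<le> M q)" by (rule exE)
  \<comment> \<open>A common bound for all coefficients; the sum stands in for a maximum and also
    makes sense for empty \<open>J\<close>.\<close>
  define C where "C = (\<Sum>q\<in>J \<times> J. \<bar>M q\<bar>)"
  have C: "norm (a k l x) \<le> C" if "k \<in> J" "l \<in> J" "x \<in> X" for k l x
  proof -
    have "norm (a k l x) \<le> M (k, l)" using M that by force
    also have "\<dots> \<le> \<bar>M (k, l)\<bar>" by simp
    also have "\<dots> \<le> C"
      unfolding C_def using that J by (intro member_le_sum[where f = "\<lambda>q. \<bar>M q\<bar>"]) auto
    finally show ?thesis .
  qed
  have "C \<ge> 0" by (simp add: C_def sum_nonneg)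
  \<comment> \<open>The contraction factor of the final estimate, zero at \<open>x0\<close> because
    every \<open>\<psi>' k\<close> vanishes there.\<close>
  define \<delta> where "\<delta> x = C * (\<Sum>k\<in>J. \<epsilon> k x)" for x
  have \<delta>cont: "continuous_on X \<delta>" unfolding \<delta>_def by (intro continuous_intros \<epsilon>(1))
  have "\<delta> x0 = 0"
  proof -
    have "\<psi>' k x0 = 0" if "k \<in> J" for k using c that by (simp add: \<psi>'B)
    then show ?thesis using \<epsilon>(3) x0 by (simp add: \<delta>_def)
  qed
  define V where "V = (X \<inter> (\<lambda>x. det (B x)) -` (- {0})) \<inter> (X \<inter> \<delta> -` {..<1})"
  have "openin (top_of_set X) V"
    unfolding V_def
    by (rule openin_Int; rule continuous_openin_preimage_gen)
       (auto intro!: \<delta>cont continuous_on_det Bcont)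
  moreover have "x0 \<in> V" using x0 det0 \<open>\<delta> x0 = 0\<close> by (simp add: V_def B_def)
  moreover have "vec.dim (fixed_vectors \<sigma> (isotropy act x)) = vec.dim (fixed_vectors \<sigma> (isotropy act x0))"
    if "x \<in> V" for x
  proof -
    have x: "x \<in> X" and det: "det (B x) \<noteq> 0" and \<delta>: "\<delta> x < 1" using that by (auto simp: V_def)
    obtain R where R: "R ** B x = mat 1"
      using det invertible_det_nz[of "B x"] invertible_left_inverse[of "B x"] by blast
    have B_inv: "B x ** R = mat 1" using R matrix_left_right_inverse by blast
    \<comment> \<open>A seminorm: the size of the coordinates outside \<open>S\<close> in the basis
      formed by the columns of \<open>B x\<close>. Its kernel is the span of the frame at x.\<close>
    define Y where "Y v = (\<Sum>i\<in>- S. norm ((R *v v) $ i))" for v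
    have Y_nonneg: "0 \<le> Y v" for v by (simp add: Y_def sum_nonneg)
    have Y_add: "Y (u + v) \<le> Y u + Y v" for u v
      unfolding Y_def sum.distrib[symmetric] by (intro sum_mono) (simp add: vec.add norm_triangle_ineq)
    have Y_scale: "Y (z *s v) = norm z * Y v" for z v
      unfolding Y_def by (simp add: vec.scale norm_mult sum_distrib_left)
    have Y_sum: "Y (\<Sum>l\<in>L. f l) \<le> (\<Sum>l\<in>L. Y (f l))" if "finite L" for L :: "'j set" and f
      using that
    proof (induction L rule: finite_induct)
      case (insert l L)
      then show ?case using Y_add[of "f l" "\<Sum>l\<in>L. f l"] by simp
    qed (simp add: Y_def)
    have Y_zero: "Y v = 0 \<longleftrightarrow> v \<in> (*v) (B x) ` ?U" for v
    proof
      assume "Y v = 0"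
      then have "R *v v \<in> ?U"
        by (simp add: Y_def sum_nonneg_eq_0_iff supported_vectors_def)
      moreover have "v = B x *v (R *v v)" by (simp add: matrix_vector_mul_assoc B_inv)
      ultimately show "v \<in> (*v) (B x) ` ?U" by blast
    next
      assume "v \<in> (*v) (B x) ` ?U"
      then show "Y v = 0" by (auto simp: Y_def matrix_vector_mul_assoc R supported_vectors_def)
    qed
    have Y\<psi>: "Y (\<psi> l x) \<le> Y (\<psi>' l x)" if "l \<in> J" for l
    proof -
      have "Y (B x *v c l) = 0" using c that by (subst Y_zero) blast
      then show ?thesis using Y_add[of "\<psi>' l x" "B x *v c l"] that by (simp add: \<psi>'B)
    qed
    have Y\<eta>: "Y (\<eta> k x) \<le> C * (\<Sum>l\<in>J. Y (\<psi>' l x))" if k: "k \<in> J" for k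
    proof -
      have "Y (\<eta> k x) \<le> (\<Sum>l\<in>J. norm (a k l x) * Y (\<psi> l x))"
        using Y_sum[OF J, of "\<lambda>l. a k l x *s \<psi> l x"] by (simp add: a(2)[OF k x] Y_scale)
      also have "\<dots> \<le> (\<Sum>l\<in>J. C * Y (\<psi>' l x))"
        by (intro sum_mono mult_mono C k x Y\<psi> \<open>C \<ge> 0\<close> Y_nonneg)
      finally show ?thesis by (simp add: sum_distrib_left)
    qed
    \<comment> \<open>From \<psi>' = \<epsilon> \<eta> and the bound on
      \<open>Y (\<eta> k x)\<close> by C Z one gets Z \<le> \<delta> x Z, and \<delta> x < 1 forces
      Z = 0.\<close>
    define Z where "Z = (\<Sum>l\<in>J. Y (\<psi>' l x))"
    have "Z \<ge> 0" by (simp add: Z_def sum_nonneg Y_nonneg)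
    have "Z = (\<Sum>k\<in>J. \<epsilon> k x * Y (\<eta> k x))"
      unfolding Z_def using \<epsilon>(2)[OF _ x] by (intro sum.cong refl) (simp add: \<eta>(2)[OF _ x] Y_scale)
    also have "\<dots> \<le> (\<Sum>k\<in>J. \<epsilon> k x * (C * Z))"
      unfolding Z_def by (intro sum_mono mult_left_mono Y\<eta> \<epsilon>(2) x)
    also have "\<dots> = \<delta> x * Z" by (simp add: \<delta>_def sum_distrib_left sum_distrib_right mult_ac)
    finally have "Z \<le> \<delta> x * Z" .
    then have "(1 - \<delta> x) * Z \<le> 0" by (simp add: algebra_simps)
    then have "Z = 0" using \<delta> \<open>Z \<ge> 0\<close> by (simp add: mult_le_0_iff)
    then have Y\<psi>0: "Y (\<psi> l x) = 0" if "l \<in> J" for l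
    proof -
      have "Y (\<psi>' l x) = 0"
        using \<open>Z = 0\<close> J that by (simp add: Z_def sum_nonneg_eq_0_iff Y_nonneg)
      then show ?thesis using Y\<psi>[OF that] Y_nonneg[of "\<psi> l x"] by simp
    qed
    have "fixed_vectors \<sigma> (isotropy act x) \<subseteq> (*v) (B x) ` ?U"
    proof
      fix v assume "v \<in> fixed_vectors \<sigma> (isotropy act x)"
      then obtain \<phi> where \<phi>: "\<phi> \<in> ?E" "\<phi> x = v" by (rule equivariant_extension[OF \<sigma> x])
      from gen[OF \<phi>(1)] obtain b where b: "\<forall>x\<in>X. \<phi> x = (\<Sum>k\<in>J. b k x *s \<psi> k x)" by blast
      have "Y v \<le> (\<Sum>k\<in>J. Y (b k x *s \<psi> k x))"
        using Y_sum[OF J, of "\<lambda>k. b k x *s \<psi> k x"] b x \<phi>(2) by simp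
      also have "\<dots> = 0" by (simp add: Y_scale Y\<psi>0)
      finally have "Y v = 0" using Y_nonneg[of v] by simp
      then show "v \<in> (*v) (B x) ` ?U" by (simp only: Y_zero)
    qed
    then show ?thesis using frame_dim[OF \<Phi> x det[unfolded B_def]] card unfolding B_def by simp
  qed
  ultimately show "\<exists>V. openin (top_of_set X) V \<and> x0 \<in> V \<and>
      (\<forall>y\<in>V. vec.dim (fixed_vectors \<sigma> (isotropy act y)) = vec.dim (fixed_vectors \<sigma> (isotropy act x0)))"
    by blast
qed

end

theorem theoremA:
  fixes act :: "'g::{topological_group_add, t2_space} \<Rightarrow> 'x::t2_space \<Rightarrow> 'x"
    and X :: "'x set"
    and \<alpha> :: "'g \<Rightarrow> complex^'n^'n"
  assumes "compact (UNIV :: 'g set)"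
    and "compact X"
    and "continuous_action act X"
    and "irreducible_representation \<alpha>"
  shows "finitely_generated_over (invariant_functions act X) (isotypic_component act X \<alpha>) \<longleftrightarrow>
         locally (\<lambda>U. (\<lambda>x. vec.dim (fixed_vectors \<alpha> (isotropy act x))) constant_on U) X"
proof -
  interpret compact_group_action act X
    using assms by (simp add: compact_group_action_def)
  have \<alpha>: "representation \<alpha>" by (rule irreducible_representationD(1)[OF assms(4)])
  note \<sigma> = representation_contragredient[OF \<alpha>]
  note dim = dim_fixed_vectors_contragredient[OF assms(1) \<alpha>]
  show ?thesis
  proof
    assume "finitely_generated_over (invariant_functions act X) (isotypic_component act X \<alpha>)"
    then show "locally (\<lambda>U. (\<lambda>x. vec.dim (fixed_vectors \<alpha> (isotropy act x))) constant_on U) X"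
    proof (rule finitely_generated_imp_equivariant_generators[OF assms(4)])
      fix J :: "(('x \<Rightarrow> complex) \<times> 'n) set" and \<psi>
      assume "finite J" "\<And>k. k \<in> J \<Longrightarrow> \<psi> k \<in> equivariant_maps act X (contragredient \<alpha>)"
        "\<And>\<eta>. \<eta> \<in> equivariant_maps act X (contragredient \<alpha>) \<Longrightarrow>
           \<exists>a. (\<forall>k\<in>J. continuous_on X (a k)) \<and> (\<forall>x\<in>X. \<eta> x = (\<Sum>k\<in>J. a k x *s \<psi> k x))"
      from equivariant_generators_imp_locally_constant[OF \<sigma> this]
      show ?thesis by (simp only: dim)
    qed
  next
    assume "locally (\<lambda>U. (\<lambda>x. vec.dim (fixed_vectors \<alpha> (isotropy act x))) constant_on U) X"
    then have "locally (\<lambda>U. (\<lambda>x. vec.dim (fixed_vectors (contragredient \<alpha>) (isotropy act x))) constant_on U) X"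
      by (simp only: dim)
    then show "finitely_generated_over (invariant_functions act X) (isotypic_component act X \<alpha>)"
    proof (rule locally_constant_imp_equivariant_generators[OF \<sigma>])
      fix J :: "('x \<times> 'n) set" and \<Phi>
      assume "finite J" "\<And>k. k \<in> J \<Longrightarrow> \<Phi> k \<in> equivariant_maps act X (contragredient \<alpha>)"
        "\<And>\<psi>. \<psi> \<in> equivariant_maps act X (contragredient \<alpha>) \<Longrightarrow>
           \<exists>a. (\<forall>k\<in>J. a k \<in> invariant_functions act X) \<and> (\<forall>x\<in>X. \<psi> x = (\<Sum>k\<in>J. a k x *s \<Phi> k x))"
      from equivariant_generators_imp_finitely_generated[OF assms(4) this]
      show ?thesis .
    qed
  qed
qed

end
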